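(* Let $\mathcal{H}$ be a separable infinite-dimensional real Hilbert space, $X$ an isonormal Gaussian process on $\mathcal{H}$, $K\subset\mathcal{H}$ a GB convex body and $h_K(X)$ its support function. Then the closed convex hull of the essential range of the Malliavin derivative of $h_K(X)$ is $K$: $$\overline{\mathrm{co}}\big(\mathrm{ess}(Dh_K(X))\big)=K.$$
   Context: An isonormal Gaussian process on $\mathcal{H}$ is a family $X=(X_v)_{v\in\mathcal{H}}$ of centred jointly Gaussian random variables on a probability space $(\Omega,\mathcal{F},\mathbb{P})$ with $\mathbb{E}[X_vX_u]=(v,u)_{\mathcal{H}}$ and $X_{av+bu}=aX_v+bX_u$. A convex body in $\mathcal{H}$ is a non-empty compact convex subset; it is Gaussian bounded (GB) if for every countable $C\subset K$, $\sup_{v\in C}X_v<\infty$ almost surely. The support function is the random variable $h_K(X)=\sup_{v\in K}X_v$ (supremum over any countable dense subset of $K$). Malliavin derivative: for $\varphi=f(X_{v_1},\dots,X_{v_n})$ with $f$ smooth and all its derivatives of at most polynomial growth, $D\varphi=\sum_j\partial_jf(X_{v_1},\dots,X_{v_n})v_j$; $D$ also denotes the closure of this operator from $L^2(\Omega)$ to $L^2(\Omega;\mathcal{H})$, with domain $\mathbb{D}^{1,2}$. For every GB convex body $K$, $h_K(X)\in\mathbb{D}^{1,2}$. The essential range of $\mathbf{f}\in L^2(\Omega;\mathcal{H})$ is $\mathrm{ess}(\mathbf{f})=\bigcap_{\mathbf{u}=\mathbf{f}\text{ a.s.}}\overline{\mathbf{u}(\Omega)}$. *)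

theory Defs
  imports "HOL-Probability.Probability"
begin

text \<open>Point masses are Gaussian (variance zero).\<close>

definition gaussian_rv :: "'a measure \<Rightarrow> ('a \<Rightarrow> real) \<Rightarrow> bool" where
  "gaussian_rv M Y \<longleftrightarrow>
     Y \<in> borel_measurable M \<and>
     ((\<exists>\<mu>. AE \<omega> in M. Y \<omega> = \<mu>) \<or>
      (\<exists>\<mu> \<sigma>. \<sigma> > 0 \<and> distributed M lborel Y (normal_density \<mu> \<sigma>)))"

definition jointly_gaussian :: "'a measure \<Rightarrow> ('i \<Rightarrow> 'a \<Rightarrow> real) \<Rightarrow> bool" where
  "jointly_gaussian M X \<longleftrightarrow>
     (\<forall>I c. finite I \<longrightarrow> gaussian_rv M (\<lambda>\<omega>. \<Sum>i\<in>I. c i * X i \<omega>))"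

locale isonormal_gaussian_process = prob_space M
  for M :: "'a measure" +
  fixes X :: "'h::{real_inner, banach, second_countable_topology} \<Rightarrow> 'a \<Rightarrow> real"
  assumes jointly_gaussian: "jointly_gaussian M X"
    and centred: "expectation (X v) = 0"
    and covariance: "expectation (\<lambda>\<omega>. X v \<omega> * X u \<omega>) = v \<bullet> u"
    and linear: "AE \<omega> in M. X (a *\<^sub>R v + b *\<^sub>R u) \<omega> = a * X v \<omega> + b * X u \<omega>"

definition convex_body :: "'h::real_normed_vector set \<Rightarrow> bool" where
  "convex_body K \<longleftrightarrow> K \<noteq> {} \<and> compact K \<and> convex K"

definition gaussian_bounded :: "'a measure \<Rightarrow> ('h \<Rightarrow> 'a \<Rightarrow> real) \<Rightarrow> 'h set \<Rightarrow> bool" where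
  "gaussian_bounded M X K \<longleftrightarrow>
     (\<forall>C. countable C \<and> C \<subseteq> K \<longrightarrow> (AE \<omega> in M. bdd_above ((\<lambda>v. X v \<omega>) ` C)))"

text \<open>
  For a GB convex body \<open>K\<close>, its support function \<open>h\<^sub>K(X)\<close> is \<open>support_rv X C\<close> for any countable
  dense subset \<open>C\<close> of \<open>K\<close>; different choices of \<open>C\<close> give almost surely equal random variables.
  The supremum is taken in the reals, so its value is meaningful only outside the null set
  on which it would be infinite.
\<close>

definition support_rv :: "('h \<Rightarrow> 'a \<Rightarrow> real) \<Rightarrow> 'h set \<Rightarrow> 'a \<Rightarrow> real" where
  "support_rv X C \<omega> = (SUP v\<in>C. X v \<omega>)"

text \<open>
  A function on \<open>\<real>\<^sup>n\<close> is represented by a function on sequences that depends only on the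
  coordinates with index below \<open>n\<close>.  For such functions, continuity with respect to the product
  topology is continuity on \<open>\<real>\<^sup>n\<close>.
\<close>

definition partial_deriv :: "nat \<Rightarrow> ((nat \<Rightarrow> real) \<Rightarrow> real) \<Rightarrow> (nat \<Rightarrow> real) \<Rightarrow> real" where
  "partial_deriv j f x = deriv (\<lambda>t. f (x(j := t))) (x j)"

definition iterated_partial_deriv ::
    "nat list \<Rightarrow> ((nat \<Rightarrow> real) \<Rightarrow> real) \<Rightarrow> (nat \<Rightarrow> real) \<Rightarrow> real" where
  "iterated_partial_deriv js f = foldr partial_deriv js f"

definition smooth_poly_growth :: "nat \<Rightarrow> ((nat \<Rightarrow> real) \<Rightarrow> real) \<Rightarrow> bool" where
  "smooth_poly_growth n f \<longleftrightarrow>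
     (\<forall>x y. (\<forall>i<n. x i = y i) \<longrightarrow> f x = f y) \<and>
     (\<forall>js. set js \<subseteq> {..<n} \<longrightarrow>
        continuous_on UNIV (iterated_partial_deriv js f) \<and>
        (\<forall>j<n. \<forall>x. (\<lambda>t. iterated_partial_deriv js f (x(j := t))) field_differentiable at (x j)) \<and>
        (\<exists>C k. \<forall>x. \<bar>iterated_partial_deriv js f x\<bar> \<le> C * (1 + L2_set x {..<n}) ^ k))"

definition square_integrable ::
    "'a measure \<Rightarrow> ('a \<Rightarrow> 'b::{banach, second_countable_topology}) \<Rightarrow> bool" where
  "square_integrable M f \<longleftrightarrow>
     f \<in> borel_measurable M \<and> integrable M (\<lambda>\<omega>. (norm (f \<omega>))\<^sup>2)"

definition tendsto_L2 ::
    "'a measure \<Rightarrow> (nat \<Rightarrow> 'a \<Rightarrow> 'b::{banach, second_countable_topology}) \<Rightarrow> ('a \<Rightarrow> 'b) \<Rightarrow> bool"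
  where
  "tendsto_L2 M f g \<longleftrightarrow>
     (\<lambda>k. \<integral>\<^sup>+ \<omega>. ennreal ((norm (f k \<omega> - g \<omega>))\<^sup>2) \<partial>M) \<longlonglongrightarrow> 0"

definition smooth_malliavin ::
    "('h::{real_inner, banach, second_countable_topology} \<Rightarrow> 'a \<Rightarrow> real) \<Rightarrow>
     ('a \<Rightarrow> real) \<Rightarrow> ('a \<Rightarrow> 'h) \<Rightarrow> bool" where
  "smooth_malliavin X \<phi> \<Phi> \<longleftrightarrow>
     (\<exists>n f v. smooth_poly_growth n f \<and>
        \<phi> = (\<lambda>\<omega>. f (\<lambda>i. X (v i) \<omega>)) \<and>
        \<Phi> = (\<lambda>\<omega>. \<Sum>j<n. partial_deriv j f (\<lambda>i. X (v i) \<omega>) *\<^sub>R v j))"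

text \<open>
  The closure of the graph of the operator on smooth random variables in
  \<open>L\<^sup>2(\<Omega>) \<times> L\<^sup>2(\<Omega>; H)\<close>, on representatives; \<open>F\<close> belongs to the domain of the
  closed operator iff \<open>has_malliavin_derivative M X F G\<close> for some \<open>G\<close>.
\<close>

definition has_malliavin_derivative ::
    "'a measure \<Rightarrow> ('h::{real_inner, banach, second_countable_topology} \<Rightarrow> 'a \<Rightarrow> real) \<Rightarrow>
     ('a \<Rightarrow> real) \<Rightarrow> ('a \<Rightarrow> 'h) \<Rightarrow> bool" where
  "has_malliavin_derivative M X F G \<longleftrightarrow>
     square_integrable M F \<and> square_integrable M G \<and>
     (\<exists>\<phi> \<Phi>. (\<forall>k. smooth_malliavin X (\<phi> k) (\<Phi> k)) \<and>
        tendsto_L2 M \<phi> F \<and> tendsto_L2 M \<Phi> G)"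

text \<open>
  A representative of the Malliavin derivative, which is unique up to almost sure equality
  because the operator on smooth random variables is closable; unspecified outside the domain.
\<close>

definition malliavin_deriv ::
    "'a measure \<Rightarrow> ('h::{real_inner, banach, second_countable_topology} \<Rightarrow> 'a \<Rightarrow> real) \<Rightarrow>
     ('a \<Rightarrow> real) \<Rightarrow> 'a \<Rightarrow> 'h" where
  "malliavin_deriv M X F = (SOME G. has_malliavin_derivative M X F G)"

definition essential_range :: "'a measure \<Rightarrow> ('a \<Rightarrow> 'b::topological_space) \<Rightarrow> 'b set" where
  "essential_range M f =
     \<Inter> {closure (u ` space M) | u. u \<in> borel_measurable M \<and> (AE \<omega> in M. u \<omega> = f \<omega>)}"

end

theory Submission
  imports Defs
begin

text \<open>
  Enumerate \<open>C\<close> as \<open>c\<^sub>0, c\<^sub>1, \<dots>\<close>. The log-sum-exp functions of \<open>X c\<^sub>0, \<dots>, X c\<^sub>n\<close> are smooth, tend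
  to \<open>h\<^sub>K(X)\<close> in \<open>L\<^sup>2\<close> (Fernique's theorem provides the square-integrable bound), and their
  derivatives are softmax averages of points of \<open>K\<close>. The maximiser need not exist, so these
  derivatives need not converge; but midpoint combinations with almost minimal \<open>L\<^sup>2\<close> norm do, and
  the limit is a Malliavin derivative with values in \<open>K\<close>. Gaussian integration by parts against
  \<open>cos (X w)\<close> and \<open>sin (X w)\<close> determines the derivative almost surely, because Fourier transforms
  determine finite measures on \<open>\<real>\<^sup>H\<close>. Hence every derivative \<open>G\<close> lies in \<open>K\<close>.

  Conversely, if the closed convex hull of the essential range missed a point of \<open>K\<close>, there would
  be a unit vector \<open>u\<close>, a point \<open>p \<in> C\<close> and \<open>b < p \<bullet> u\<close> with \<open>G \<bullet> u \<le> b\<close>. Then the expectation of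
  \<open>h\<^sub>K(X)\<close> under the Cameron-Martin shift by \<open>s u\<close> would grow at most like \<open>b s\<close>, although
  \<open>h\<^sub>K(X) \<ge> X p\<close> forces growth at least \<open>(p \<bullet> u) s\<close>.
\<close>

section \<open>Finite measures on products and their Fourier transforms\<close>

text \<open>Two features of the setting shape the argument. They are replaced by equalities of laws
  on \<open>\<real>\<^sup>H\<close>, which are determined by the characters of finite combinations;
  the symmetry of the process, the splitting off of one direction and the rotation of two copies
  then reduce to comparing norms of vectors.

  Moreover, the sigma-algebra of \<open>M\<close> may be larger than the one generated by
  \<open>X\<close>, so a random variable orthogonal to all functions of the path need not vanish.
  For the difference of two derivatives this gap closes because both are themselves
  \<open>L\<^sup>2\<close> limits of functions of the path.

  The Cameron-Martin shift is never carried out as a change of measure: the growth of the shifted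
  expectation is read off integration by parts against one explicit weight of a single Gaussian
  variable.\<close>

lemma finite_measure_char_eqI:
  fixes \<mu> \<nu> :: "real measure"
  assumes "finite_measure \<mu>" "finite_measure \<nu>"
    and [simp, measurable_cong]: "sets \<mu> = sets borel" "sets \<nu> = sets borel"
    and char: "\<And>s. (CLINT x|\<mu>. iexp (s * x)) = (CLINT x|\<nu>. iexp (s * x))"
  shows "\<mu> = \<nu>"
proof -
  interpret \<mu>: finite_measure \<mu> by fact
  interpret \<nu>: finite_measure \<nu> by fact
  have space [simp]: "space \<mu> = UNIV" "space \<nu> = UNIV"
    using sets_eq_imp_space_eq[of \<mu> borel] sets_eq_imp_space_eq[of \<nu> borel] by auto
  \<comment> \<open>The total mass is the transform at \<open>0\<close>. Dividing by it reduces the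
    claim to Levy's uniqueness theorem for probability measures; the zero measure is treated
    apart.\<close>
  define c where "c = measure \<mu> UNIV"
  have "complex_of_real (measure \<mu> UNIV) = complex_of_real (measure \<nu> UNIV)"
    using char[of 0] by (simp add: scaleR_conv_of_real)
  then have c': "c = measure \<nu> UNIV" by (simp add: c_def)
  show ?thesis
  proof (cases "c = 0")
    case True
    show ?thesis
    proof (rule measure_eqI)
      fix A assume "A \<in> sets \<mu>"
      have "measure \<mu> A \<le> c"
        using \<mu>.bounded_measure[of A] by (simp add: c_def)
      moreover have "measure \<nu> A \<le> c"
        using \<nu>.bounded_measure[of A] by (simp add: c')
      ultimately
      have "measure \<mu> A = measure \<nu> A"
        using True measure_nonneg[of \<mu> A] measure_nonneg[of \<nu> A] by linarith
      then show "emeasure \<mu> A = emeasure \<nu> A"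
        by (simp add: \<mu>.emeasure_eq_measure \<nu>.emeasure_eq_measure)
    qed simp
  next
    case False
    then have "c > 0" by (simp add: c_def zero_less_measure_iff)
    define \<mu>' where "\<mu>' = density \<mu> (\<lambda>_. ennreal (1/c))"
    define \<nu>' where "\<nu>' = density \<nu> (\<lambda>_. ennreal (1/c))"
    have [simp, measurable_cong]: "sets \<mu>' = sets borel" "sets \<nu>' = sets borel"
      by (simp_all add: \<mu>'_def \<nu>'_def)
    have em: "emeasure \<mu>' A = ennreal (1/c) * emeasure \<mu> A"
             "emeasure \<nu>' A = ennreal (1/c) * emeasure \<nu> A" if "A \<in> sets borel" for A
      unfolding \<mu>'_def \<nu>'_def using that by (simp_all add: emeasure_density_const)
    have "real_distribution \<mu>'"
      using \<open>c > 0\<close> em[of UNIV] unfolding real_distribution_def real_distribution_axioms_def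
      by (auto intro!: prob_spaceI sets_eq_imp_space_eq
          simp: \<mu>'_def \<mu>.emeasure_eq_measure c_def simp flip: ennreal_mult ennreal_1)
    moreover have "real_distribution \<nu>'"
      using \<open>c > 0\<close> em[of UNIV] unfolding real_distribution_def real_distribution_axioms_def
      by (auto intro!: prob_spaceI sets_eq_imp_space_eq
          simp: \<nu>'_def \<nu>.emeasure_eq_measure c' simp flip: ennreal_mult ennreal_1)
    moreover have "char \<mu>' = char \<nu>'"
      using \<open>c > 0\<close> char by (auto simp: char_def \<mu>'_def \<nu>'_def integral_density fun_eq_iff)
    ultimately have eq: "\<mu>' = \<nu>'" by (rule Levy_uniqueness)
    show ?thesis
    proof (rule measure_eqI)
      fix A assume "A \<in> sets \<mu>"
      then have "ennreal (1/c) * emeasure \<mu> A = ennreal (1/c) * emeasure \<nu> A"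
        using em[of A] eq by simp
      then show "emeasure \<mu> A = emeasure \<nu> A"
        using \<open>c > 0\<close> by (simp add: ennreal_mult_cancel_left)
    qed simp
  qed
qed

text \<open>Coefficients come as a list: adding a term is \<open>Cons\<close>, repeated indices are
  harmless, and inductions need no disjointness conditions.\<close>

definition lincomb :: "(real \<times> 'i) list \<Rightarrow> ('i \<Rightarrow> real) \<Rightarrow> real" where
  "lincomb ts x = (\<Sum>(s, j)\<leftarrow>ts. s * x j)"

lemma lincomb_simps [simp]:
  "lincomb [] x = 0" "lincomb ((s, j) # ts) x = s * x j + lincomb ts x"
  by (simp_all add: lincomb_def)

lemma lincomb_uminus: "lincomb (map (\<lambda>(s, j). (- s, j)) ts) x = - lincomb ts x"
  by (induction ts) auto

lemma measurable_lincomb [measurable]: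
  "lincomb ts \<in> borel_measurable (PiM UNIV (\<lambda>_. borel))"
proof (induction ts)
  case (Cons a ts)
  obtain s j where a: "a = (s, j)" by (cases a)
  have "lincomb (a # ts) = (\<lambda>x. s * x j + lincomb ts x)" by (auto simp: a)
  with Cons show ?case by simp
qed (simp add: lincomb_def)

lemma sets_cylinder:
  fixes A :: "'i \<Rightarrow> 'b::topological_space set"
  assumes "finite J" and [measurable]: "\<And>j. A j \<in> sets borel"
  shows "{x. \<forall>j\<in>J. x j \<in> A j} \<in> sets (PiM UNIV (\<lambda>_. borel))"
proof -
  have "{x \<in> space (PiM UNIV (\<lambda>_. borel)). \<forall>j\<in>J. x j \<in> A j} \<in> sets (PiM UNIV (\<lambda>_. borel))"
    using assms(1) by (intro sets.sets_Collect_finite_All) auto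
  then show ?thesis by (simp add: space_PiM)
qed

text \<open>Pushing the measure with density \<open>d\<close> forward along one coordinate reduces
  the claim to the real line. Nonnegativity of \<open>d\<close> makes this a measure, and the bound
  \<open>B\<close> makes it finite.\<close>

lemma weighted_coordinate_eqI:
  fixes \<mu> \<nu> :: "('i \<Rightarrow> real) measure"
  assumes "finite_measure \<mu>" "finite_measure \<nu>"
    and [measurable_cong]: "sets \<mu> = sets (PiM UNIV (\<lambda>_. borel))" "sets \<nu> = sets (PiM UNIV (\<lambda>_. borel))"
    and [measurable]: "d \<in> borel_measurable (PiM UNIV (\<lambda>_. borel))"
    and d: "\<And>x. 0 \<le> d x" "\<And>x. d x \<le> B"
    and char: "\<And>s. (CLINT x|\<mu>. d x *\<^sub>R iexp (s * x j)) = (CLINT x|\<nu>. d x *\<^sub>R iexp (s * x j))"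
    and [measurable]: "A \<in> sets borel"
  shows "(\<integral>x. d x * indicator A (x j) \<partial>\<mu>) = (\<integral>x. d x * indicator A (x j) \<partial>\<nu>)"
proof -
  define m where "m \<xi> = distr (density \<xi> (\<lambda>x. ennreal (d x))) borel (\<lambda>x. x j)"
    for \<xi> :: "('i \<Rightarrow> real) measure"
  have fin: "finite_measure (m \<xi>)" if "finite_measure \<xi>"
      and [measurable_cong]: "sets \<xi> = sets (PiM UNIV (\<lambda>_. borel))" for \<xi>
  proof -
    interpret finite_measure \<xi> by fact
    have "finite_measure (density \<xi> (\<lambda>x. ennreal (d x)))"
    proof
      have "emeasure (density \<xi> (\<lambda>x. ennreal (d x))) (space \<xi>) = (\<integral>\<^sup>+x. ennreal (d x) \<partial>\<xi>)"
        by (subst emeasure_density) (auto intro!: nn_integral_cong)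
      also have "\<dots> \<le> (\<integral>\<^sup>+x. ennreal B \<partial>\<xi>)"
        by (intro nn_integral_mono ennreal_leI d)
      also have "\<dots> < \<infinity>"
        by (simp add: ennreal_mult_less_top emeasure_eq_measure)
      finally show "emeasure (density \<xi> (\<lambda>x. ennreal (d x))) (space (density \<xi> (\<lambda>x. ennreal (d x)))) \<noteq> \<infinity>"
        by simp
    qed
    then show ?thesis
      unfolding m_def by (rule finite_measure.finite_measure_distr) measurable
  qed
  have "m \<mu> = m \<nu>"
  proof (rule finite_measure_char_eqI)
    show "(CLINT x|m \<mu>. iexp (s * x)) = (CLINT x|m \<nu>. iexp (s * x))" for s
      using char[of s] by (simp add: m_def integral_distr integral_density d)
  qed (use assms(1-4) fin in \<open>auto simp: m_def\<close>)
  then have "(\<integral>x. (indicator A x :: real) \<partial>m \<mu>) = (\<integral>x. indicator A x \<partial>m \<nu>)"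
    by simp
  moreover have "(\<integral>x. (indicator A x :: real) \<partial>m \<xi>) = (\<integral>x. d x * indicator A (x j) \<partial>\<xi>)"
    if [measurable_cong]: "sets \<xi> = sets (PiM UNIV (\<lambda>_. borel))" for \<xi>
    unfolding m_def by (subst integral_distr; simp?) (subst integral_density; simp add: d)
  ultimately show ?thesis using assms(3,4) by simp
qed

text \<open>Cylinders determine a finite measure on the product. Characters are exchanged for
  indicators one coordinate at a time, each exchange being the one-dimensional uniqueness theorem
  with the remaining factors as weight.\<close>

lemma finite_measure_PiM_char_eqI:
  fixes \<mu> \<nu> :: "('i \<Rightarrow> real) measure"
  assumes fin: "finite_measure \<mu>" "finite_measure \<nu>"
    and [measurable_cong, simp]: "sets \<mu> = sets (PiM UNIV (\<lambda>_. borel))"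
      "sets \<nu> = sets (PiM UNIV (\<lambda>_. borel))"
    and char: "\<And>ts. (CLINT x|\<mu>. iexp (lincomb ts x)) = (CLINT x|\<nu>. iexp (lincomb ts x))"
  shows "\<mu> = \<nu>"
proof -
  interpret \<mu>: finite_measure \<mu> by fact
  interpret \<nu>: finite_measure \<nu> by fact
  have int: "integrable \<mu> f" "integrable \<nu> f"
    if "f \<in> borel_measurable (PiM UNIV (\<lambda>_. borel))" "\<And>x. cmod (f x) \<le> B" for f :: "_ \<Rightarrow> complex" and B
    using that by (auto intro!: \<mu>.integrable_const_bound[where B=B] \<nu>.integrable_const_bound[where B=B])
  have intr: "integrable \<mu> f" "integrable \<nu> f"
    if "f \<in> borel_measurable (PiM UNIV (\<lambda>_. borel))" "\<And>x. \<bar>f x\<bar> \<le> B" for f :: "_ \<Rightarrow> real" and B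
    using that by (auto intro!: \<mu>.integrable_const_bound[where B=B] \<nu>.integrable_const_bound[where B=B])
  \<comment> \<open>A character of an arbitrary combination is carried along, because the induction
    step needs the transform in the new coordinate also when further characters are present.\<close>
  have main: "(CLINT x|\<mu>. indicator {x. \<forall>j\<in>J. x j \<in> A j} x *\<^sub>R iexp (lincomb ts x)) =
      (CLINT x|\<nu>. indicator {x. \<forall>j\<in>J. x j \<in> A j} x *\<^sub>R iexp (lincomb ts x))"
    if "finite J" "\<And>j. A j \<in> sets borel" for J ts and A :: "'i \<Rightarrow> real set"
    using that
  proof (induction J arbitrary: ts rule: finite_induct)
    case empty
    show ?case using char by simp
  next
    case (insert j J)
    have [measurable]: "A i \<in> sets borel" for i by fact
    define D where "D = (\<lambda>x. indicator {x. \<forall>j\<in>J. x j \<in> A j} x :: real)"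
    have Dm [measurable]: "D \<in> borel_measurable (PiM UNIV (\<lambda>_. borel))"
      unfolding D_def using sets_cylinder[OF insert.hyps(1), of A] insert.prems by (intro borel_measurable_indicator) simp
    have D01: "0 \<le> D x" "D x \<le> 1" for x by (auto simp: D_def indicator_def)
    have IH: "(CLINT x|\<mu>. D x *\<^sub>R iexp (lincomb us x)) = (CLINT x|\<nu>. D x *\<^sub>R iexp (lincomb us x))" for us
      using insert.IH[of us] insert.prems by (simp add: D_def)
    define L where "L = lincomb ts"
    have [measurable]: "L \<in> borel_measurable (PiM UNIV (\<lambda>_. borel))" by (simp add: L_def)
    have b0: "cmod (D x *\<^sub>R iexp y) \<le> 1" for x y
      using D01[of x] by (simp)
    have I0: "(CLINT x|\<mu>. D x *\<^sub>R iexp (s * x j)) = (CLINT x|\<nu>. D x *\<^sub>R iexp (s * x j))" for s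
      using IH[of "[(s, j)]"] by simp
    have I1: "(CLINT x|\<mu>. D x *\<^sub>R iexp (L x + s * x j)) = (CLINT x|\<nu>. D x *\<^sub>R iexp (L x + s * x j))" for s
      using IH[of "(s, j) # ts"] by (simp add: L_def add.commute)
    have I2: "(CLINT x|\<mu>. D x *\<^sub>R iexp (- L x + s * x j)) = (CLINT x|\<nu>. D x *\<^sub>R iexp (- L x + s * x j))" for s
      using IH[of "(s, j) # map (\<lambda>(s, j). (- s, j)) ts"] by (simp add: L_def add.commute lincomb_uminus)
    have lin: "(CLINT x|\<mu>. D x *\<^sub>R iexp (f x) + (a * (D x *\<^sub>R iexp (g x)) + b * (D x *\<^sub>R iexp (h x)))) =
        (CLINT x|\<nu>. D x *\<^sub>R iexp (f x) + (a * (D x *\<^sub>R iexp (g x)) + b * (D x *\<^sub>R iexp (h x))))"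
      if [measurable]: "f \<in> borel_measurable (PiM UNIV (\<lambda>_. borel))" "g \<in> borel_measurable (PiM UNIV (\<lambda>_. borel))"
          "h \<in> borel_measurable (PiM UNIV (\<lambda>_. borel))"
        and eq: "(CLINT x|\<mu>. D x *\<^sub>R iexp (f x)) = (CLINT x|\<nu>. D x *\<^sub>R iexp (f x))"
          "(CLINT x|\<mu>. D x *\<^sub>R iexp (g x)) = (CLINT x|\<nu>. D x *\<^sub>R iexp (g x))"
          "(CLINT x|\<mu>. D x *\<^sub>R iexp (h x)) = (CLINT x|\<nu>. D x *\<^sub>R iexp (h x))"
      for f g h and a b
    proof -
      have i: "integrable \<mu> (\<lambda>x. D x *\<^sub>R iexp (k x))" "integrable \<nu> (\<lambda>x. D x *\<^sub>R iexp (k x))"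
        if [measurable]: "k \<in> borel_measurable (PiM UNIV (\<lambda>_. borel))" for k
        by (intro int[where B=1] b0; measurable)+
      show ?thesis
        using i[OF that(1)] i[OF that(2)] i[OF that(3)] eq by (simp del: mult_scaleR_right)
    qed
    \<comment> \<open>A complex character cannot serve as a density. Its real and imaginary parts
      are raised by 1 to become nonnegative weights; \<open>split\<close> subtracts the extra term
      again.\<close>
    have cosE: "(D x * (1 + cos (L x))) *\<^sub>R iexp (s * x j) = D x *\<^sub>R iexp (s * x j) +
        ((1/2) * (D x *\<^sub>R iexp (L x + s * x j)) + (1/2) * (D x *\<^sub>R iexp (- L x + s * x j)))" for x s
    proof -
      have c: "complex_of_real (cos (L x)) = (iexp (L x) + iexp (- L x)) / 2"
        by (simp add: cos_exp_eq flip: cos_of_real)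
      show ?thesis
        unfolding scaleR_conv_of_real of_real_mult of_real_add c distrib_left exp_add
        by (simp add: field_simps exp_add)
    qed
    have sinE: "(D x * (1 + sin (L x))) *\<^sub>R iexp (s * x j) = D x *\<^sub>R iexp (s * x j) +
        (- \<i> / 2 * (D x *\<^sub>R iexp (L x + s * x j)) + \<i> / 2 * (D x *\<^sub>R iexp (- L x + s * x j)))" for x s
    proof -
      have c: "complex_of_real (sin (L x)) = - \<i> / 2 * iexp (L x) + \<i> / 2 * iexp (- L x)"
        by (simp add: sin_exp_eq field_simps flip: sin_of_real)
      show ?thesis
        unfolding scaleR_conv_of_real of_real_mult of_real_add c distrib_left exp_add
        by (simp add: algebra_simps exp_add)
    qed
    let ?I = "\<lambda>x. indicator (A j) (x j) :: real"
    have d0: "(\<integral>x. D x * ?I x \<partial>\<mu>) = (\<integral>x. D x * ?I x \<partial>\<nu>)"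
      by (rule weighted_coordinate_eqI[where B=1]) (use fin I0 D01 in auto)
    have d1: "(\<integral>x. (D x * (1 + cos (L x))) * ?I x \<partial>\<mu>) = (\<integral>x. (D x * (1 + cos (L x))) * ?I x \<partial>\<nu>)"
    proof (rule weighted_coordinate_eqI[where B=2])
      show "(CLINT x|\<mu>. (D x * (1 + cos (L x))) *\<^sub>R iexp (s * x j)) =
          (CLINT x|\<nu>. (D x * (1 + cos (L x))) *\<^sub>R iexp (s * x j))" for s
        unfolding cosE by (rule lin) (use I0 I1 I2 in simp_all)
      show "0 \<le> D x * (1 + cos (L x))" for x using D01[of x] cos_ge_minus_one[of "L x"] by (intro mult_nonneg_nonneg) linarith+
      show "D x * (1 + cos (L x)) \<le> 2" for x
        using mult_mono[of "D x" 1 "1 + cos (L x)" 2] D01[of x] cos_ge_minus_one[of "L x"] cos_le_one[of "L x"] by linarith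
    qed (use fin in auto)
    have d2: "(\<integral>x. (D x * (1 + sin (L x))) * ?I x \<partial>\<mu>) = (\<integral>x. (D x * (1 + sin (L x))) * ?I x \<partial>\<nu>)"
    proof (rule weighted_coordinate_eqI[where B=2])
      show "(CLINT x|\<mu>. (D x * (1 + sin (L x))) *\<^sub>R iexp (s * x j)) =
          (CLINT x|\<nu>. (D x * (1 + sin (L x))) *\<^sub>R iexp (s * x j))" for s
        unfolding sinE by (rule lin) (use I0 I1 I2 in simp_all)
      show "0 \<le> D x * (1 + sin (L x))" for x using D01[of x] sin_ge_minus_one[of "L x"] by (intro mult_nonneg_nonneg) linarith+
      show "D x * (1 + sin (L x)) \<le> 2" for x
        using mult_mono[of "D x" 1 "1 + sin (L x)" 2] D01[of x] sin_ge_minus_one[of "L x"] sin_le_one[of "L x"] by linarith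
    qed (use fin in auto)
    have ind: "indicator {x. \<forall>j\<in>insert j J. x j \<in> A j} x = D x * ?I x" for x
      by (auto simp: D_def indicator_def)
    have split: "(D x * ?I x) *\<^sub>R iexp (L x) =
        complex_of_real ((D x * (1 + cos (L x))) * ?I x - D x * ?I x) +
        \<i> * complex_of_real ((D x * (1 + sin (L x))) * ?I x - D x * ?I x)" for x
      by (simp add: complex_eq_iff algebra_simps exp_Euler cos_of_real sin_of_real)
    have le: "D x * (1 + y) * ?I x \<le> 2" "\<bar>D x * (1 + y) * ?I x\<bar> \<le> 2" if "- 1 \<le> y" "y \<le> 1" for x y
    proof -
      have "D x * (1 + y) * ?I x \<le> 1 * 2 * 1"
        by (intro mult_mono) (use D01[of x] that in \<open>auto simp: indicator_def\<close>)
      moreover have "0 \<le> D x * (1 + y) * ?I x"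
        by (intro mult_nonneg_nonneg) (use D01[of x] that in \<open>auto simp: indicator_def\<close>)
      ultimately show "D x * (1 + y) * ?I x \<le> 2" "\<bar>D x * (1 + y) * ?I x\<bar> \<le> 2" by auto
    qed
    have i0: "integrable \<mu> (\<lambda>x. D x * ?I x)" "integrable \<nu> (\<lambda>x. D x * ?I x)"
      by (intro intr[where B=2]; use le[of 0] in simp)+
    have i1: "integrable \<mu> (\<lambda>x. D x * (1 + cos (L x)) * ?I x)" "integrable \<nu> (\<lambda>x. D x * (1 + cos (L x)) * ?I x)"
      by (intro intr[where B=2]; use le in simp)+
    have i2: "integrable \<mu> (\<lambda>x. D x * (1 + sin (L x)) * ?I x)" "integrable \<nu> (\<lambda>x. D x * (1 + sin (L x)) * ?I x)"
      by (intro intr[where B=2]; use le in simp)+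
    show ?case
      unfolding ind L_def[symmetric] split
      by (subst (1 2) Bochner_Integration.integral_add)
         (auto intro!: integrable_of_real integrable_mult_right Bochner_Integration.integrable_diff i0 i1 i2
           simp: i0 i1 i2 d0 d1 d2 Bochner_Integration.integral_diff simp del: of_real_diff)
  qed
  show ?thesis
  proof (rule measure_eqI_PiM_infinite[where I=UNIV and M="\<lambda>_. borel"])
    fix A :: "'i \<Rightarrow> real set" and J :: "'i set"
    assume "finite J" "J \<subseteq> UNIV" and A0: "\<And>i. i \<in> J \<Longrightarrow> A i \<in> sets borel"
    \<comment> \<open>\<open>A\<close> is known to be Borel only on \<open>J\<close>, whereas
      \<open>main\<close> asks for a Borel set at every index.\<close>
    define A' where "A' i = (if i \<in> J then A i else UNIV)" for i
    have A: "A' i \<in> sets borel" for i using A0 by (auto simp: A'_def)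
    have eq: "prod_emb UNIV (\<lambda>_. borel) J (Pi\<^sub>E J A) = {x. \<forall>j\<in>J. x j \<in> A' j}"
      by (auto simp: prod_emb_def A'_def PiE_def Pi_def)
    have sm: "{x. \<forall>j\<in>J. x j \<in> A' j} \<in> sets (PiM UNIV (\<lambda>_. borel))"
      using \<open>finite J\<close> A by (rule sets_cylinder)
    have "(CLINT x|\<mu>. complex_of_real (indicator {x. \<forall>j\<in>J. x j \<in> A' j} x)) =
        (CLINT x|\<nu>. complex_of_real (indicator {x. \<forall>j\<in>J. x j \<in> A' j} x))"
      using main[OF \<open>finite J\<close>, where A=A' and ts="[]"] A by (simp add: scaleR_conv_of_real)
    then have "measure \<mu> {x. \<forall>j\<in>J. x j \<in> A' j} = measure \<nu> {x. \<forall>j\<in>J. x j \<in> A' j}"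
      using sm sets_eq_imp_space_eq[of \<mu> "PiM UNIV (\<lambda>_. borel)"] sets_eq_imp_space_eq[of \<nu> "PiM UNIV (\<lambda>_. borel)"]
      by (simp add: space_PiM)
    then show "emeasure \<mu> (prod_emb UNIV (\<lambda>_. borel) J (Pi\<^sub>E J A)) = emeasure \<nu> (prod_emb UNIV (\<lambda>_. borel) J (Pi\<^sub>E J A))"
      by (simp add: eq \<mu>.emeasure_eq_measure \<nu>.emeasure_eq_measure)
  qed (use fin in auto)
qed

section \<open>Laws of an isonormal process\<close>

text \<open>The vector counterpart of \<open>lincomb\<close> on the same coefficient lists; almost
  surely the process takes the one to the other.\<close>

definition vcomb :: "(real \<times> 'i) list \<Rightarrow> ('i \<Rightarrow> 'b::real_vector) \<Rightarrow> 'b" where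
  "vcomb ts c = (\<Sum>(s, j)\<leftarrow>ts. s *\<^sub>R c j)"

lemma vcomb_simps [simp]:
  "vcomb [] c = 0" "vcomb ((s, j) # ts) c = s *\<^sub>R c j + vcomb ts c"
  by (simp_all add: vcomb_def)

lemma vcomb_project:
  fixes u :: "'b::real_inner"
  shows "vcomb ts (\<lambda>v. v - (v \<bullet> u) *\<^sub>R u) = vcomb ts (\<lambda>v. v) - (vcomb ts (\<lambda>v. v) \<bullet> u) *\<^sub>R u"
  by (induction ts) (auto simp: algebra_simps inner_add_left)

section \<open>Characteristic function and exponential moments of centred normal laws\<close>

lemma integral_iexp_normal_density:
  assumes "\<sigma> > 0"
  shows "(CLINT x|density lborel (normal_density 0 \<sigma>). iexp x) = complex_of_real (exp (- \<sigma>\<^sup>2 / 2))"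
proof -
  let ?N = "density lborel (normal_density 0 \<sigma>)"
  interpret prob_space ?N using assms by (rule prob_space_normal_density)
  have "distributed ?N lborel (\<lambda>x. x) (normal_density 0 \<sigma>)"
    by (auto simp: distributed_def distr_id2)
  then have "distributed ?N lborel (\<lambda>x. x / \<sigma>) std_normal_density"
    using assms normal_standard_normal_convert[of \<sigma> "\<lambda>x. x" 0] by simp
  then have *: "distr ?N lborel (\<lambda>x. x / \<sigma>) = std_normal_distribution"
    by (rule distributed_distr_eq_density)
  have "(CLINT x|?N. iexp x) = (CLINT x|?N. iexp (\<sigma> * (x / \<sigma>)))"
    using assms by simp
  also have "\<dots> = (CLINT x|distr ?N lborel (\<lambda>x. x / \<sigma>). iexp (\<sigma> * x))"
    by (subst integral_distr) auto
  also have "\<dots> = char std_normal_distribution \<sigma>"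
    by (simp only: * char_def)
  finally show ?thesis by (simp add: char_std_normal_distribution)
qed

text \<open>Completing the square: an exponential tilt shifts the mean by
  \<open>b * \<sigma>\<^sup>2\<close>. This gives the exponential moments and, at variance one, the
  effect of a Cameron-Martin shift.\<close>

lemma normal_density_times_exp:
  assumes "\<sigma> > 0"
  shows "normal_density 0 \<sigma> x * exp (b * x) = exp (b\<^sup>2 * \<sigma>\<^sup>2 / 2) * normal_density (b * \<sigma>\<^sup>2) \<sigma> x"
proof -
  have "- x\<^sup>2 / (2 * \<sigma>\<^sup>2) + b * x = b\<^sup>2 * \<sigma>\<^sup>2 / 2 + - (x - b * \<sigma>\<^sup>2)\<^sup>2 / (2 * \<sigma>\<^sup>2)"
    using assms by (simp add: field_simps power2_eq_square)
  then show ?thesis by (simp add: normal_density_def exp_add[symmetric] algebra_simps)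
qed

lemma integrable_normal_exp:
  assumes "\<sigma> > 0"
  shows "integrable lborel (\<lambda>x. normal_density 0 \<sigma> x * exp (b * x))"
  unfolding normal_density_times_exp[OF assms] using assms by simp

lemma integrable_normal_exp_abs:
  assumes "\<sigma> > 0"
  shows "integrable lborel (\<lambda>x. normal_density 0 \<sigma> x * exp (b * \<bar>x\<bar>))"
proof (rule Bochner_Integration.integrable_bound)
  show "integrable lborel (\<lambda>x. normal_density 0 \<sigma> x * exp (b * x) + normal_density 0 \<sigma> x * exp ((- b) * x))"
    by (intro Bochner_Integration.integrable_add integrable_normal_exp assms)
  show "AE x in lborel. norm (normal_density 0 \<sigma> x * exp (b * \<bar>x\<bar>)) \<le>
      norm (normal_density 0 \<sigma> x * exp (b * x) + normal_density 0 \<sigma> x * exp ((- b) * x))"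
  proof (intro AE_I2)
    fix x :: real
    have "exp (b * \<bar>x\<bar>) \<le> exp (b * x) + exp (- b * x)"
      by (cases "x \<ge> 0") (auto simp: add_increasing add_increasing2)
    then have "normal_density 0 \<sigma> x * exp (b * \<bar>x\<bar>) \<le> normal_density 0 \<sigma> x * (exp (b * x) + exp (- b * x))"
      by (intro mult_left_mono) auto
    then show "norm (normal_density 0 \<sigma> x * exp (b * \<bar>x\<bar>)) \<le>
        norm (normal_density 0 \<sigma> x * exp (b * x) + normal_density 0 \<sigma> x * exp ((- b) * x))"
      by (simp add: distrib_left abs_mult)
  qed
qed auto

context isonormal_gaussian_process
begin

lemma gaussian_rv_X: "gaussian_rv M (X v)"
  using jointly_gaussian[unfolded jointly_gaussian_def, rule_format, of "{v}" "\<lambda>_. 1"] by simp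

lemma measurable_X [measurable]: "X v \<in> borel_measurable M"
  using gaussian_rv_X[of v] by (simp add: gaussian_rv_def)

lemma AE_X_0: "AE \<omega> in M. X 0 \<omega> = 0"
  using linear[of 0 0 0 0] by simp

text \<open>The definition of a Gaussian variable leaves mean and variance open; centring and
  covariance pin them down, and a point mass would have variance \<open>0\<close> instead of
  \<open>(norm v)\<^sup>2\<close>.\<close>

lemma distributed_X:
  assumes "v \<noteq> 0"
  shows "distributed M lborel (X v) (normal_density 0 (norm v))"
proof -
  have var: "expectation (\<lambda>\<omega>. X v \<omega> * X v \<omega>) = (norm v)\<^sup>2"
    using covariance[of v v] by (simp add: power2_norm_eq_inner)
  consider \<mu> where "AE \<omega> in M. X v \<omega> = \<mu>"
    | \<mu> \<sigma> where "\<sigma> > 0" "distributed M lborel (X v) (normal_density \<mu> \<sigma>)"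
    using gaussian_rv_X[of v] unfolding gaussian_rv_def by auto
  then show ?thesis
  proof cases
    case 1
    have "expectation (X v) = expectation (\<lambda>\<omega>. \<mu>)" using 1 by (intro integral_cong_AE) auto
    then have "\<mu> = 0" using centred[of v] by (simp add: prob_space)
    then have "expectation (\<lambda>\<omega>. X v \<omega> * X v \<omega>) = expectation (\<lambda>\<omega>. 0)"
      using 1 by (intro integral_cong_AE) auto
    then show ?thesis using var assms by simp
  next
    case 2
    have "\<mu> = 0" using normal_distributed_expectation[OF 2] centred[of v] by simp
    moreover have "\<sigma>\<^sup>2 = (norm v)\<^sup>2"
      using normal_distributed_variance[OF 2] var centred[of v] by (simp add: power2_eq_square)
    then have "\<sigma> = norm v" using 2(1) by (auto simp: power2_eq_iff)
    ultimately show ?thesis using 2 by simp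
  qed
qed

lemma char_X: "(CLINT \<omega>|M. iexp (X v \<omega>)) = complex_of_real (exp (- (norm v)\<^sup>2 / 2))"
proof (cases "v = 0")
  case True
  then have "(CLINT \<omega>|M. iexp (X v \<omega>)) = (CLINT \<omega>|M. 1)"
    using AE_X_0 by (intro integral_cong_AE) auto
  then show ?thesis using True by (simp add: prob_space)
next
  case False
  have "(CLINT \<omega>|M. iexp (X v \<omega>)) = (CLINT x|distr M lborel (X v). iexp x)"
    by (subst integral_distr) auto
  also have "distr M lborel (X v) = density lborel (normal_density 0 (norm v))"
    using distributed_X[OF False] by (rule distributed_distr_eq_density)
  finally show ?thesis using False by (simp add: integral_iexp_normal_density)
qed

lemma AE_lincomb: "AE \<omega> in M. lincomb ts (\<lambda>j. X (c j) \<omega>) = X (vcomb ts c) \<omega>"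
proof (induction ts)
  case Nil
  then show ?case using AE_X_0 by auto
next
  case (Cons a ts)
  obtain s j where a: "a = (s, j)" by (cases a)
  show ?case
    using Cons linear[of s "c j" 1 "vcomb ts c"] by eventually_elim (auto simp: a)
qed

lemma measurable_lincomb_X [measurable]:
  "(\<lambda>\<omega>. lincomb ts (\<lambda>j. X (c j) \<omega>)) \<in> borel_measurable M"
proof -
  have "(\<lambda>\<omega> j. X (c j) \<omega>) \<in> measurable M (PiM UNIV (\<lambda>_. borel))"
    by (rule measurable_PiM_single') auto
  from measurable_compose[OF this measurable_lincomb] show ?thesis .
qed

lemma char_lincomb:
  "(CLINT \<omega>|M. iexp (lincomb ts (\<lambda>j. X (c j) \<omega>))) = complex_of_real (exp (- (norm (vcomb ts c))\<^sup>2 / 2))"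
proof -
  have "(CLINT \<omega>|M. iexp (lincomb ts (\<lambda>j. X (c j) \<omega>))) = (CLINT \<omega>|M. iexp (X (vcomb ts c) \<omega>))"
    using AE_lincomb[of ts c] by (intro integral_cong_AE) auto
  then show ?thesis by (simp add: char_X)
qed

lemma integrable_exp_abs_X: "integrable M (\<lambda>\<omega>. exp (b * \<bar>X v \<omega>\<bar>))"
proof (cases "v = 0")
  case True
  show ?thesis
    using AE_X_0 True by (subst integrable_cong_AE[where g="\<lambda>_. 1"]) auto
next
  case False
  have "integrable (density lborel (normal_density 0 (norm v))) (\<lambda>x. exp (b * \<bar>x\<bar>))"
    using integrable_normal_exp_abs[of "norm v" b] False by (subst integrable_density) auto
  also have "density lborel (normal_density 0 (norm v)) = distr M lborel (X v)"
    using distributed_distr_eq_density[OF distributed_X[OF False]] by simp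
  finally show ?thesis by (subst (asm) integrable_distr_eq) auto
qed

lemma measurable_sum_abs_X [measurable]: "(\<lambda>\<omega>. \<Sum>v\<leftarrow>vs. \<bar>X v \<omega>\<bar>) \<in> borel_measurable M"
  by (induction vs) auto

text \<open>The product of two exponentials is bounded by the sum of their squares, so moments of
  single variables suffice. The rate \<open>b\<close> is generalised because it doubles at each
  step.\<close>

lemma integrable_exp_sum_abs_X: "integrable M (\<lambda>\<omega>. exp (b * (\<Sum>v\<leftarrow>vs. \<bar>X v \<omega>\<bar>)))"
proof (induction vs arbitrary: b)
  case (Cons v vs)
  have *: "exp (x + y) \<le> exp (2 * x) + exp (2 * y)" for x y :: real
  proof -
    have "2 * (exp x * exp y) \<le> (exp x)\<^sup>2 + (exp y)\<^sup>2" using sum_squares_bound[of "exp x" "exp y"] by simp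
    moreover have "0 < exp x * exp y" by simp
    ultimately have "exp x * exp y \<le> (exp x)\<^sup>2 + (exp y)\<^sup>2" by linarith
    then show ?thesis by (simp add: exp_add exp_double)
  qed
  show ?case
  proof (rule Bochner_Integration.integrable_bound)
    show "integrable M (\<lambda>\<omega>. exp (2 * b * \<bar>X v \<omega>\<bar>) + exp (2 * b * (\<Sum>v\<leftarrow>vs. \<bar>X v \<omega>\<bar>)))"
      by (intro Bochner_Integration.integrable_add integrable_exp_abs_X Cons)
    show "(\<lambda>\<omega>. exp (b * (\<Sum>v\<leftarrow>v # vs. \<bar>X v \<omega>\<bar>))) \<in> borel_measurable M"
      by measurable
    show "AE \<omega> in M. norm (exp (b * (\<Sum>v\<leftarrow>v # vs. \<bar>X v \<omega>\<bar>)))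
        \<le> norm (exp (2 * b * \<bar>X v \<omega>\<bar>) + exp (2 * b * (\<Sum>v\<leftarrow>vs. \<bar>X v \<omega>\<bar>)))"
    proof (intro AE_I2)
      fix \<omega>
      have "exp (b * \<bar>X v \<omega>\<bar> + b * (\<Sum>v\<leftarrow>vs. \<bar>X v \<omega>\<bar>)) \<le> exp (2 * (b * \<bar>X v \<omega>\<bar>)) + exp (2 * (b * (\<Sum>v\<leftarrow>vs. \<bar>X v \<omega>\<bar>)))"
        by (rule *)
      then show "norm (exp (b * (\<Sum>v\<leftarrow>v # vs. \<bar>X v \<omega>\<bar>)))
        \<le> norm (exp (2 * b * \<bar>X v \<omega>\<bar>) + exp (2 * b * (\<Sum>v\<leftarrow>vs. \<bar>X v \<omega>\<bar>)))"
        by (simp add: algebra_simps add_pos_pos)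
    qed
  qed
qed simp

end

section \<open>Equalities in law through characteristic functions\<close>

lemma law_eqI:
  assumes N: "prob_space N" and N': "prob_space N'"
    and [measurable]: "\<And>i. Z i \<in> borel_measurable N" "\<And>i. Z' i \<in> borel_measurable N'"
    and char: "\<And>ts. (CLINT \<omega>|N. iexp (lincomb ts (\<lambda>i. Z i \<omega>))) = (CLINT \<omega>|N'. iexp (lincomb ts (\<lambda>i. Z' i \<omega>)))"
  shows "distr N (PiM UNIV (\<lambda>_. borel)) (\<lambda>\<omega> i. Z i \<omega>) = distr N' (PiM UNIV (\<lambda>_. borel)) (\<lambda>\<omega> i. Z' i \<omega>)"
proof -
  have m: "(\<lambda>\<omega> i. Z i \<omega>) \<in> measurable N (PiM UNIV (\<lambda>_. borel))"
    "(\<lambda>\<omega> i. Z' i \<omega>) \<in> measurable N' (PiM UNIV (\<lambda>_. borel))"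
    by (rule measurable_PiM_single'; simp)+
  show ?thesis
  proof (rule finite_measure_PiM_char_eqI)
    show "(CLINT x|distr N (PiM UNIV (\<lambda>_. borel)) (\<lambda>\<omega> i. Z i \<omega>). iexp (lincomb ts x)) =
        (CLINT x|distr N' (PiM UNIV (\<lambda>_. borel)) (\<lambda>\<omega> i. Z' i \<omega>). iexp (lincomb ts x))" for ts
      using char[of ts] by (subst (1 2) integral_distr) (auto intro!: m)
  qed (auto intro!: prob_space.finite_measure prob_space.prob_space_distr N N' m)
qed

lemma (in pair_prob_space) integral_iexp_add:
  assumes [measurable]: "f \<in> borel_measurable M1" "g \<in> borel_measurable M2"
  shows "(CLINT z|M1 \<Otimes>\<^sub>M M2. iexp (f (fst z) + g (snd z))) = (CLINT x|M1. iexp (f x)) * (CLINT y|M2. iexp (g y))"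
proof -
  have "integrable (M1 \<Otimes>\<^sub>M M2) (\<lambda>z. iexp (f (fst z) + g (snd z)))"
    by (rule P.integrable_const_bound[where B=1]) auto
  from integral_fst'[OF this]
  have "(CLINT z|M1 \<Otimes>\<^sub>M M2. iexp (f (fst z) + g (snd z))) = (CLINT x|M1. CLINT y|M2. iexp (f x) * iexp (g y))"
    by (simp add: exp_add distrib_left)
  then show ?thesis by simp
qed

context isonormal_gaussian_process
begin

abbreviation "paths \<equiv> PiM UNIV (\<lambda>_. borel) :: ('h \<Rightarrow> real) measure"

lemma measurable_path [measurable]: "(\<lambda>\<omega> v. X v \<omega>) \<in> measurable M paths"
  by (rule measurable_PiM_single') auto

text \<open>This symmetry later turns boundedness from above into two-sided boundedness.\<close>

lemma law_uminus: "distr M paths (\<lambda>\<omega> v. - X v \<omega>) = distr M paths (\<lambda>\<omega> v. X v \<omega>)"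
proof (rule law_eqI)
  fix ts :: "(real \<times> 'h) list"
  have "lincomb ts (\<lambda>v. - X v \<omega>) = lincomb (map (\<lambda>(s, j). (- s, j)) ts) (\<lambda>v. X v \<omega>)" for \<omega>
    by (induction ts) auto
  moreover have "vcomb (map (\<lambda>(s, j). (- s, j)) ts) (\<lambda>v. v) = - vcomb ts (\<lambda>v. v :: 'h)"
    by (induction ts) auto
  ultimately show "(CLINT \<omega>|M. iexp (lincomb ts (\<lambda>v. - X v \<omega>))) = (CLINT \<omega>|M. iexp (lincomb ts (\<lambda>v. X v \<omega>)))"
    using char_lincomb[of "map (\<lambda>(s, j). (- s, j)) ts" "\<lambda>v. v"] char_lincomb[of ts "\<lambda>v. v"] by simp
qed (auto intro: prob_space_axioms)

text \<open>By Pythagoras, the component along \<open>u\<close> and the orthogonal remainder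
  contribute to the variance additively. The component can therefore be replaced by an independent
  standard normal variable, which makes room for one-dimensional calculus in the direction
  \<open>u\<close>.\<close>

lemma law_split:
  assumes u: "norm u = 1"
  shows "distr (std_normal_distribution \<Otimes>\<^sub>M M) paths (\<lambda>z v. (v \<bullet> u) * fst z + X (v - (v \<bullet> u) *\<^sub>R u) (snd z)) =
    distr M paths (\<lambda>\<omega> v. X v \<omega>)"
proof -
  interpret G: prob_space std_normal_distribution by (rule prob_space_normal_density) simp
  interpret GM: pair_prob_space std_normal_distribution M ..
  show ?thesis
  proof (rule law_eqI)
    fix ts :: "(real \<times> 'h) list"
    define V where "V = vcomb ts (\<lambda>v. v)"
    let ?W = "\<lambda>\<omega>. lincomb ts (\<lambda>v. X (v - (v \<bullet> u) *\<^sub>R u) \<omega>)"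
    have "lincomb ts (\<lambda>v. (v \<bullet> u) * fst z + X (v - (v \<bullet> u) *\<^sub>R u) (snd z)) =
        (V \<bullet> u) * fst z + ?W (snd z)" for z
      unfolding V_def by (induction ts) (auto simp: algebra_simps inner_add_left)
    then have "(CLINT z|std_normal_distribution \<Otimes>\<^sub>M M. iexp (lincomb ts (\<lambda>v. (v \<bullet> u) * fst z + X (v - (v \<bullet> u) *\<^sub>R u) (snd z))))
        = (CLINT x|std_normal_distribution. iexp ((V \<bullet> u) * x)) * (CLINT \<omega>|M. iexp (?W \<omega>))"
      using GM.integral_iexp_add[of "\<lambda>x. (V \<bullet> u) * x" ?W] by simp
    also have "(CLINT x|std_normal_distribution. iexp ((V \<bullet> u) * x)) = char std_normal_distribution (V \<bullet> u)"
      by (simp add: char_def)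
    also have "(CLINT \<omega>|M. iexp (?W \<omega>)) = complex_of_real (exp (- (norm (V - (V \<bullet> u) *\<^sub>R u))\<^sup>2 / 2))"
      using char_lincomb[of ts "\<lambda>v. v - (v \<bullet> u) *\<^sub>R u"] by (simp add: vcomb_project V_def)
    also have "char std_normal_distribution (V \<bullet> u) * \<dots> = complex_of_real (exp (- (norm V)\<^sup>2 / 2))"
    proof -
      have "(norm (V - (V \<bullet> u) *\<^sub>R u))\<^sup>2 = (norm V)\<^sup>2 - (V \<bullet> u)\<^sup>2"
        using u unfolding power2_norm_eq_inner norm_eq_1
        by (simp add: inner_diff_left inner_diff_right inner_commute power2_eq_square algebra_simps)
      then have "- (V \<bullet> u)\<^sup>2 / 2 + - (norm (V - (V \<bullet> u) *\<^sub>R u))\<^sup>2 / 2 = - (norm V)\<^sup>2 / 2"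
        by (simp add: field_simps)
      then show ?thesis
        unfolding char_std_normal_distribution of_real_mult[symmetric] exp_add[symmetric] by simp
    qed
    finally show "(CLINT z|std_normal_distribution \<Otimes>\<^sub>M M. iexp (lincomb ts (\<lambda>v. (v \<bullet> u) * fst z + X (v - (v \<bullet> u) *\<^sub>R u) (snd z))))
        = (CLINT \<omega>|M. iexp (lincomb ts (\<lambda>v. X v \<omega>)))"
      using char_lincomb[of ts "\<lambda>v. v"] by (simp add: V_def)
  qed (auto intro: prob_space_axioms GM.P.prob_space_axioms)
qed

text \<open>Two independent copies form one process indexed by \<open>bool \<times> 'h\<close>, with
  \<open>True\<close> for the first copy. Rotation by 45 degrees preserves its law by the
  parallelogram identity for the total coefficient vectors \<open>A\<close> and \<open>B\<close> of
  the two copies.\<close>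

lemma law_rotation:
  "distr (M \<Otimes>\<^sub>M M) (PiM UNIV (\<lambda>_. borel)) (\<lambda>z (b, v). if b then X v (fst z) else X v (snd z)) =
   distr (M \<Otimes>\<^sub>M M) (PiM UNIV (\<lambda>_. borel))
     (\<lambda>z (b, v). if b then (X v (fst z) + X v (snd z)) / sqrt 2 else (X v (fst z) - X v (snd z)) / sqrt 2)"
proof -
  interpret MM: pair_prob_space M M ..
  \<comment> \<open>\<open>?m f ts\<close> rescales each coefficient according to its copy; with
    \<open>of_bool\<close> it keeps the terms of the first copy and annihilates the others.\<close>
  let ?m = "\<lambda>f ts. map (\<lambda>(s, j). (s * f (fst j), j)) (ts :: (real \<times> bool \<times> 'h) list)"
  have comb: "(CLINT z|M \<Otimes>\<^sub>M M. iexp (lincomb (?m f ts) (\<lambda>j. X (snd j) (fst z)) + lincomb (?m g ts) (\<lambda>j. X (snd j) (snd z)))) =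
      complex_of_real (exp (- (norm (vcomb (?m f ts) snd))\<^sup>2 / 2)) * complex_of_real (exp (- (norm (vcomb (?m g ts) snd))\<^sup>2 / 2))"
    for f g ts
    by (subst MM.integral_iexp_add) (simp_all add: char_lincomb)
  let ?r = "1 / sqrt 2"
  have "distr (M \<Otimes>\<^sub>M M) (PiM UNIV (\<lambda>_. borel)) (\<lambda>z j. (case j of (b, v) \<Rightarrow> if b then X v (fst z) else X v (snd z))) =
   distr (M \<Otimes>\<^sub>M M) (PiM UNIV (\<lambda>_. borel))
     (\<lambda>z j. (case j of (b, v) \<Rightarrow> if b then (X v (fst z) + X v (snd z)) / sqrt 2 else (X v (fst z) - X v (snd z)) / sqrt 2))"
  proof (rule law_eqI)
    fix ts :: "(real \<times> bool \<times> 'h) list"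
    define A B where "A = vcomb (?m of_bool ts) snd" and "B = vcomb (?m (\<lambda>b. of_bool (\<not> b)) ts) snd"
    have 1: "lincomb ts (\<lambda>j. case j of (b, v) \<Rightarrow> if b then X v (fst z) else X v (snd z)) =
       lincomb (?m of_bool ts) (\<lambda>j. X (snd j) (fst z)) + lincomb (?m (\<lambda>b. of_bool (\<not> b)) ts) (\<lambda>j. X (snd j) (snd z))" for z
      by (induction ts) auto
    have 2: "lincomb ts (\<lambda>j. case j of (b, v) \<Rightarrow> if b then (X v (fst z) + X v (snd z)) / sqrt 2 else (X v (fst z) - X v (snd z)) / sqrt 2) =
       lincomb (?m (\<lambda>_. ?r) ts) (\<lambda>j. X (snd j) (fst z)) + lincomb (?m (\<lambda>b. if b then ?r else - ?r) ts) (\<lambda>j. X (snd j) (snd z))" for z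
      by (induction ts) (auto simp: field_simps)
    have 3: "vcomb (?m (\<lambda>_. ?r) ts) snd = ?r *\<^sub>R (A + B)"
      unfolding A_def B_def by (induction ts) (auto simp: algebra_simps)
    have 4: "vcomb (?m (\<lambda>b. if b then ?r else - ?r) ts) snd = ?r *\<^sub>R (A - B)"
      unfolding A_def B_def by (induction ts) (auto simp: algebra_simps)
    have "(norm A)\<^sup>2 + (norm B)\<^sup>2 = (norm (?r *\<^sub>R (A + B)))\<^sup>2 + (norm (?r *\<^sub>R (A - B)))\<^sup>2"
      by (simp add: power_mult_distrib power_divide power2_norm_eq_inner inner_add_left inner_add_right inner_diff_left inner_diff_right
            inner_commute field_simps)
    then have "- (norm A)\<^sup>2 / 2 + - (norm B)\<^sup>2 / 2 = - (norm (?r *\<^sub>R (A + B)))\<^sup>2 / 2 + - (norm (?r *\<^sub>R (A - B)))\<^sup>2 / 2"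
      by linarith
    then have "(CLINT z|M \<Otimes>\<^sub>M M. iexp (lincomb (?m of_bool ts) (\<lambda>j. X (snd j) (fst z)) + lincomb (?m (\<lambda>b. of_bool (\<not> b)) ts) (\<lambda>j. X (snd j) (snd z)))) =
      (CLINT z|M \<Otimes>\<^sub>M M. iexp (lincomb (?m (\<lambda>_. ?r) ts) (\<lambda>j. X (snd j) (fst z)) + lincomb (?m (\<lambda>b. if b then ?r else - ?r) ts) (\<lambda>j. X (snd j) (snd z))))"
      unfolding comb[of of_bool ts "\<lambda>b. of_bool (\<not> b)"] comb[of "\<lambda>_. ?r" ts "\<lambda>b. if b then ?r else - ?r"] 3 4 A_def[symmetric] B_def[symmetric] of_real_mult[symmetric] exp_add[symmetric] by simp
    then show "(CLINT z|M \<Otimes>\<^sub>M M. iexp (lincomb ts (\<lambda>j. case j of (b, v) \<Rightarrow> if b then X v (fst z) else X v (snd z)))) =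
       (CLINT z|M \<Otimes>\<^sub>M M. iexp (lincomb ts (\<lambda>j. case j of (b, v) \<Rightarrow> if b then (X v (fst z) + X v (snd z)) / sqrt 2 else (X v (fst z) - X v (snd z)) / sqrt 2)))"
      unfolding 1 2 .
  qed (auto intro: MM.P.prob_space_axioms split: prod.split)
  then show ?thesis by simp
qed

end

section \<open>Gaussian integration by parts\<close>

text \<open>Exponential growth is the natural limit here: Cameron-Martin densities must qualify as
  test functions, and the Gaussian density still absorbs them. The class is closed under sums,
  products and affine substitutions.\<close>

definition exp_bounded :: "(real \<Rightarrow> real) \<Rightarrow> bool" where
  "exp_bounded g \<longleftrightarrow> (\<exists>A b. \<forall>x. \<bar>g x\<bar> \<le> A * exp (b * \<bar>x\<bar>))"

lemma exp_boundedE: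
  assumes "exp_bounded g"
  obtains A b where "0 \<le> A" "0 < b" "\<And>x. \<bar>g x\<bar> \<le> A * exp (b * \<bar>x\<bar>)"
proof -
  obtain A b where *: "\<bar>g x\<bar> \<le> A * exp (b * \<bar>x\<bar>)" for x
    using assms by (auto simp: exp_bounded_def)
  have "\<bar>g x\<bar> \<le> \<bar>A\<bar> * exp ((\<bar>b\<bar> + 1) * \<bar>x\<bar>)" for x
  proof -
    have "b * \<bar>x\<bar> \<le> (\<bar>b\<bar> + 1) * \<bar>x\<bar>" by (intro mult_right_mono) auto
    then have "A * exp (b * \<bar>x\<bar>) \<le> \<bar>A\<bar> * exp ((\<bar>b\<bar> + 1) * \<bar>x\<bar>)"
      by (intro mult_mono) auto
    with *[of x] show ?thesis by linarith
  qed
  then show ?thesis by (intro that[of "\<bar>A\<bar>" "\<bar>b\<bar> + 1"]) auto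
qed

lemma exp_boundedI: "(\<And>x. \<bar>g x\<bar> \<le> A * exp (b * \<bar>x\<bar>)) \<Longrightarrow> exp_bounded g"
  by (auto simp: exp_bounded_def)

lemma exp_bounded_const: "exp_bounded (\<lambda>_. c)"
  by (rule exp_boundedI[of _ "\<bar>c\<bar>" 0]) auto

lemma exp_bounded_mult:
  assumes "exp_bounded f" "exp_bounded g"
  shows "exp_bounded (\<lambda>x. f x * g x)"
proof -
  obtain A b where f: "0 \<le> A" "0 < b" "\<And>x. \<bar>f x\<bar> \<le> A * exp (b * \<bar>x\<bar>)" by (rule exp_boundedE[OF assms(1)]) blast
  obtain B c where g: "0 \<le> B" "0 < c" "\<And>x. \<bar>g x\<bar> \<le> B * exp (c * \<bar>x\<bar>)" by (rule exp_boundedE[OF assms(2)]) blast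
  show ?thesis
  proof (rule exp_boundedI)
    fix x
    have "\<bar>f x * g x\<bar> \<le> (A * exp (b * \<bar>x\<bar>)) * (B * exp (c * \<bar>x\<bar>))"
      unfolding abs_mult using f g by (intro mult_mono) auto
    then show "\<bar>f x * g x\<bar> \<le> (A * B) * exp ((b + c) * \<bar>x\<bar>)"
      by (simp add: algebra_simps exp_add)
  qed
qed

lemma exp_bounded_add:
  assumes "exp_bounded f" "exp_bounded g"
  shows "exp_bounded (\<lambda>x. f x + g x)"
proof -
  obtain A b where f: "0 \<le> A" "0 < b" "\<And>x. \<bar>f x\<bar> \<le> A * exp (b * \<bar>x\<bar>)" by (rule exp_boundedE[OF assms(1)]) blast
  obtain B c where g: "0 \<le> B" "0 < c" "\<And>x. \<bar>g x\<bar> \<le> B * exp (c * \<bar>x\<bar>)" by (rule exp_boundedE[OF assms(2)]) blast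
  show ?thesis
  proof (rule exp_boundedI)
    fix x
    have "A * exp (b * \<bar>x\<bar>) \<le> A * exp ((b + c) * \<bar>x\<bar>)" "B * exp (c * \<bar>x\<bar>) \<le> B * exp ((b + c) * \<bar>x\<bar>)"
      using f g by (auto intro!: mult_left_mono mult_right_mono)
    with f(3)[of x] g(3)[of x] show "\<bar>f x + g x\<bar> \<le> (A + B) * exp ((b + c) * \<bar>x\<bar>)"
      unfolding distrib_right[of A] by linarith
  qed
qed

lemma exp_bounded_sum:
  "(\<And>i. i \<in> I \<Longrightarrow> exp_bounded (f i)) \<Longrightarrow> exp_bounded (\<lambda>x. \<Sum>i\<in>I. f i x)"
  by (induction I rule: infinite_finite_induct) (auto intro: exp_bounded_const exp_bounded_add)

lemma exp_bounded_affine: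
  assumes "exp_bounded g"
  shows "exp_bounded (\<lambda>x. g (a * x + c))"
proof -
  obtain A b where g: "0 \<le> A" "0 < b" "\<And>x. \<bar>g x\<bar> \<le> A * exp (b * \<bar>x\<bar>)" by (rule exp_boundedE[OF assms(1)]) blast
  show ?thesis
  proof (rule exp_boundedI)
    fix x
    have "b * \<bar>a * x + c\<bar> \<le> b * (\<bar>a\<bar> * \<bar>x\<bar> + \<bar>c\<bar>)"
      using g(2) abs_triangle_ineq[of "a * x" c] by (intro mult_left_mono) (auto simp: abs_mult)
    then have "A * exp (b * \<bar>a * x + c\<bar>) \<le> A * exp (b * (\<bar>a\<bar> * \<bar>x\<bar> + \<bar>c\<bar>))"
      using g(1) by (intro mult_left_mono) auto
    also have "\<dots> = (A * exp (b * \<bar>c\<bar>)) * exp ((b * \<bar>a\<bar>) * \<bar>x\<bar>)"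
      by (simp add: distrib_left exp_add mult_ac)
    finally show "\<bar>g (a * x + c)\<bar> \<le> (A * exp (b * \<bar>c\<bar>)) * exp ((b * \<bar>a\<bar>) * \<bar>x\<bar>)"
      using g(3)[of "a * x + c"] by linarith
  qed
qed

lemma abs_le_exp_abs: "\<bar>x\<bar> \<le> exp \<bar>x\<bar>" for x :: real
  using exp_ge_add_one_self[of "\<bar>x\<bar>"] by linarith

lemma exp_bounded_id: "exp_bounded (\<lambda>x. x)"
  by (rule exp_boundedI[of _ 1 1]) (simp add: abs_le_exp_abs)

lemma integrable_std_normal_exp_bounded:
  assumes "exp_bounded g" and [measurable]: "g \<in> borel_measurable borel"
  shows "integrable lborel (\<lambda>x. std_normal_density x * g x)"
proof -
  obtain A b where g: "0 \<le> A" "0 < b" "\<And>x. \<bar>g x\<bar> \<le> A * exp (b * \<bar>x\<bar>)" by (rule exp_boundedE[OF assms(1)]) blast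
  show ?thesis
  proof (rule Bochner_Integration.integrable_bound)
    show "integrable lborel (\<lambda>x. A * (std_normal_density x * exp (b * \<bar>x\<bar>)))"
      by (intro integrable_mult_right integrable_normal_exp_abs) simp
    show "AE x in lborel. norm (std_normal_density x * g x) \<le> norm (A * (std_normal_density x * exp (b * \<bar>x\<bar>)))"
    proof (intro AE_I2)
      fix x
      have "std_normal_density x * \<bar>g x\<bar> \<le> std_normal_density x * (A * exp (b * \<bar>x\<bar>))"
        by (intro mult_left_mono g) simp
      then show "norm (std_normal_density x * g x) \<le> norm (A * (std_normal_density x * exp (b * \<bar>x\<bar>)))"
        using g(1) by (simp add: abs_mult mult_ac)
    qed
  qed measurable
qed

text \<open>The fundamental theorem of calculus on the whole line is applied to
  \<open>std_normal_density x * g x\<close>, whose derivative is the density times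
  \<open>g' x - x * g x\<close>. Gaussian decay beats the exponential bound at both ends, so no
  boundary terms remain.\<close>

lemma gaussian_integration_by_parts:
  fixes g g' :: "real \<Rightarrow> real"
  assumes g: "\<And>x. (g has_real_derivative g' x) (at x)" and cont: "continuous_on UNIV g'"
    and bounded: "exp_bounded g" "exp_bounded g'"
  shows "(\<integral>x. g' x \<partial>std_normal_distribution) = (\<integral>x. x * g x \<partial>std_normal_distribution)"
proof -
  have cg: "continuous_on UNIV g" by (meson DERIV_isCont continuous_at_imp_continuous_on g)
  have [measurable]: "g \<in> borel_measurable borel" "g' \<in> borel_measurable borel"
    using cg cont by (auto intro: borel_measurable_continuous_onI)
  let ?d = std_normal_density
  have i1: "integrable lborel (\<lambda>x. ?d x * g' x)"
    using bounded(2) by (rule integrable_std_normal_exp_bounded) measurable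
  have i2: "integrable lborel (\<lambda>x. ?d x * (x * g x))"
    by (rule integrable_std_normal_exp_bounded[OF exp_bounded_mult[OF exp_bounded_id bounded(1)]]) measurable
  have d: "(?d has_real_derivative (- x * ?d x)) (at x)" for x
    unfolding std_normal_density_def by (rule derivative_eq_intros refl | simp)+
  obtain A b where gb: "0 \<le> A" "0 < b" "\<And>x. \<bar>g x\<bar> \<le> A * exp (b * \<bar>x\<bar>)" by (rule exp_boundedE[OF bounded(1)]) blast
  have le: "\<bar>?d x * g x\<bar> \<le> A * ?d x * exp (b * \<bar>x\<bar>)" for x
    using mult_left_mono[OF gb(3)[of x], of "?d x"] by (simp add: abs_mult mult_ac)
  have "((\<lambda>x. ?d x * g x) \<longlongrightarrow> 0) at_top"
  proof (rule Lim_null_comparison)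
    show "((\<lambda>x. A * ?d x * exp (b * \<bar>x\<bar>)) \<longlongrightarrow> 0) at_top"
      using gb(2) unfolding std_normal_density_def by real_asymp
  qed (use le in auto)
  moreover have "((\<lambda>x. ?d x * g x) \<longlongrightarrow> 0) at_bot"
  proof (rule Lim_null_comparison)
    show "((\<lambda>x. A * ?d x * exp (b * \<bar>x\<bar>)) \<longlongrightarrow> 0) at_bot"
      using gb(2) unfolding std_normal_density_def by real_asymp
  qed (use le in auto)
  ultimately have "(LBINT x=-\<infinity>..\<infinity>. ?d x * g' x - ?d x * (x * g x)) = 0 - 0"
  proof (intro interval_integral_FTC_integrable[where F="\<lambda>x. ?d x * g x"])
    show "((\<lambda>x. ?d x * g x) has_vector_derivative ?d x * g' x - ?d x * (x * g x)) (at x)" for x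
      unfolding has_real_derivative_iff_has_vector_derivative[symmetric]
      by (rule derivative_eq_intros d g refl | simp add: algebra_simps)+
    show "isCont (\<lambda>x. ?d x * g' x - ?d x * (x * g x)) x" for x
      using cg cont unfolding std_normal_density_def continuous_on_eq_continuous_at[OF open_UNIV]
      by (auto intro!: continuous_intros)
    show "set_integrable lborel (einterval (- \<infinity>) \<infinity>) (\<lambda>x. ?d x * g' x - ?d x * (x * g x))"
      using i1 i2 by (simp add: set_integrable_def)
  qed (auto simp: ereal_tendsto_simps)
  then have "(\<integral>x. ?d x * g' x - ?d x * (x * g x) \<partial>lborel) = 0"
    by (simp add: interval_lebesgue_integral_def set_lebesgue_integral_def)
  with i1 i2 show ?thesis by (simp add: integral_density)
qed

section \<open>Smooth functions of finitely many coordinates along lines\<close>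

lemma has_real_derivative_line:
  fixes f :: "(nat \<Rightarrow> real) \<Rightarrow> real"
  assumes dep: "\<And>x y. (\<And>i. i < n \<Longrightarrow> x i = y i) \<Longrightarrow> f x = f y"
    and diff: "\<And>j x. j < n \<Longrightarrow> ((\<lambda>t. f (x(j := t))) has_real_derivative D j x) (at (x j))"
    and cont: "\<And>j. j < n \<Longrightarrow> continuous_on UNIV (D j)"
  shows "((\<lambda>s. f (\<lambda>i. a i * s + y i)) has_real_derivative
    (\<Sum>j<n. a j * D j (\<lambda>i. if i < n then a i * s + y i else z i))) (at s)"
proof -
  \<comment> \<open>The sequence space carries no norm in which to differentiate, so the coordinates
    are set in motion one by one: the first \<open>m\<close> follow the line, the others rest at
    \<open>z\<close>.\<close>
  define p where "p m z s = (\<lambda>i. if i < m then a i * s + y i else z i)" for m z s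
  have "((\<lambda>s. f (p m z s)) has_real_derivative (\<Sum>j<m. a j * D j (p m z s))) (at s)" if "m \<le> n" for m z s
    using that
  proof (induction m arbitrary: z s)
    case (Suc m)
    define t where "t = a m * s + y m"
    have upd: "p (Suc m) z s' = p m (z(m := a m * s' + y m)) s'" for s'
      by (auto simp: p_def fun_eq_iff less_Suc_eq)
    have cp: "continuous_on UNIV (\<lambda>(s', t'). p m (z(m := t')) s')"
      unfolding p_def case_prod_beta
    proof (rule continuous_on_coordinatewise_then_product)
      show "continuous_on UNIV (\<lambda>x. if i < m then a i * fst x + y i else (z(m := snd x)) i)" for i
        by (cases "i < m"; cases "i = m") (auto intro!: continuous_intros)
    qed
    have "continuous_on UNIV (\<lambda>q. D m (case q of (s', t') \<Rightarrow> p m (z(m := t')) s'))"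
      by (rule continuous_on_compose2[OF cont cp]) (use Suc.prems in auto)
    then have cD: "continuous_on UNIV (\<lambda>(s', t'). D m (p m (z(m := t')) s'))"
      by (simp add: case_prod_beta)
    \<comment> \<open>Coordinate \<open>m\<close> gets its own real variable \<open>t'\<close>,
      which leaves a function of two real variables. One partial derivative comes from the induction
      hypothesis; the other exists everywhere and is continuous, which gives the total derivative.
      Afterwards \<open>t'\<close> is made to follow the line.\<close>
    have "((\<lambda>(s', t'). f (p m (z(m := t')) s')) has_derivative
        (\<lambda>(h, k). h * (\<Sum>j<m. a j * D j (p m (z(m := t)) s)) + blinfun_scaleR_left (D m (p m (z(m := t)) s)) k))
        (at (s, t) within UNIV \<times> UNIV)"
    proof (rule has_derivative_partialsI[where fy="\<lambda>s' t'. blinfun_scaleR_left (D m (p m (z(m := t')) s'))"])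
      show "((\<lambda>s'. f (p m (z(m := t)) s')) has_derivative (\<lambda>h. h * (\<Sum>j<m. a j * D j (p m (z(m := t)) s)))) (at s)"
        using Suc.IH[of "z(m := t)" s] Suc.prems unfolding has_field_derivative_def by (simp add: mult.commute[of _ "sum _ _"])
      show "((\<lambda>t'. f (p m (z(m := t')) s')) has_derivative blinfun_apply (blinfun_scaleR_left (D m (p m (z(m := t')) s')))) (at t')" for s' t'
      proof -
        have "(p m (z(m := t')) s')(m := \<tau>) = p m (z(m := \<tau>)) s'" for \<tau>
          by (auto simp: p_def fun_eq_iff)
        moreover have "p m (z(m := t')) s' m = t'" by (simp add: p_def)
        ultimately show ?thesis
          using diff[of m "p m (z(m := t')) s'"] Suc.prems
          by (simp add: has_field_derivative_def mult.commute[of _ "D _ _"])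
      qed
      show "continuous (at (s, t) within UNIV \<times> UNIV) (\<lambda>(s', t'). blinfun_scaleR_left (D m (p m (z(m := t')) s')))"
        using cD unfolding continuous_on_eq_continuous_at[OF open_UNIV] case_prod_beta
        by (intro bounded_linear.continuous[OF bounded_linear_blinfun_scaleR_left]) auto
    qed auto
    then have tot: "((\<lambda>(s', t'). f (p m (z(m := t')) s')) has_derivative
        (\<lambda>(h, k). h * (\<Sum>j<m. a j * D j (p m (z(m := t)) s)) + k * D m (p m (z(m := t)) s)))
        (at ((\<lambda>s'. (s', a m * s' + y m)) s))"
      by (simp add: t_def case_prod_beta)
    have "((\<lambda>s'. (s', a m * s' + y m)) has_derivative (\<lambda>h. (h, a m * h))) (at s)"
      by (auto intro!: derivative_eq_intros)
    from has_derivative_compose[OF this tot]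
    have "((\<lambda>s'. f (p (Suc m) z s')) has_derivative
        (\<lambda>h. h * (\<Sum>j<m. a j * D j (p m (z(m := t)) s)) + a m * h * D m (p m (z(m := t)) s))) (at s)"
      by (simp add: upd)
    then show ?case
      unfolding has_field_derivative_def
      by (rule has_derivative_eq_rhs) (simp add: fun_eq_iff upd t_def algebra_simps)
  qed (simp add: p_def)
  from this[of n z s] have "((\<lambda>s. f (p n z s)) has_real_derivative (\<Sum>j<n. a j * D j (p n z s))) (at s)" by simp
  moreover have "f (p n z s) = f (\<lambda>i. a i * s + y i)" for s by (rule dep) (simp add: p_def)
  ultimately show ?thesis by (simp add: p_def)
qed

lemma smooth_poly_growthD:
  assumes "smooth_poly_growth n f"
  shows "(\<And>i. i < n \<Longrightarrow> x i = y i) \<Longrightarrow> f x = f y"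
    and "set js \<subseteq> {..<n} \<Longrightarrow> continuous_on UNIV (iterated_partial_deriv js f)"
    and "set js \<subseteq> {..<n} \<Longrightarrow> j < n \<Longrightarrow>
      (\<lambda>t. iterated_partial_deriv js f (x(j := t))) field_differentiable at (x j)"
  using assms unfolding smooth_poly_growth_def by blast+

lemma iterated_partial_deriv_simps [simp]:
  "iterated_partial_deriv [] f = f"
  "iterated_partial_deriv (j # js) f = partial_deriv j (iterated_partial_deriv js f)"
  by (simp_all add: iterated_partial_deriv_def)

lemma smooth_poly_growth_line:
  assumes f: "smooth_poly_growth n f"
  shows "((\<lambda>s. f (\<lambda>i. a i * s + y i)) has_real_derivative
    (\<Sum>j<n. a j * partial_deriv j f (\<lambda>i. a i * s + y i))) (at s)"
proof -
  have "((\<lambda>t. f (x(j := t))) has_real_derivative partial_deriv j f x) (at (x j))" if "j < n" for j x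
    using smooth_poly_growthD(3)[OF f, of "[]" j x] that
    unfolding partial_deriv_def by (simp add: field_differentiable_derivI)
  moreover have "continuous_on UNIV (partial_deriv j f)" if "j < n" for j
    using smooth_poly_growthD(2)[OF f, of "[j]"] that by simp
  ultimately have "((\<lambda>s. f (\<lambda>i. a i * s + y i)) has_real_derivative
    (\<Sum>j<n. a j * partial_deriv j f (\<lambda>i. if i < n then a i * s + y i else (\<lambda>i. a i * s + y i) i))) (at s)"
    by (intro has_real_derivative_line) (use smooth_poly_growthD(1)[OF f] in blast)+
  then show ?thesis by (simp cong: if_cong)
qed

lemma smooth_poly_growth_exp_bound:
  assumes "smooth_poly_growth n f" "set js \<subseteq> {..<n}"
  obtains A b where "0 \<le> A" "0 < b"
    "\<And>x. \<bar>iterated_partial_deriv js f x\<bar> \<le> A * exp (b * (\<Sum>i<n. \<bar>x i\<bar>))"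
proof -
  obtain C k where *: "\<bar>iterated_partial_deriv js f x\<bar> \<le> C * (1 + L2_set x {..<n}) ^ k" for x
    using assms unfolding smooth_poly_growth_def by blast
  \<comment> \<open>\<open>Suc k\<close> in place of \<open>k\<close> keeps the rate positive when
    \<open>k = 0\<close>.\<close>
  have "\<bar>iterated_partial_deriv js f x\<bar> \<le> \<bar>C\<bar> * exp (real (Suc k) * (\<Sum>i<n. \<bar>x i\<bar>))" for x
  proof -
    let ?S = "\<Sum>i<n. \<bar>x i\<bar>"
    have "1 + L2_set x {..<n} \<le> 1 + ?S" using L2_set_le_sum_abs[of x "{..<n}"] by simp
    also have "\<dots> \<le> exp ?S" by (rule exp_ge_add_one_self)
    finally have "(1 + L2_set x {..<n}) ^ k \<le> exp ?S ^ k" by (intro power_mono) auto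
    also have "\<dots> \<le> exp (real (Suc k) * ?S)"
      by (simp add: exp_of_nat_mult[symmetric] distrib_right sum_nonneg)
    finally have "C * (1 + L2_set x {..<n}) ^ k \<le> \<bar>C\<bar> * exp (real (Suc k) * ?S)"
      by (intro mult_mono) auto
    with *[of x] show ?thesis by linarith
  qed
  then show ?thesis by (intro that[of "\<bar>C\<bar>" "real (Suc k)"]) auto
qed

lemma exp_bounded_line:
  assumes "smooth_poly_growth n f" "set js \<subseteq> {..<n}"
  shows "exp_bounded (\<lambda>s. iterated_partial_deriv js f (\<lambda>i. a i * s + y i))"
proof -
  obtain A b where Ab: "0 \<le> A" "0 < b"
    "\<And>x. \<bar>iterated_partial_deriv js f x\<bar> \<le> A * exp (b * (\<Sum>i<n. \<bar>x i\<bar>))"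
    by (rule smooth_poly_growth_exp_bound[OF assms]) blast
  show ?thesis
  proof (rule exp_boundedI)
    fix s
    have "(\<Sum>i<n. \<bar>a i * s + y i\<bar>) \<le> (\<Sum>i<n. \<bar>a i\<bar> * \<bar>s\<bar> + \<bar>y i\<bar>)"
      by (intro sum_mono) (metis abs_mult abs_triangle_ineq)
    then have "b * (\<Sum>i<n. \<bar>a i * s + y i\<bar>) \<le> b * ((\<Sum>i<n. \<bar>a i\<bar>) * \<bar>s\<bar> + (\<Sum>i<n. \<bar>y i\<bar>))"
      using Ab(2) by (intro mult_left_mono) (auto simp: sum.distrib sum_distrib_right)
    then have "A * exp (b * (\<Sum>i<n. \<bar>a i * s + y i\<bar>)) \<le> A * exp (b * ((\<Sum>i<n. \<bar>a i\<bar>) * \<bar>s\<bar> + (\<Sum>i<n. \<bar>y i\<bar>)))"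
      using Ab(1) by (intro mult_left_mono) auto
    also have "\<dots> = (A * exp (b * (\<Sum>i<n. \<bar>y i\<bar>))) * exp ((b * (\<Sum>i<n. \<bar>a i\<bar>)) * \<bar>s\<bar>)"
      by (simp add: distrib_left exp_add mult_ac)
    finally show "\<bar>iterated_partial_deriv js f (\<lambda>i. a i * s + y i)\<bar> \<le>
        (A * exp (b * (\<Sum>i<n. \<bar>y i\<bar>))) * exp ((b * (\<Sum>i<n. \<bar>a i\<bar>)) * \<bar>s\<bar>)"
      using Ab(3)[of "\<lambda>i. a i * s + y i"] by linarith
  qed
qed

lemma measurable_comp_coordinates:
  fixes g :: "(nat \<Rightarrow> real) \<Rightarrow> real" and v :: "nat \<Rightarrow> 'i"
  assumes "continuous_on UNIV g"
  shows "(\<lambda>p. g (\<lambda>i. p (v i))) \<in> borel_measurable (PiM UNIV (\<lambda>_. borel))"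
proof -
  have "(\<lambda>p i. p (v i)) \<in> borel_measurable (PiM UNIV (\<lambda>_. borel :: real measure))"
    by (rule measurable_coordinatewise_then_product) measurable
  then show ?thesis
    by (rule measurable_compose) (rule borel_measurable_continuous_onI[OF assms])
qed

text \<open>Young's inequality with generous constants. The free weight \<open>r\<close> does the
  work of Cauchy-Schwarz: it is tuned afterwards to the size of the integrals.\<close>

lemma mult_le_square_add_square:
  fixes x y r :: real
  assumes "0 < r"
  shows "x * y \<le> x\<^sup>2 / r + r * y\<^sup>2"
proof -
  have "0 \<le> (x - r * y)\<^sup>2 + x\<^sup>2 + (r * y)\<^sup>2" by simp
  then have "r * (x * y) \<le> x\<^sup>2 + r * (r * y\<^sup>2)"
    by (simp add: power2_eq_square algebra_simps)
  then have "(r * (x * y)) / r \<le> (x\<^sup>2 + r * (r * y\<^sup>2)) / r"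
    using assms by (intro divide_right_mono) auto
  then show ?thesis using assms by (simp add: add_divide_distrib)
qed

section \<open>Square-integrable functions and convergence in mean square\<close>

lemma square_integrable_diff:
  fixes f g :: "'a \<Rightarrow> 'b::{banach, second_countable_topology}"
  assumes "square_integrable M f" "square_integrable M g"
  shows "square_integrable M (\<lambda>\<omega>. f \<omega> - g \<omega>)"
proof -
  have [measurable]: "f \<in> borel_measurable M" "g \<in> borel_measurable M"
    and i: "integrable M (\<lambda>\<omega>. (norm (f \<omega>))\<^sup>2)" "integrable M (\<lambda>\<omega>. (norm (g \<omega>))\<^sup>2)"
    using assms by (auto simp: square_integrable_def)
  have "integrable M (\<lambda>\<omega>. (norm (f \<omega> - g \<omega>))\<^sup>2)"
  proof (rule Bochner_Integration.integrable_bound)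
    show "integrable M (\<lambda>\<omega>. 2 * (norm (f \<omega>))\<^sup>2 + 2 * (norm (g \<omega>))\<^sup>2)"
      using i by simp
    have "(norm (f \<omega> - g \<omega>))\<^sup>2 \<le> 2 * (norm (f \<omega>))\<^sup>2 + 2 * (norm (g \<omega>))\<^sup>2" for \<omega>
    proof -
      have "(norm (f \<omega> - g \<omega>))\<^sup>2 \<le> (norm (f \<omega>) + norm (g \<omega>))\<^sup>2"
        by (intro power_mono norm_triangle_ineq4) auto
      also have "\<dots> \<le> 2 * (norm (f \<omega>))\<^sup>2 + 2 * (norm (g \<omega>))\<^sup>2"
        using sum_squares_bound[of "norm (f \<omega>)" "norm (g \<omega>)"] by (simp add: power2_sum)
      finally show ?thesis .
    qed
    then show "AE \<omega> in M. norm ((norm (f \<omega> - g \<omega>))\<^sup>2) \<le> norm (2 * (norm (f \<omega>))\<^sup>2 + 2 * (norm (g \<omega>))\<^sup>2)"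
      by auto
  qed measurable
  then show ?thesis by (simp add: square_integrable_def)
qed

lemma square_integrable_inner_right:
  fixes f :: "'a \<Rightarrow> 'b::{real_inner, banach, second_countable_topology}"
  assumes "square_integrable M f"
  shows "square_integrable M (\<lambda>\<omega>. f \<omega> \<bullet> u)"
proof -
  have [measurable]: "f \<in> borel_measurable M" and i: "integrable M (\<lambda>\<omega>. (norm (f \<omega>))\<^sup>2)"
    using assms by (auto simp: square_integrable_def)
  have "integrable M (\<lambda>\<omega>. (norm (f \<omega> \<bullet> u))\<^sup>2)"
  proof (rule Bochner_Integration.integrable_bound)
    show "integrable M (\<lambda>\<omega>. (norm (f \<omega>))\<^sup>2 * (norm u)\<^sup>2)" using i by simp
    have "(f \<omega> \<bullet> u)\<^sup>2 \<le> (norm (f \<omega>))\<^sup>2 * (norm u)\<^sup>2" for \<omega>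
      using Cauchy_Schwarz_ineq[of "f \<omega>" u] by (simp add: power2_norm_eq_inner)
    then show "AE \<omega> in M. norm ((norm (f \<omega> \<bullet> u))\<^sup>2) \<le> norm ((norm (f \<omega>))\<^sup>2 * (norm u)\<^sup>2)" by auto
  qed measurable
  then show ?thesis by (simp add: square_integrable_def)
qed

lemma integrable_mult_L2:
  fixes f g :: "'a \<Rightarrow> real"
  assumes "square_integrable M f" "square_integrable M g"
  shows "integrable M (\<lambda>\<omega>. f \<omega> * g \<omega>)"
proof -
  have [measurable]: "f \<in> borel_measurable M" "g \<in> borel_measurable M"
    and i: "integrable M (\<lambda>\<omega>. (f \<omega>)\<^sup>2)" "integrable M (\<lambda>\<omega>. (g \<omega>)\<^sup>2)"
    using assms by (auto simp: square_integrable_def)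
  show ?thesis
  proof (rule Bochner_Integration.integrable_bound)
    show "integrable M (\<lambda>\<omega>. (f \<omega>)\<^sup>2 + (g \<omega>)\<^sup>2)" using i by simp
    have "\<bar>f \<omega> * g \<omega>\<bar> \<le> (f \<omega>)\<^sup>2 + (g \<omega>)\<^sup>2" for \<omega>
      using mult_le_square_add_square[of 1 "\<bar>f \<omega>\<bar>" "\<bar>g \<omega>\<bar>"] by (simp add: abs_mult)
    then show "AE \<omega> in M. norm (f \<omega> * g \<omega>) \<le> norm ((f \<omega>)\<^sup>2 + (g \<omega>)\<^sup>2)" by auto
  qed measurable
qed

lemma tendsto_L2_iff:
  fixes f :: "nat \<Rightarrow> 'a \<Rightarrow> 'b::{banach, second_countable_topology}"
  assumes "\<And>k. square_integrable M (f k)" "square_integrable M g"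
  shows "tendsto_L2 M f g \<longleftrightarrow> (\<lambda>k. \<integral>\<omega>. (norm (f k \<omega> - g \<omega>))\<^sup>2 \<partial>M) \<longlonglongrightarrow> 0"
proof -
  have "integrable M (\<lambda>\<omega>. (norm (f k \<omega> - g \<omega>))\<^sup>2)" for k
    using square_integrable_diff[OF assms(1)[of k] assms(2)] by (simp add: square_integrable_def)
  then have "(\<integral>\<^sup>+\<omega>. ennreal ((norm (f k \<omega> - g \<omega>))\<^sup>2) \<partial>M) = ennreal (\<integral>\<omega>. (norm (f k \<omega> - g \<omega>))\<^sup>2 \<partial>M)" for k
    by (intro nn_integral_eq_integral) auto
  then show ?thesis
    by (simp add: tendsto_L2_def tendsto_ennreal_iff[of _ _ 0, simplified] integral_nonneg)
qed

text \<open>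
  The weight \<open>r k\<close> in Young's inequality is the square root of the squared \<open>L\<^sup>2\<close> distance,
  shifted by \<open>1 / (k + 1)\<close> to keep it positive.
\<close>

lemma tendsto_L2_integral_inner:
  fixes f :: "nat \<Rightarrow> 'a \<Rightarrow> 'b::{real_inner, banach, second_countable_topology}"
  assumes f: "\<And>k. square_integrable M (f k)" and g: "square_integrable M g"
    and lim: "tendsto_L2 M f g" and T: "square_integrable M T"
  shows "(\<lambda>k. \<integral>\<omega>. (f k \<omega> \<bullet> u) * T \<omega> \<partial>M) \<longlonglongrightarrow> (\<integral>\<omega>. (g \<omega> \<bullet> u) * T \<omega> \<partial>M)"
proof -
  define a where "a k = (\<integral>\<omega>. (norm (f k \<omega> - g \<omega>))\<^sup>2 \<partial>M)" for k
  define B where "B = (\<integral>\<omega>. (norm u)\<^sup>2 * (T \<omega>)\<^sup>2 \<partial>M)"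
  define r where "r k = sqrt (a k + 1 / real (Suc k))" for k
  have a0: "0 \<le> a k" for k by (simp add: a_def integral_nonneg)
  have r0: "0 < r k" for k
    unfolding r_def by (intro real_sqrt_gt_zero add_nonneg_pos a0) auto
  have B0: "0 \<le> B" by (simp add: B_def integral_nonneg)
  have "a \<longlonglongrightarrow> 0" using lim unfolding tendsto_L2_iff[OF f g] a_def .
  then have "(\<lambda>k. a k + 1 / real (Suc k)) \<longlonglongrightarrow> 0 + 0"
    by (intro tendsto_add LIMSEQ_Suc[OF lim_1_over_n])
  then have "r \<longlonglongrightarrow> 0" unfolding r_def using tendsto_real_sqrt by fastforce
  then have lim0: "(\<lambda>k. (1 + B) * r k) \<longlonglongrightarrow> 0" by (auto intro: tendsto_mult_right_zero)
  have ifT: "integrable M (\<lambda>\<omega>. (f k \<omega> \<bullet> u) * T \<omega>)" for k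
    by (intro integrable_mult_L2 square_integrable_inner_right f T)
  have igT: "integrable M (\<lambda>\<omega>. (g \<omega> \<bullet> u) * T \<omega>)"
    by (intro integrable_mult_L2 square_integrable_inner_right g T)
  have T2: "integrable M (\<lambda>\<omega>. (T \<omega>)\<^sup>2)" using T by (simp add: square_integrable_def)
  have d2: "integrable M (\<lambda>\<omega>. (norm (f k \<omega> - g \<omega>))\<^sup>2)" for k
    using square_integrable_diff[OF f[of k] g] by (simp add: square_integrable_def)
  have bound: "\<bar>(\<integral>\<omega>. (f k \<omega> \<bullet> u) * T \<omega> \<partial>M) - (\<integral>\<omega>. (g \<omega> \<bullet> u) * T \<omega> \<partial>M)\<bar> \<le> (1 + B) * r k" for k
  proof -
    have pt: "\<bar>(f k \<omega> \<bullet> u) * T \<omega> - (g \<omega> \<bullet> u) * T \<omega>\<bar> \<le> (norm (f k \<omega> - g \<omega>))\<^sup>2 / r k + r k * ((norm u)\<^sup>2 * (T \<omega>)\<^sup>2)" for \<omega>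
    proof -
      let ?x = "norm (f k \<omega> - g \<omega>)" and ?y = "norm u * \<bar>T \<omega>\<bar>"
      have "\<bar>(f k \<omega> \<bullet> u) * T \<omega> - (g \<omega> \<bullet> u) * T \<omega>\<bar> = \<bar>(f k \<omega> - g \<omega>) \<bullet> u\<bar> * \<bar>T \<omega>\<bar>"
        by (simp add: inner_diff_left algebra_simps flip: abs_mult)
      also have "\<dots> \<le> (?x * norm u) * \<bar>T \<omega>\<bar>"
        by (intro mult_right_mono Cauchy_Schwarz_ineq2) auto
      also have "\<dots> = ?x * ?y" by simp
      also have "\<dots> \<le> ?x\<^sup>2 / r k + r k * ?y\<^sup>2"
        by (rule mult_le_square_add_square[OF r0])
      finally show ?thesis by (simp add: power_mult_distrib)
    qed
    have "\<bar>(\<integral>\<omega>. (f k \<omega> \<bullet> u) * T \<omega> \<partial>M) - (\<integral>\<omega>. (g \<omega> \<bullet> u) * T \<omega> \<partial>M)\<bar> =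
        \<bar>\<integral>\<omega>. (f k \<omega> \<bullet> u) * T \<omega> - (g \<omega> \<bullet> u) * T \<omega> \<partial>M\<bar>"
      using ifT igT by simp
    also have "\<dots> \<le> (\<integral>\<omega>. (norm (f k \<omega> - g \<omega>))\<^sup>2 / r k + r k * ((norm u)\<^sup>2 * (T \<omega>)\<^sup>2) \<partial>M)"
      by (rule order_trans[OF integral_abs_bound integral_mono]) (use pt d2 T2 ifT igT in auto)
    also have "\<dots> = a k / r k + r k * B"
      using d2[of k] T2 by (simp add: a_def B_def)
    also have "\<dots> \<le> r k + r k * B"
    proof -
      have "a k \<le> r k * r k" using a0[of k] by (simp add: r_def)
      then show ?thesis using r0[of k] by (simp add: field_simps)
    qed
    finally show ?thesis by (simp add: algebra_simps)
  qed
  have "(\<lambda>k. (\<integral>\<omega>. (f k \<omega> \<bullet> u) * T \<omega> \<partial>M) - (\<integral>\<omega>. (g \<omega> \<bullet> u) * T \<omega> \<partial>M)) \<longlonglongrightarrow> 0"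
    by (rule Lim_null_comparison[OF _ lim0]) (use bound in auto)
  then show ?thesis by (rule Lim_null[THEN iffD2])
qed

section \<open>Integration by parts for smooth functions of the process\<close>

context isonormal_gaussian_process
begin

text \<open>The counterpart of \<open>exp_bounded\<close> on the probability space. Since products
  stay in the class and its members are integrable, all their moments are finite. The bound is
  required at every point, so closure properties involve no null sets.\<close>

definition exp_growth :: "('a \<Rightarrow> real) \<Rightarrow> bool" where
  "exp_growth Y \<longleftrightarrow> Y \<in> borel_measurable M \<and>
    (\<exists>A b vs. \<forall>\<omega>. \<bar>Y \<omega>\<bar> \<le> A * exp (b * (\<Sum>v\<leftarrow>vs. \<bar>X v \<omega>\<bar>)))"

lemma exp_growthI:
  "Y \<in> borel_measurable M \<Longrightarrow> (\<And>\<omega>. \<bar>Y \<omega>\<bar> \<le> A * exp (b * (\<Sum>v\<leftarrow>vs. \<bar>X v \<omega>\<bar>))) \<Longrightarrow> exp_growth Y"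
  unfolding exp_growth_def by blast

lemma sum_list_abs_nonneg: "0 \<le> (\<Sum>v\<leftarrow>vs. \<bar>X v \<omega>\<bar>)"
  by (intro sum_list_nonneg) auto

lemma exp_growthE:
  assumes "exp_growth Y"
  obtains A b vs where "0 \<le> A" "0 < b" "\<And>\<omega>. \<bar>Y \<omega>\<bar> \<le> A * exp (b * (\<Sum>v\<leftarrow>vs. \<bar>X v \<omega>\<bar>))"
proof -
  obtain A b vs where *: "\<bar>Y \<omega>\<bar> \<le> A * exp (b * (\<Sum>v\<leftarrow>vs. \<bar>X v \<omega>\<bar>))" for \<omega>
    using assms by (auto simp: exp_growth_def)
  have "\<bar>Y \<omega>\<bar> \<le> \<bar>A\<bar> * exp ((\<bar>b\<bar> + 1) * (\<Sum>v\<leftarrow>vs. \<bar>X v \<omega>\<bar>))" for \<omega>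
  proof -
    have "A * exp (b * (\<Sum>v\<leftarrow>vs. \<bar>X v \<omega>\<bar>)) \<le> \<bar>A\<bar> * exp ((\<bar>b\<bar> + 1) * (\<Sum>v\<leftarrow>vs. \<bar>X v \<omega>\<bar>))"
      using sum_list_abs_nonneg by (intro mult_mono) (auto intro!: mult_right_mono)
    with *[of \<omega>] show ?thesis by linarith
  qed
  then show ?thesis by (intro that[of "\<bar>A\<bar>" "\<bar>b\<bar> + 1"]) auto
qed

lemma exp_growth_measurable: "exp_growth Y \<Longrightarrow> Y \<in> borel_measurable M"
  by (simp add: exp_growth_def)

lemma exp_growth_integrable:
  assumes "exp_growth Y"
  shows "integrable M Y"
proof -
  obtain A b vs where *: "0 \<le> A" "\<And>\<omega>. \<bar>Y \<omega>\<bar> \<le> A * exp (b * (\<Sum>v\<leftarrow>vs. \<bar>X v \<omega>\<bar>))"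
    by (rule exp_growthE[OF assms]) blast
  show ?thesis
  proof (rule Bochner_Integration.integrable_bound)
    show "integrable M (\<lambda>\<omega>. A * exp (b * (\<Sum>v\<leftarrow>vs. \<bar>X v \<omega>\<bar>)))"
      by (intro integrable_mult_right integrable_exp_sum_abs_X)
    show "AE \<omega> in M. norm (Y \<omega>) \<le> norm (A * exp (b * (\<Sum>v\<leftarrow>vs. \<bar>X v \<omega>\<bar>)))"
      using * by (auto simp: abs_mult)
  qed (use assms in \<open>simp add: exp_growth_measurable\<close>)
qed

lemma exp_growth_const: "exp_growth (\<lambda>_. c)"
  by (rule exp_growthI[where A="\<bar>c\<bar>" and b=0]) auto

lemma exp_growth_mult:
  assumes "exp_growth Y" "exp_growth Z"
  shows "exp_growth (\<lambda>\<omega>. Y \<omega> * Z \<omega>)"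
proof -
  obtain A b vs where Y: "0 \<le> A" "0 < b" "\<And>\<omega>. \<bar>Y \<omega>\<bar> \<le> A * exp (b * (\<Sum>v\<leftarrow>vs. \<bar>X v \<omega>\<bar>))"
    by (rule exp_growthE[OF assms(1)]) blast
  obtain B c us where Z: "0 \<le> B" "0 < c" "\<And>\<omega>. \<bar>Z \<omega>\<bar> \<le> B * exp (c * (\<Sum>v\<leftarrow>us. \<bar>X v \<omega>\<bar>))"
    by (rule exp_growthE[OF assms(2)]) blast
  show ?thesis
  proof (rule exp_growthI)
    fix \<omega>
    let ?S = "\<Sum>v\<leftarrow>vs. \<bar>X v \<omega>\<bar>" and ?T = "\<Sum>v\<leftarrow>us. \<bar>X v \<omega>\<bar>"
    have "\<bar>Y \<omega> * Z \<omega>\<bar> \<le> (A * exp (b * ?S)) * (B * exp (c * ?T))"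
      unfolding abs_mult by (intro mult_mono Y Z) (use Y Z in auto)
    also have "\<dots> = (A * B) * exp (b * ?S + c * ?T)" by (simp add: exp_add)
    also have "\<dots> \<le> (A * B) * exp ((b + c) * (?S + ?T))"
    proof -
      have "0 \<le> b * ?T" "0 \<le> c * ?S" using Y Z sum_list_abs_nonneg by (simp_all add: )
      then show ?thesis using Y Z by (intro mult_left_mono) (auto simp: algebra_simps)
    qed
    finally show "\<bar>Y \<omega> * Z \<omega>\<bar> \<le> (A * B) * exp ((b + c) * (\<Sum>v\<leftarrow>vs @ us. \<bar>X v \<omega>\<bar>))" by simp
  qed (intro borel_measurable_times borel_measurable_add exp_growth_measurable assms)
qed

lemma exp_growth_add:
  assumes "exp_growth Y" "exp_growth Z"
  shows "exp_growth (\<lambda>\<omega>. Y \<omega> + Z \<omega>)"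
proof -
  obtain A b vs where Y: "0 \<le> A" "0 < b" "\<And>\<omega>. \<bar>Y \<omega>\<bar> \<le> A * exp (b * (\<Sum>v\<leftarrow>vs. \<bar>X v \<omega>\<bar>))"
    by (rule exp_growthE[OF assms(1)]) blast
  obtain B c us where Z: "0 \<le> B" "0 < c" "\<And>\<omega>. \<bar>Z \<omega>\<bar> \<le> B * exp (c * (\<Sum>v\<leftarrow>us. \<bar>X v \<omega>\<bar>))"
    by (rule exp_growthE[OF assms(2)]) blast
  show ?thesis
  proof (rule exp_growthI)
    fix \<omega>
    let ?S = "\<Sum>v\<leftarrow>vs. \<bar>X v \<omega>\<bar>" and ?T = "\<Sum>v\<leftarrow>us. \<bar>X v \<omega>\<bar>"
    have nn: "0 \<le> b * ?T" "0 \<le> c * ?S" "0 \<le> b * ?S" "0 \<le> c * ?T"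
      using Y Z sum_list_abs_nonneg by simp_all
    have "A * exp (b * ?S) \<le> A * exp ((b + c) * (?S + ?T))"
      "B * exp (c * ?T) \<le> B * exp ((b + c) * (?S + ?T))"
      using Y Z nn by (auto intro!: mult_left_mono simp: algebra_simps)
    with Y(3)[of \<omega>] Z(3)[of \<omega>]
    show "\<bar>Y \<omega> + Z \<omega>\<bar> \<le> (A + B) * exp ((b + c) * (\<Sum>v\<leftarrow>vs @ us. \<bar>X v \<omega>\<bar>))"
      unfolding distrib_right[of A] by simp
  qed (intro borel_measurable_times borel_measurable_add exp_growth_measurable assms)
qed

lemma exp_growth_diff:
  assumes "exp_growth Y" "exp_growth Z"
  shows "exp_growth (\<lambda>\<omega>. Y \<omega> - Z \<omega>)"
  using exp_growth_add[OF assms(1) exp_growth_mult[OF exp_growth_const[of "-1"] assms(2)]] by simp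

lemma exp_growth_sum:
  "(\<And>i. i \<in> I \<Longrightarrow> exp_growth (Y i)) \<Longrightarrow> exp_growth (\<lambda>\<omega>. \<Sum>i\<in>I. Y i \<omega>)"
  by (induction I rule: infinite_finite_induct) (auto intro: exp_growth_const exp_growth_add)

lemma exp_growth_comp_X:
  assumes "exp_bounded g" and [measurable]: "g \<in> borel_measurable borel"
  shows "exp_growth (\<lambda>\<omega>. g (X v \<omega>))"
proof -
  obtain A b where g: "\<And>x. \<bar>g x\<bar> \<le> A * exp (b * \<bar>x\<bar>)"
    by (rule exp_boundedE[OF assms(1)]) blast
  show ?thesis by (rule exp_growthI[where A=A and b=b and vs="[v]"]) (simp_all add: g)
qed

lemma exp_growth_X: "exp_growth (X v)"
  using exp_growth_comp_X[OF exp_bounded_id, of v] by simp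

lemma exp_growth_smooth:
  assumes "smooth_poly_growth n f" "set js \<subseteq> {..<n}"
  shows "exp_growth (\<lambda>\<omega>. iterated_partial_deriv js f (\<lambda>i. X (v i) \<omega>))"
proof -
  obtain A b where Ab: "0 \<le> A" "0 < b"
    "\<And>x. \<bar>iterated_partial_deriv js f x\<bar> \<le> A * exp (b * (\<Sum>i<n. \<bar>x i\<bar>))"
    by (rule smooth_poly_growth_exp_bound[OF assms]) blast
  have "(\<lambda>\<omega>. iterated_partial_deriv js f (\<lambda>i. X (v i) \<omega>)) \<in> borel_measurable M"
    using measurable_compose[OF measurable_path measurable_comp_coordinates[OF smooth_poly_growthD(2)[OF assms]]] .
  then show ?thesis
    by (rule exp_growthI[where A=A and b=b and vs="map v [0..<n]"])
       (use Ab(3) in \<open>simp add: o_def interv_sum_list_conv_sum_set_nat atLeast0LessThan\<close>)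
qed

lemma exp_growth_square_integrable: "exp_growth Y \<Longrightarrow> square_integrable M Y"
  using exp_growth_integrable[OF exp_growth_mult[of Y Y]]
  by (simp add: square_integrable_def exp_growth_measurable power2_eq_square)

lemma exp_growth_smooth_0: "smooth_poly_growth n f \<Longrightarrow> exp_growth (\<lambda>\<omega>. f (\<lambda>i. X (v i) \<omega>))"
  using exp_growth_smooth[of n f "[]"] by simp

lemma exp_growth_partial_deriv:
  "smooth_poly_growth n f \<Longrightarrow> j < n \<Longrightarrow> exp_growth (\<lambda>\<omega>. partial_deriv j f (\<lambda>i. X (v i) \<omega>))"
  using exp_growth_smooth[of n f "[j]"] by simp

text \<open>Equality in law followed by Fubini: in the inner integral the part of the path
  orthogonal to \<open>u\<close> is frozen.\<close>

lemma integral_split: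
  fixes H :: "('h \<Rightarrow> real) \<Rightarrow> real"
  assumes u: "norm u = 1" and [measurable]: "H \<in> borel_measurable paths"
    and int: "integrable M (\<lambda>\<omega>. H (\<lambda>v. X v \<omega>))"
  shows "(\<integral>\<omega>. H (\<lambda>v. X v \<omega>) \<partial>M) =
    (\<integral>\<omega>. (\<integral>x. H (\<lambda>v. (v \<bullet> u) * x + X (v - (v \<bullet> u) *\<^sub>R u) \<omega>) \<partial>std_normal_distribution) \<partial>M)"
proof -
  interpret G: prob_space std_normal_distribution by (rule prob_space_normal_density) simp
  interpret GM: pair_prob_space std_normal_distribution M ..
  let ?Z = "\<lambda>z v. (v \<bullet> u) * fst z + X (v - (v \<bullet> u) *\<^sub>R u) (snd z)"
  have Z [measurable]: "?Z \<in> measurable (std_normal_distribution \<Otimes>\<^sub>M M) paths"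
    by (rule measurable_PiM_single') auto
  have "integrable (distr M paths (\<lambda>\<omega> v. X v \<omega>)) H"
    using int by (subst integrable_distr_eq) auto
  then have i: "integrable (std_normal_distribution \<Otimes>\<^sub>M M) (\<lambda>z. H (?Z z))"
    unfolding law_split[OF u, symmetric] by (subst (asm) integrable_distr_eq) auto
  have "(\<integral>\<omega>. H (\<lambda>v. X v \<omega>) \<partial>M) = integral\<^sup>L (distr M paths (\<lambda>\<omega> v. X v \<omega>)) H"
    by (subst integral_distr) auto
  also have "\<dots> = (\<integral>z. H (?Z z) \<partial>(std_normal_distribution \<Otimes>\<^sub>M M))"
    unfolding law_split[OF u, symmetric] by (subst integral_distr) auto
  also have "\<dots> = (\<integral>\<omega>. (\<integral>x. H (?Z (x, \<omega>)) \<partial>std_normal_distribution) \<partial>M)"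
    using GM.integral_snd[of "\<lambda>x \<omega>. H (?Z (x, \<omega>))"] i by (simp add: case_prod_unfold)
  finally show ?thesis by simp
qed

text \<open>With the remainder orthogonal to \<open>u\<close> frozen, \<open>f\<close> and
  \<open>\<theta>\<close> become functions of one standard normal variable. The identity is
  one-dimensional integration by parts for their product; the term with \<open>\<theta>'\<close>
  comes from the product rule.\<close>

lemma integration_by_parts_smooth:
  assumes f: "smooth_poly_growth n f" and u: "norm u = 1"
    and \<theta>: "\<And>x. (\<theta> has_real_derivative \<theta>' x) (at x)" "continuous_on UNIV \<theta>'"
      "exp_bounded \<theta>" "exp_bounded \<theta>'"
  shows "expectation (\<lambda>\<omega>. (\<Sum>j<n. partial_deriv j f (\<lambda>i. X (v i) \<omega>) * (v j \<bullet> u)) * \<theta> (X w \<omega>)) =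
    expectation (\<lambda>\<omega>. f (\<lambda>i. X (v i) \<omega>) * (X u \<omega> * \<theta> (X w \<omega>) - (w \<bullet> u) * \<theta>' (X w \<omega>)))"
proof -
  have cont: "continuous_on UNIV \<theta>"
    by (meson DERIV_isCont continuous_at_imp_continuous_on \<theta>(1))
  have [measurable]: "\<theta> \<in> borel_measurable borel" "\<theta>' \<in> borel_measurable borel"
    using cont \<theta>(2) by (auto intro: borel_measurable_continuous_onI)
  have cf: "continuous_on UNIV f" using smooth_poly_growthD(2)[OF f, of "[]"] by simp
  have cpf: "continuous_on UNIV (partial_deriv j f)" if "j < n" for j
    using smooth_poly_growthD(2)[OF f, of "[j]"] that by simp
  note [measurable] = measurable_comp_coordinates[OF cf] measurable_comp_coordinates[OF cpf]
  define H1 where "H1 p = (\<Sum>j<n. partial_deriv j f (\<lambda>i. p (v i)) * (v j \<bullet> u)) * \<theta> (p w)" for p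
  define H2 where "H2 p = f (\<lambda>i. p (v i)) * (p u * \<theta> (p w))" for p
  define H3 where "H3 p = f (\<lambda>i. p (v i)) * ((w \<bullet> u) * \<theta>' (p w))" for p
  have H [measurable]: "H1 \<in> borel_measurable paths" "H2 \<in> borel_measurable paths" "H3 \<in> borel_measurable paths"
    unfolding H1_def H2_def H3_def by measurable
  note eg = exp_growth_mult exp_growth_sum exp_growth_smooth_0[OF f] exp_growth_partial_deriv[OF f]
    exp_growth_const exp_growth_X exp_growth_comp_X[OF \<theta>(3)] exp_growth_comp_X[OF \<theta>(4)]
  have I1: "integrable M (\<lambda>\<omega>. H1 (\<lambda>v. X v \<omega>))"
    unfolding H1_def by (intro exp_growth_integrable eg) auto
  have I2: "integrable M (\<lambda>\<omega>. H2 (\<lambda>v. X v \<omega>))"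
    unfolding H2_def by (intro exp_growth_integrable eg) auto
  have I3: "integrable M (\<lambda>\<omega>. H3 (\<lambda>v. X v \<omega>))"
    unfolding H3_def by (intro exp_growth_integrable eg) auto
  let ?Z = "\<lambda>x \<omega> v. (v \<bullet> u) * x + X (v - (v \<bullet> u) *\<^sub>R u) \<omega>"
  have uu: "u \<bullet> u = 1" using u by (simp add: norm_eq_1)
  \<comment> \<open>At \<open>v = u\<close> the remainder is \<open>X 0 \<omega>\<close>, which
    vanishes only almost surely; its vanishing identifies the coordinate at \<open>u\<close> with
    the integration variable \<open>x\<close>.\<close>
  have inner: "(\<integral>x. H1 (?Z x \<omega>) + H3 (?Z x \<omega>) \<partial>std_normal_distribution) =
      (\<integral>x. H2 (?Z x \<omega>) \<partial>std_normal_distribution)" if "X 0 \<omega> = 0" for \<omega>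
  proof -
    define a where "a = (\<lambda>i. v i \<bullet> u)"
    define y where "y = (\<lambda>i. X (v i - (v i \<bullet> u) *\<^sub>R u) \<omega>)"
    define \<kappa> where "\<kappa> = w \<bullet> u"
    define z where "z = X (w - (w \<bullet> u) *\<^sub>R u) \<omega>"
    define l where "l x = (\<lambda>i. a i * x + y i)" for x
    define g where "g x = f (l x) * \<theta> (\<kappa> * x + z)" for x
    define g' where "g' x = (\<Sum>j<n. a j * partial_deriv j f (l x)) * \<theta> (\<kappa> * x + z) + f (l x) * (\<kappa> * \<theta>' (\<kappa> * x + z))" for x
    have cl: "continuous_on UNIV l"
      unfolding l_def by (intro continuous_on_coordinatewise_then_product continuous_intros)
    have "(\<integral>x. g' x \<partial>std_normal_distribution) = (\<integral>x. x * g x \<partial>std_normal_distribution)"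
    proof (rule gaussian_integration_by_parts)
      show "(g has_real_derivative g' x) (at x)" for x
      proof -
        have "((\<lambda>x. \<theta> (\<kappa> * x + z)) has_real_derivative \<theta>' (\<kappa> * x + z) * \<kappa>) (at x)"
          by (rule DERIV_chain2[OF \<theta>(1)]) (auto intro!: derivative_eq_intros)
        from DERIV_mult[OF smooth_poly_growth_line[OF f, of a y x] this]
        show ?thesis unfolding g_def g'_def l_def by (simp add: algebra_simps)
      qed
      have "continuous_on UNIV (\<lambda>x. partial_deriv j f (l x))" if "j < n" for j
        by (rule continuous_on_compose2[OF cpf[OF that] cl]) auto
      moreover have "continuous_on UNIV (\<lambda>x. f (l x))"
        by (rule continuous_on_compose2[OF cf cl]) auto
      moreover have "continuous_on UNIV (\<lambda>x. \<theta> (\<kappa> * x + z))" "continuous_on UNIV (\<lambda>x. \<theta>' (\<kappa> * x + z))"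
        by (rule continuous_on_compose2[OF cont] continuous_on_compose2[OF \<theta>(2)]; auto intro!: continuous_intros)+
      ultimately show "continuous_on UNIV g'"
        unfolding g'_def by (intro continuous_intros) auto
      have ef: "exp_bounded (\<lambda>x. f (l x))"
        using exp_bounded_line[OF f, of "[]" a y] by (simp add: l_def)
      have epf: "exp_bounded (\<lambda>x. partial_deriv j f (l x))" if "j < n" for j
        using exp_bounded_line[OF f, of "[j]" a y] that by (simp add: l_def)
      show "exp_bounded g" "exp_bounded g'"
        unfolding g_def g'_def
        by (intro exp_bounded_mult exp_bounded_add exp_bounded_sum ef epf exp_bounded_const
            exp_bounded_affine[OF \<theta>(3)] exp_bounded_affine[OF \<theta>(4)]; simp)+
    qed
    moreover have "H1 (?Z x \<omega>) + H3 (?Z x \<omega>) = g' x" for x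
      by (simp add: H1_def H3_def g'_def l_def a_def y_def \<kappa>_def z_def mult.commute)
    moreover have "H2 (?Z x \<omega>) = x * g x" for x
      using that by (simp add: H2_def g_def l_def a_def y_def \<kappa>_def z_def uu)
    ultimately show ?thesis by simp
  qed
  have "(\<integral>\<omega>. H1 (\<lambda>v. X v \<omega>) + H3 (\<lambda>v. X v \<omega>) \<partial>M) =
      (\<integral>\<omega>. (\<integral>x. H1 (?Z x \<omega>) + H3 (?Z x \<omega>) \<partial>std_normal_distribution) \<partial>M)"
    using integral_split[OF u, of "\<lambda>p. H1 p + H3 p"] I1 I3 by simp
  also have "\<dots> = (\<integral>\<omega>. (\<integral>x. H2 (?Z x \<omega>) \<partial>std_normal_distribution) \<partial>M)"
  proof (rule integral_cong_AE)
    show "AE \<omega> in M. (\<integral>x. H1 (?Z x \<omega>) + H3 (?Z x \<omega>) \<partial>std_normal_distribution) =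
      (\<integral>x. H2 (?Z x \<omega>) \<partial>std_normal_distribution)"
      using AE_X_0 by eventually_elim (rule inner)
    interpret G: prob_space std_normal_distribution by (rule prob_space_normal_density) simp
    have "(\<lambda>z. ?Z (snd z) (fst z)) \<in> measurable (M \<Otimes>\<^sub>M std_normal_distribution) paths"
      by (rule measurable_PiM_single') auto
    note m = measurable_compose[OF this]
    show "(\<lambda>\<omega>. \<integral>x. H1 (?Z x \<omega>) + H3 (?Z x \<omega>) \<partial>std_normal_distribution) \<in> borel_measurable M"
      using m[of "\<lambda>p. H1 p + H3 p" borel]
      by (intro G.borel_measurable_lebesgue_integral) (simp add: case_prod_unfold)
    show "(\<lambda>\<omega>. \<integral>x. H2 (?Z x \<omega>) \<partial>std_normal_distribution) \<in> borel_measurable M"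
      using m[of H2 borel] by (intro G.borel_measurable_lebesgue_integral) (simp add: case_prod_unfold)
  qed
  also have "\<dots> = (\<integral>\<omega>. H2 (\<lambda>v. X v \<omega>) \<partial>M)"
    using integral_split[OF u, of H2] I2 by simp
  finally have "(\<integral>\<omega>. H1 (\<lambda>v. X v \<omega>) \<partial>M) = (\<integral>\<omega>. H2 (\<lambda>v. X v \<omega>) - H3 (\<lambda>v. X v \<omega>) \<partial>M)"
    using I1 I2 I3 by simp
  then show ?thesis by (simp add: H1_def H2_def H3_def right_diff_distrib)
qed

end

section \<open>Uniqueness of the Malliavin derivative\<close>

text \<open>The images under \<open>Z\<close> of the measures with densities the positive and the
  negative part of \<open>W\<close> are finite and have the same Fourier transform. They coincide,
  so \<open>H\<close> has the same integral against both.\<close>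

lemma integral_comp_weight_eq_0:
  fixes W :: "'a \<Rightarrow> real" and Z :: "'a \<Rightarrow> 'i \<Rightarrow> real"
  assumes "prob_space M" and W: "integrable M W"
    and Z [measurable]: "Z \<in> measurable M (PiM UNIV (\<lambda>_. borel))"
    and char: "\<And>ts. (CLINT \<omega>|M. W \<omega> *\<^sub>R iexp (lincomb ts (Z \<omega>))) = 0"
    and H [measurable]: "H \<in> borel_measurable (PiM UNIV (\<lambda>_. borel))"
    and HW: "integrable M (\<lambda>\<omega>. H (Z \<omega>) * W \<omega>)"
  shows "(\<integral>\<omega>. H (Z \<omega>) * W \<omega> \<partial>M) = (0 :: real)"
proof -
  interpret prob_space M by fact
  have [measurable]: "W \<in> borel_measurable M" using W by simp
  \<comment> \<open>\<open>s = 1\<close> selects the positive part of \<open>W\<close> and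
    \<open>s = -1\<close> the negative part.\<close>
  define m where "m s = distr (density M (\<lambda>\<omega>. ennreal (max 0 (s * W \<omega>)))) (PiM UNIV (\<lambda>_. borel)) Z" for s :: real
  have ip: "integrable M (\<lambda>\<omega>. max 0 (s * W \<omega>))" for s :: real
    using W by (intro integrable_max) auto
  have fin: "finite_measure (m s)" for s
  proof -
    have "finite_measure (density M (\<lambda>\<omega>. ennreal (max 0 (s * W \<omega>))))"
    proof
      have "emeasure (density M (\<lambda>\<omega>. ennreal (max 0 (s * W \<omega>)))) (space M) = (\<integral>\<^sup>+\<omega>. ennreal (max 0 (s * W \<omega>)) \<partial>M)"
        by (subst emeasure_density) (auto intro!: nn_integral_cong)
      also have "\<dots> = ennreal (\<integral>\<omega>. max 0 (s * W \<omega>) \<partial>M)"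
        by (rule nn_integral_eq_integral[OF ip]) simp
      finally show "emeasure (density M (\<lambda>\<omega>. ennreal (max 0 (s * W \<omega>))))
          (space (density M (\<lambda>\<omega>. ennreal (max 0 (s * W \<omega>))))) \<noteq> \<infinity>" by simp
    qed
    then show ?thesis unfolding m_def by (rule finite_measure.finite_measure_distr) measurable
  qed
  have int: "integral\<^sup>L (m s) f = (\<integral>\<omega>. max 0 (s * W \<omega>) *\<^sub>R f (Z \<omega>) \<partial>M)"
    if [measurable]: "f \<in> borel_measurable (PiM UNIV (\<lambda>_. borel))"
    for f :: "_ \<Rightarrow> 'b::{banach, second_countable_topology}" and s
  proof -
    have "integral\<^sup>L (m s) f = (\<integral>\<omega>. f (Z \<omega>) \<partial>density M (\<lambda>\<omega>. ennreal (max 0 (s * W \<omega>))))"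
      unfolding m_def by (rule integral_distr) measurable
    also have "\<dots> = (\<integral>\<omega>. max 0 (s * W \<omega>) *\<^sub>R f (Z \<omega>) \<partial>M)"
      by (rule integral_density) (use measurable_compose[OF Z that] in simp_all)
    finally show ?thesis .
  qed
  have pm: "max 0 (1 * W \<omega>) - max 0 (-1 * W \<omega>) = W \<omega>" for \<omega> by simp
  have "m 1 = m (-1)"
  proof (rule finite_measure_PiM_char_eqI)
    fix ts
    have i: "integrable M (\<lambda>\<omega>. max 0 (s * W \<omega>) *\<^sub>R iexp (lincomb ts (Z \<omega>)))" for s
      by (rule Bochner_Integration.integrable_bound[OF ip[of s]])
         (auto intro: measurable_compose[OF Z measurable_lincomb])
    have "integral\<^sup>L (m 1) (\<lambda>x. iexp (lincomb ts x)) - integral\<^sup>L (m (-1)) (\<lambda>x. iexp (lincomb ts x)) =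
        (CLINT \<omega>|M. max 0 (1 * W \<omega>) *\<^sub>R iexp (lincomb ts (Z \<omega>)) - max 0 (-1 * W \<omega>) *\<^sub>R iexp (lincomb ts (Z \<omega>)))"
      using i[of 1] i[of "-1"] by (subst (1 2) int) auto
    also have "\<dots> = 0"
      unfolding scaleR_diff_left[symmetric] pm by (rule char)
    finally show "integral\<^sup>L (m 1) (\<lambda>x. iexp (lincomb ts x)) = integral\<^sup>L (m (-1)) (\<lambda>x. iexp (lincomb ts x))"
      by simp
  qed (use fin[of 1] fin[of "-1"] in \<open>simp_all add: m_def\<close>)
  then have eq: "(\<integral>\<omega>. max 0 (1 * W \<omega>) *\<^sub>R H (Z \<omega>) \<partial>M) = (\<integral>\<omega>. max 0 (-1 * W \<omega>) *\<^sub>R H (Z \<omega>) \<partial>M)"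
    using int[OF H, of 1] int[OF H, of "-1"] by simp
  have "integrable M (\<lambda>\<omega>. max 0 (s * W \<omega>) *\<^sub>R H (Z \<omega>))" if "\<bar>s\<bar> = 1" for s
  proof (rule Bochner_Integration.integrable_bound[OF HW])
    have "max 0 (s * W \<omega>) \<le> \<bar>W \<omega>\<bar>" for \<omega> using that by (auto simp: abs_if split: if_splits)
    then show "AE \<omega> in M. norm (max 0 (s * W \<omega>) *\<^sub>R H (Z \<omega>)) \<le> norm (H (Z \<omega>) * W \<omega>)"
      by (auto simp: abs_mult mult.commute[of "\<bar>H _\<bar>"] intro!: mult_right_mono)
  qed measurable
  from this[of 1] this[of "-1"]
  have "(\<integral>\<omega>. max 0 (1 * W \<omega>) *\<^sub>R H (Z \<omega>) \<partial>M) - (\<integral>\<omega>. max 0 (-1 * W \<omega>) *\<^sub>R H (Z \<omega>) \<partial>M) =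
      (\<integral>\<omega>. max 0 (1 * W \<omega>) *\<^sub>R H (Z \<omega>) - max 0 (-1 * W \<omega>) *\<^sub>R H (Z \<omega>) \<partial>M)"
    by (intro Bochner_Integration.integral_diff[symmetric]) auto
  also have "\<dots> = (\<integral>\<omega>. H (Z \<omega>) * W \<omega> \<partial>M)"
    unfolding scaleR_diff_left[symmetric] pm by (simp add: mult.commute)
  finally show ?thesis using eq by simp
qed

context isonormal_gaussian_process
begin

lemma smooth_malliavin_square_integrable:
  assumes "smooth_malliavin X \<phi> \<Phi>"
  shows "square_integrable M \<phi>" "square_integrable M \<Phi>"
proof -
  obtain n f v where f: "smooth_poly_growth n f" and \<phi>: "\<phi> = (\<lambda>\<omega>. f (\<lambda>i. X (v i) \<omega>))"
    and \<Phi>: "\<Phi> = (\<lambda>\<omega>. \<Sum>j<n. partial_deriv j f (\<lambda>i. X (v i) \<omega>) *\<^sub>R v j)"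
    using assms unfolding smooth_malliavin_def by blast
  show "square_integrable M \<phi>"
    unfolding \<phi> by (rule exp_growth_square_integrable[OF exp_growth_smooth_0[OF f]])
  let ?p = "\<lambda>j \<omega>. partial_deriv j f (\<lambda>i. X (v i) \<omega>)"
  have eg: "exp_growth (?p j)" if "j < n" for j using exp_growth_partial_deriv[OF f that] .
  have [measurable]: "\<Phi> \<in> borel_measurable M"
    unfolding \<Phi> using eg[THEN exp_growth_measurable] by (intro borel_measurable_sum borel_measurable_scaleR) auto
  have "integrable M (\<lambda>\<omega>. (norm (\<Phi> \<omega>))\<^sup>2)"
  proof (rule Bochner_Integration.integrable_bound)
    have "exp_growth (\<lambda>\<omega>. \<Sum>j<n. \<Sum>k<n. (?p j \<omega> * ?p k \<omega>) * (v j \<bullet> v k))"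
      using eg by (intro exp_growth_sum exp_growth_mult exp_growth_const) auto
    then show "integrable M (\<lambda>\<omega>. \<Sum>j<n. \<Sum>k<n. (?p j \<omega> * ?p k \<omega>) * (v j \<bullet> v k))"
      by (rule exp_growth_integrable)
    have "(norm (\<Phi> \<omega>))\<^sup>2 = (\<Sum>j<n. \<Sum>k<n. (?p j \<omega> * ?p k \<omega>) * (v j \<bullet> v k))" for \<omega>
      unfolding \<Phi> power2_norm_eq_inner
      by (simp add: inner_sum_left inner_sum_right sum_distrib_left mult_ac inner_commute)
    then show "AE \<omega> in M. norm ((norm (\<Phi> \<omega>))\<^sup>2) \<le> norm (\<Sum>j<n. \<Sum>k<n. (?p j \<omega> * ?p k \<omega>) * (v j \<bullet> v k))"
      by simp
  qed measurable
  then show "square_integrable M \<Phi>" by (simp add: square_integrable_def)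
qed

text \<open>Both sides are continuous in \<open>L\<^sup>2\<close> once the test factors are square
  integrable, so the identity passes from smooth variables to the closure of the graph.\<close>

lemma integration_by_parts:
  assumes FG: "has_malliavin_derivative M X F G" and u: "norm u = 1"
    and \<theta>: "\<And>x. (\<theta> has_real_derivative \<theta>' x) (at x)" "continuous_on UNIV \<theta>'"
      "exp_bounded \<theta>" "exp_bounded \<theta>'"
  shows "expectation (\<lambda>\<omega>. (G \<omega> \<bullet> u) * \<theta> (X w \<omega>)) =
    expectation (\<lambda>\<omega>. F \<omega> * (X u \<omega> * \<theta> (X w \<omega>) - (w \<bullet> u) * \<theta>' (X w \<omega>)))"
proof -
  have F: "square_integrable M F" and G: "square_integrable M G"
    using FG by (auto simp: has_malliavin_derivative_def)
  obtain \<phi> \<Phi> where sm: "\<And>k. smooth_malliavin X (\<phi> k) (\<Phi> k)"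
    and lim: "tendsto_L2 M \<phi> F" "tendsto_L2 M \<Phi> G"
    using FG unfolding has_malliavin_derivative_def by blast
  have cont: "continuous_on UNIV \<theta>"
    by (meson DERIV_isCont continuous_at_imp_continuous_on \<theta>(1))
  have [measurable]: "\<theta> \<in> borel_measurable borel" "\<theta>' \<in> borel_measurable borel"
    using cont \<theta>(2) by (auto intro: borel_measurable_continuous_onI)
  have eg: "exp_growth (\<lambda>\<omega>. \<theta> (X w \<omega>))" "exp_growth (\<lambda>\<omega>. \<theta>' (X w \<omega>))"
    using \<theta> by (auto intro: exp_growth_comp_X)
  have T1: "square_integrable M (\<lambda>\<omega>. \<theta> (X w \<omega>))"
    by (intro exp_growth_square_integrable eg)
  have T2: "square_integrable M (\<lambda>\<omega>. X u \<omega> * \<theta> (X w \<omega>) - (w \<bullet> u) * \<theta>' (X w \<omega>))"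
    by (intro exp_growth_square_integrable exp_growth_diff exp_growth_mult exp_growth_const exp_growth_X eg)
  \<comment> \<open>The factor \<open>\<bullet> 1\<close> writes a real number as an inner product,
    so that the same limit lemma serves \<open>\<phi>\<close> and \<open>\<Phi>\<close>.\<close>
  have eq: "expectation (\<lambda>\<omega>. (\<Phi> k \<omega> \<bullet> u) * \<theta> (X w \<omega>)) =
     expectation (\<lambda>\<omega>. (\<phi> k \<omega> \<bullet> 1) * (X u \<omega> * \<theta> (X w \<omega>) - (w \<bullet> u) * \<theta>' (X w \<omega>)))" for k
  proof -
    obtain n f v where f: "smooth_poly_growth n f" and \<phi>: "\<phi> k = (\<lambda>\<omega>. f (\<lambda>i. X (v i) \<omega>))"
      and \<Phi>: "\<Phi> k = (\<lambda>\<omega>. \<Sum>j<n. partial_deriv j f (\<lambda>i. X (v i) \<omega>) *\<^sub>R v j)"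
      using sm[of k] unfolding smooth_malliavin_def by blast
    show ?thesis
      using integration_by_parts_smooth[OF f u \<theta>, of v w] by (simp add: \<phi> \<Phi> inner_sum_left)
  qed
  have "(\<lambda>k. expectation (\<lambda>\<omega>. (\<Phi> k \<omega> \<bullet> u) * \<theta> (X w \<omega>))) \<longlonglongrightarrow> expectation (\<lambda>\<omega>. (G \<omega> \<bullet> u) * \<theta> (X w \<omega>))"
    by (intro tendsto_L2_integral_inner smooth_malliavin_square_integrable[OF sm] G lim T1)
  moreover have "(\<lambda>k. expectation (\<lambda>\<omega>. (\<phi> k \<omega> \<bullet> 1) * (X u \<omega> * \<theta> (X w \<omega>) - (w \<bullet> u) * \<theta>' (X w \<omega>)))) \<longlonglongrightarrow>
      expectation (\<lambda>\<omega>. (F \<omega> \<bullet> 1) * (X u \<omega> * \<theta> (X w \<omega>) - (w \<bullet> u) * \<theta>' (X w \<omega>)))"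
    by (intro tendsto_L2_integral_inner smooth_malliavin_square_integrable[OF sm] F lim T2)
  ultimately show ?thesis
    unfolding eq by (simp add: LIMSEQ_unique)
qed

text \<open>The right-hand side of integration by parts involves \<open>F\<close> only. Hence the
  difference \<open>W\<close> of the two components is orthogonal to every \<open>cos (X w)\<close>
  and \<open>sin (X w)\<close>, and by Fourier uniqueness to every admissible function of the
  path.\<close>

lemma malliavin_derivative_inner_unique:
  assumes FG: "has_malliavin_derivative M X F G1" "has_malliavin_derivative M X F G2" and u: "norm u = 1"
  shows "AE \<omega> in M. G1 \<omega> \<bullet> u = G2 \<omega> \<bullet> u"
proof -
  have G: "square_integrable M G1" "square_integrable M G2"
    using FG by (auto simp: has_malliavin_derivative_def)
  define W where "W \<omega> = (G1 \<omega> - G2 \<omega>) \<bullet> u" for \<omega>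
  have W: "square_integrable M W"
    unfolding W_def by (intro square_integrable_inner_right square_integrable_diff G)
  have one: "square_integrable M (\<lambda>_. 1 :: real)" by (simp add: square_integrable_def)
  have iW: "integrable M W" using integrable_mult_L2[OF W one] by simp
  have [measurable]: "W \<in> borel_measurable M" using iW by simp
  have bd: "exp_bounded \<theta>" if "\<And>x. \<bar>\<theta> x\<bar> \<le> 1" for \<theta> :: "real \<Rightarrow> real"
    by (rule exp_boundedI[of _ 1 0]) (use that in simp)
  have orth: "expectation (\<lambda>\<omega>. W \<omega> * \<theta> (X w \<omega>)) = 0"
    if \<theta>: "\<And>x. (\<theta> has_real_derivative \<theta>' x) (at x)" "continuous_on UNIV \<theta>'"
      "\<And>x. \<bar>\<theta> x\<bar> \<le> 1" "\<And>x. \<bar>\<theta>' x\<bar> \<le> 1" for \<theta> \<theta>' w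
  proof -
    have [measurable]: "\<theta> \<in> borel_measurable borel"
      by (intro borel_measurable_continuous_onI) (meson DERIV_isCont continuous_at_imp_continuous_on \<theta>(1))
    have T: "square_integrable M (\<lambda>\<omega>. \<theta> (X w \<omega>))"
      by (intro exp_growth_square_integrable exp_growth_comp_X bd \<theta>) auto
    have i: "integrable M (\<lambda>\<omega>. (G \<omega> \<bullet> u) * \<theta> (X w \<omega>))" if "square_integrable M G" for G
      by (intro integrable_mult_L2 square_integrable_inner_right T that)
    have "expectation (\<lambda>\<omega>. W \<omega> * \<theta> (X w \<omega>)) =
        expectation (\<lambda>\<omega>. (G1 \<omega> \<bullet> u) * \<theta> (X w \<omega>)) - expectation (\<lambda>\<omega>. (G2 \<omega> \<bullet> u) * \<theta> (X w \<omega>))"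
      using i[OF G(1)] i[OF G(2)] by (simp add: W_def inner_diff_left left_diff_distrib)
    then show ?thesis
      using integration_by_parts[OF FG(1) u, of \<theta> \<theta>' w] integration_by_parts[OF FG(2) u, of \<theta> \<theta>' w] \<theta> bd
      by simp
  qed
  have cosW: "expectation (\<lambda>\<omega>. W \<omega> * cos (X w \<omega>)) = 0" for w
    by (rule orth[of cos "\<lambda>x. - sin x"]) (auto intro!: derivative_eq_intros continuous_intros)
  have sinW: "expectation (\<lambda>\<omega>. W \<omega> * sin (X w \<omega>)) = 0" for w
    by (rule orth[of sin cos]) (auto intro!: derivative_eq_intros continuous_intros)
  have char: "(CLINT \<omega>|M. W \<omega> *\<^sub>R iexp (lincomb ts (\<lambda>v. X v \<omega>))) = 0" for ts
  proof -
    define w where "w = vcomb ts (\<lambda>v. v :: 'h)"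
    have "(CLINT \<omega>|M. W \<omega> *\<^sub>R iexp (lincomb ts (\<lambda>v. X v \<omega>))) =
        (CLINT \<omega>|M. complex_of_real (W \<omega> * cos (X w \<omega>)) + \<i> * complex_of_real (W \<omega> * sin (X w \<omega>)))"
    proof (rule integral_cong_AE)
      show "(\<lambda>\<omega>. W \<omega> *\<^sub>R iexp (lincomb ts (\<lambda>v. X v \<omega>))) \<in> borel_measurable M"
        using measurable_lincomb_X[of ts "\<lambda>v. v"] by measurable
      show "AE \<omega> in M. W \<omega> *\<^sub>R iexp (lincomb ts (\<lambda>v. X v \<omega>)) =
          complex_of_real (W \<omega> * cos (X w \<omega>)) + \<i> * complex_of_real (W \<omega> * sin (X w \<omega>))"
        using AE_lincomb[of ts "\<lambda>v. v"] unfolding w_def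
        by eventually_elim (simp add: scaleR_conv_of_real exp_Euler cos_of_real sin_of_real algebra_simps)
    qed measurable
    also have "\<dots> = 0"
    proof -
      have "integrable M (\<lambda>\<omega>. W \<omega> * cos (X w \<omega>))" "integrable M (\<lambda>\<omega>. W \<omega> * sin (X w \<omega>))"
        by (rule Bochner_Integration.integrable_bound[OF iW]; auto simp: abs_mult mult_left_le)+
      then show ?thesis using cosW sinW by (simp del: of_real_mult)
    qed
    finally show ?thesis .
  qed
  \<comment> \<open>\<open>W\<close> need not be a function of the path, but each
    \<open>\<Phi> k \<bullet> u\<close> is one and is thus orthogonal to \<open>W\<close>; the
    \<open>L\<^sup>2\<close> limit inherits this.\<close>
  have orthG: "expectation (\<lambda>\<omega>. (G \<omega> \<bullet> u) * W \<omega>) = 0" if FG: "has_malliavin_derivative M X F G" for G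
  proof -
    have G: "square_integrable M G" using FG by (auto simp: has_malliavin_derivative_def)
    obtain \<phi> \<Phi> where sm: "\<And>k. smooth_malliavin X (\<phi> k) (\<Phi> k)" and lim: "tendsto_L2 M \<Phi> G"
      using FG unfolding has_malliavin_derivative_def by blast
    note sq = smooth_malliavin_square_integrable(2)[OF sm]
    have "expectation (\<lambda>\<omega>. (\<Phi> k \<omega> \<bullet> u) * W \<omega>) = 0" for k
    proof -
      obtain n f v where f: "smooth_poly_growth n f"
        and \<Phi>: "\<Phi> k = (\<lambda>\<omega>. \<Sum>j<n. partial_deriv j f (\<lambda>i. X (v i) \<omega>) *\<^sub>R v j)"
        using sm[of k] unfolding smooth_malliavin_def by blast
      define H where "H p = (\<Sum>j<n. partial_deriv j f (\<lambda>i. p (v i)) * (v j \<bullet> u))" for p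
      have cpf: "continuous_on UNIV (partial_deriv j f)" if "j < n" for j
        using smooth_poly_growthD(2)[OF f, of "[j]"] that by simp
      note [measurable] = measurable_comp_coordinates[OF cpf]
      have H: "H \<in> borel_measurable paths" unfolding H_def by measurable
      have eq: "\<Phi> k \<omega> \<bullet> u = H (\<lambda>v. X v \<omega>)" for \<omega>
        by (simp add: \<Phi> H_def inner_sum_left)
      have "integrable M (\<lambda>\<omega>. (\<Phi> k \<omega> \<bullet> u) * W \<omega>)"
        by (intro integrable_mult_L2 square_integrable_inner_right sq W)
      then show ?thesis
        unfolding eq
        using integral_comp_weight_eq_0[OF prob_space_axioms iW measurable_path char H] by simp
    qed
    moreover have "(\<lambda>k. expectation (\<lambda>\<omega>. (\<Phi> k \<omega> \<bullet> u) * W \<omega>)) \<longlonglongrightarrow> expectation (\<lambda>\<omega>. (G \<omega> \<bullet> u) * W \<omega>)"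
      by (intro tendsto_L2_integral_inner sq G lim W)
    ultimately show ?thesis by (simp add: LIMSEQ_const_iff)
  qed
  have "integrable M (\<lambda>\<omega>. (G1 \<omega> \<bullet> u) * W \<omega>)" "integrable M (\<lambda>\<omega>. (G2 \<omega> \<bullet> u) * W \<omega>)"
    by (intro integrable_mult_L2 square_integrable_inner_right G W)+
  \<comment> \<open>Only one of the two factors is expanded, which leaves
    \<open>G1 \<bullet> u\<close> and \<open>G2 \<bullet> u\<close> each tested against
    \<open>W\<close>.\<close>
  then have "expectation (\<lambda>\<omega>. W \<omega> * W \<omega>) = 0"
    using orthG[OF FG(1)] orthG[OF FG(2)] by (subst (1) W_def) (simp add: inner_diff_left left_diff_distrib)
  then have "AE \<omega> in M. W \<omega> * W \<omega> = 0"
    using integral_nonneg_eq_0_iff_AE[of M "\<lambda>\<omega>. W \<omega> * W \<omega>"] integrable_mult_L2[OF W W] by auto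
  then show ?thesis by (auto simp: W_def inner_diff_left)
qed

text \<open>Each direction costs a null set, so separability is used to pass to countably many
  directions. Continuity of the inner product then reaches the direction
  \<open>G1 \<omega> - G2 \<omega>\<close> itself.\<close>

lemma malliavin_derivative_unique:
  assumes FG: "has_malliavin_derivative M X F G1" "has_malliavin_derivative M X F G2"
  shows "AE \<omega> in M. G1 \<omega> = G2 \<omega>"
proof -
  obtain D :: "'h set" where D: "countable D" and meets: "\<And>U. open U \<Longrightarrow> U \<noteq> {} \<Longrightarrow> \<exists>d\<in>D. d \<in> U"
    by (rule countable_dense_setE) blast
  have dense: "closure D = UNIV"
    using meets[of "- closure D"] closure_subset[of D] by auto
  have "AE \<omega> in M. \<forall>u\<in>D. G1 \<omega> \<bullet> u = G2 \<omega> \<bullet> u"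
  proof (subst AE_ball_countable[OF D], intro ballI)
    fix u assume "u \<in> D"
    show "AE \<omega> in M. G1 \<omega> \<bullet> u = G2 \<omega> \<bullet> u"
    proof (cases "u = 0")
      case False
      then have "norm (u /\<^sub>R norm u) = 1" by simp
      from malliavin_derivative_inner_unique[OF FG this] show ?thesis
        by (rule eventually_mono) (use False in simp)
    qed simp
  qed
  then show ?thesis
  proof eventually_elim
    case (elim \<omega>)
    have "closed {u. (G1 \<omega> - G2 \<omega>) \<bullet> u = 0}"
      by (intro closed_Collect_eq continuous_intros)
    then have "closure D \<subseteq> {u. (G1 \<omega> - G2 \<omega>) \<bullet> u = 0}"
      using elim by (intro closure_minimal) (auto simp: inner_diff_left)
    then have "(G1 \<omega> - G2 \<omega>) \<bullet> (G1 \<omega> - G2 \<omega>) = 0" using dense by blast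
    then show ?case by simp
  qed
qed

end

section \<open>Square integrability of the support function\<close>

context isonormal_gaussian_process
begin

text \<open>The existential quantifier stands in for a supremum of absolute values, which in the
  reals would be meaningless on unbounded paths.\<close>

definition tail :: "(nat \<Rightarrow> 'h) \<Rightarrow> real \<Rightarrow> 'a set" where
  "tail c t = {\<omega> \<in> space M. \<exists>i. t < \<bar>X (c i) \<omega>\<bar>}"

lemma sets_tail [measurable]: "tail c t \<in> sets M"
  unfolding tail_def by measurable

lemma tail_subset: "s \<le> t \<Longrightarrow> tail c t \<subseteq> tail c s"
  by (auto simp: tail_def intro: le_less_trans)

lemma tail_antimono: "s \<le> t \<Longrightarrow> prob (tail c t) \<le> prob (tail c s)"
  by (intro finite_measure_mono tail_subset sets_tail)

text \<open>The hypothesis controls the process only from above. Being bounded above by some natural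
  number is a measurable property of the path, so the symmetry of the law transfers it to
  \<open>- X\<close>.\<close>

lemma AE_abs_bounded:
  assumes "AE \<omega> in M. bdd_above (range (\<lambda>i. X (c i) \<omega>))"
  shows "AE \<omega> in M. \<exists>m::nat. \<omega> \<notin> tail c (real m)"
proof -
  let ?P = "\<lambda>p. \<exists>m::nat. \<forall>i::nat. p (c i) \<le> real m"
  have P: "{p \<in> space paths. ?P p} \<in> sets paths" by measurable
  have upper: "AE \<omega> in M. ?P (\<lambda>v. X v \<omega>)"
    using assms
  proof eventually_elim
    case (elim \<omega>)
    then obtain B where "\<And>i. X (c i) \<omega> \<le> B" by (auto simp: bdd_above_def)
    moreover obtain m :: nat where "B \<le> real m" using real_arch_simple by blast
    ultimately show ?case by (intro exI[of _ m]) (metis order_trans)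
  qed
  have m: "(\<lambda>\<omega> v. - X v \<omega>) \<in> measurable M paths" by (rule measurable_PiM_single') auto
  have "AE p in distr M paths (\<lambda>\<omega> v. X v \<omega>). ?P p"
    using upper by (subst AE_distr_iff[OF measurable_path P])
  then have "AE \<omega> in M. ?P (\<lambda>v. - X v \<omega>)"
    unfolding law_uminus[symmetric] by (subst (asm) AE_distr_iff[OF m P])
  with upper show ?thesis
  proof eventually_elim
    case (elim \<omega>)
    then obtain m n :: nat where "\<And>i. X (c i) \<omega> \<le> real m" "\<And>i. - X (c i) \<omega> \<le> real n" by auto
    then have "\<bar>X (c i) \<omega>\<bar> \<le> real (max m n)" for i
      by (smt (verit) max.cobounded1 max.cobounded2 of_nat_le_iff)
    then show ?case by (intro exI[of _ "max m n"]) (auto simp: tail_def not_less)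
  qed
qed

lemma tail_tendsto_0:
  assumes "AE \<omega> in M. bdd_above (range (\<lambda>i. X (c i) \<omega>))"
  shows "(\<lambda>m::nat. prob (tail c (real m))) \<longlonglongrightarrow> 0"
proof -
  have "(\<lambda>m::nat. prob (tail c (real m))) \<longlonglongrightarrow> prob (\<Inter>m::nat. tail c (real m))"
    by (rule finite_Lim_measure_decseq) (auto simp: decseq_def intro!: tail_subset)
  moreover have "prob (\<Inter>m::nat. tail c (real m)) = 0"
    using AE_abs_bounded[OF assms] by (subst prob_eq_0) auto
  ultimately show ?thesis by simp
qed

text \<open>
  Fernique's inequality: \<open>(X + X') / \<surd>2\<close> and \<open>(X - X') / \<surd>2\<close> are independent copies of \<open>X\<close>; if the
  former exceeds \<open>t\<close> and the latter stays below \<open>s\<close>, then both \<open>X\<close> and \<open>X'\<close> exceed \<open>(t - s) / \<surd>2\<close>.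
\<close>

lemma fernique_inequality:
  "(1 - prob (tail c s)) * prob (tail c t) \<le> (prob (tail c ((t - s) / sqrt 2)))\<^sup>2"
proof -
  interpret MM: pair_prob_space M M ..
  let ?Q = "PiM UNIV (\<lambda>_. borel) :: (bool \<times> 'h \<Rightarrow> real) measure"
  let ?Y = "\<lambda>z (b, v). if b then X v (fst z) else X v (snd z)"
  let ?Z = "\<lambda>z (b, v). if b then (X v (fst z) + X v (snd z)) / sqrt 2 else (X v (fst z) - X v (snd z)) / sqrt 2"
  define U where "U = {p \<in> space ?Q. (\<forall>i::nat. \<bar>p (False, c i)\<bar> \<le> s) \<and> (\<exists>i::nat. t < \<bar>p (True, c i)\<bar>)}"
  have U [measurable]: "U \<in> sets ?Q" unfolding U_def by measurable
  have Y: "?Y \<in> measurable (M \<Otimes>\<^sub>M M) ?Q" and Z: "?Z \<in> measurable (M \<Otimes>\<^sub>M M) ?Q"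
    by (rule measurable_PiM_single'; auto)+
  let ?r = "(t - s) / sqrt 2"
  have times: "measure (M \<Otimes>\<^sub>M M) (A \<times> B) = prob A * prob B" if "A \<in> sets M" "B \<in> sets M" for A B
  proof -
    have "emeasure (M \<Otimes>\<^sub>M M) (A \<times> B) = emeasure M A * emeasure M B"
      using that by (rule emeasure_pair_measure_Times)
    then show ?thesis
      by (simp add: measure_def enn2real_mult)
  qed
  have "prob (tail c t) * (1 - prob (tail c s)) = measure (M \<Otimes>\<^sub>M M) (tail c t \<times> (space M - tail c s))"
    by (subst times) (auto simp: prob_compl)
  also have "tail c t \<times> (space M - tail c s) = ?Y -` U \<inter> space (M \<Otimes>\<^sub>M M)"
    by (auto simp: U_def tail_def space_pair_measure space_PiM not_less) (meson not_less)
  also have "measure (M \<Otimes>\<^sub>M M) \<dots> = measure (distr (M \<Otimes>\<^sub>M M) ?Q ?Y) U"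
    by (rule measure_distr[OF Y U, symmetric])
  also have "\<dots> = measure (distr (M \<Otimes>\<^sub>M M) ?Q ?Z) U"
    by (simp only: law_rotation)
  also have "\<dots> = measure (M \<Otimes>\<^sub>M M) (?Z -` U \<inter> space (M \<Otimes>\<^sub>M M))"
    by (rule measure_distr[OF Z U])
  also have "\<dots> \<le> measure (M \<Otimes>\<^sub>M M) (tail c ?r \<times> tail c ?r)"
  proof (rule MM.P.finite_measure_mono)
    show "?Z -` U \<inter> space (M \<Otimes>\<^sub>M M) \<subseteq> tail c ?r \<times> tail c ?r"
    proof
      fix z assume z: "z \<in> ?Z -` U \<inter> space (M \<Otimes>\<^sub>M M)"
      then have sp: "fst z \<in> space M" "snd z \<in> space M" by (auto simp: space_pair_measure)
      from z obtain i where i: "t < \<bar>(X (c i) (fst z) + X (c i) (snd z)) / sqrt 2\<bar>"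
        and s: "\<bar>(X (c i) (fst z) - X (c i) (snd z)) / sqrt 2\<bar> \<le> s"
        by (auto simp: U_def)
      have "t - s < \<bar>sqrt 2 * X (c i) (fst z)\<bar>" "t - s < \<bar>sqrt 2 * X (c i) (snd z)\<bar>"
      proof -
        let ?x = "X (c i) (fst z)" and ?y = "X (c i) (snd z)"
        have "sqrt 2 * ?x = (?x + ?y) / sqrt 2 + (?x - ?y) / sqrt 2"
          "sqrt 2 * ?y = (?x + ?y) / sqrt 2 - (?x - ?y) / sqrt 2"
          by (simp_all add: field_simps)
        with i s show "t - s < \<bar>sqrt 2 * ?x\<bar>" "t - s < \<bar>sqrt 2 * ?y\<bar>" by linarith+
      qed
      then have "?r < \<bar>X (c i) (fst z)\<bar>" "?r < \<bar>X (c i) (snd z)\<bar>"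
        by (simp_all add: abs_mult field_simps)
      with sp show "z \<in> tail c ?r \<times> tail c ?r" by (auto simp: tail_def mem_Times_iff)
    qed
  qed (intro pair_measureI sets_tail)
  also have "\<dots> = (prob (tail c ?r))\<^sup>2" by (simp add: times power2_eq_square)
  finally show ?thesis by (simp add: mult.commute)
qed

text \<open>Fernique's inequality at levels \<open>s\<close> and \<open>2 * t\<close> bounds the
  tail at \<open>2 * t\<close> by a multiple of the square of the tail at \<open>t\<close>, and one
  factor of that square is small. The rate \<open>1 / 8\<close> is chosen to beat the factor 4 by
  which squared levels grow at each doubling.\<close>

lemma tail_geometric:
  assumes "AE \<omega> in M. bdd_above (range (\<lambda>i. X (c i) \<omega>))"
  obtains T where "0 < T" "\<And>k. prob (tail c (2 ^ k * T)) \<le> (1 / 8) ^ k"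
proof -
  have "\<forall>\<^sub>F m in sequentially. prob (tail c (real m)) < 1 / 32"
    using tail_tendsto_0[OF assms] by (rule order_tendstoD) simp
  then obtain m where m: "\<And>n. n \<ge> m \<Longrightarrow> prob (tail c (real n)) < 1 / 32"
    by (auto simp: eventually_sequentially)
  define s where "s = real (Suc m)"
  have s: "s > 0" and Qs: "prob (tail c s) \<le> 1 / 32" using m[of "Suc m"] by (auto simp: s_def)
  \<comment> \<open>Since \<open>sqrt 2 \<le> 3 / 2\<close>, the condition
    \<open>2 * s \<le> t\<close> keeps the level \<open>(2 * t - s) / sqrt 2\<close> at or above
    \<open>t\<close>. The threshold \<open>1 / 32\<close> then gives a factor \<open>1 / 31\<close>,
    more than enough.\<close>
  have step: "prob (tail c (2 * t)) \<le> prob (tail c t) / 8" if t: "2 * s \<le> t" for t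
  proof -
    let ?q = "prob (tail c t)"
    have "sqrt 2 \<le> 3 / 2" by (rule real_le_lsqrt) (auto simp: power2_eq_square)
    then have "t * sqrt 2 \<le> t * (3 / 2)" using t s by (intro mult_left_mono) auto
    then have "t * sqrt 2 \<le> 2 * t - s" using t by linarith
    then have "t \<le> (2 * t - s) / sqrt 2" by (simp add: pos_le_divide_eq)
    then have "prob (tail c ((2 * t - s) / sqrt 2)) \<le> ?q" by (rule tail_antimono)
    then have "(prob (tail c ((2 * t - s) / sqrt 2)))\<^sup>2 \<le> ?q\<^sup>2" by (intro power_mono) auto
    with fernique_inequality[of c s "2 * t"]
    have "(1 - prob (tail c s)) * prob (tail c (2 * t)) \<le> ?q\<^sup>2" by linarith
    moreover have "31 / 32 * prob (tail c (2 * t)) \<le> (1 - prob (tail c s)) * prob (tail c (2 * t))"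
      using Qs by (intro mult_right_mono) auto
    moreover have "?q \<le> 1 / 32" using tail_antimono[of s t c] t s Qs by linarith
    then have "?q * ?q \<le> 1 / 32 * ?q" by (intro mult_right_mono) auto
    moreover have "0 \<le> prob (tail c (2 * t))" by simp
    ultimately show ?thesis unfolding power2_eq_square by linarith
  qed
  show ?thesis
  proof (rule that[of "2 * s"])
    show "prob (tail c (2 ^ k * (2 * s))) \<le> (1 / 8) ^ k" for k
    proof (induction k)
      case (Suc k)
      have "1 * (2 * s) \<le> 2 ^ k * (2 * s)" using s by (intro mult_right_mono) auto
      from step[of "2 ^ k * (2 * s)"] this Suc show ?case by (simp add: mult.assoc)
    qed simp
  qed (use s in simp)
qed

text \<open>Measurability must hold also on the null set of unbounded paths, where
  \<open>support_rv\<close> takes a meaningless but constant value. Replacing the family by that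
  constant there leaves a bounded family with the same suprema.\<close>

lemma measurable_support_rv:
  fixes c :: "nat \<Rightarrow> 'h"
  shows "support_rv X (range c) \<in> borel_measurable M"
proof -
  define B where "B = {\<omega> \<in> space M. \<exists>m::nat. \<forall>i. X (c i) \<omega> \<le> real m}"
  have [measurable]: "B \<in> sets M" unfolding B_def by measurable
  \<comment> \<open>The real supremum is by definition a \<open>LEAST\<close> over upper bounds; for
    an unbounded set the predicate is false everywhere, so the value is the same for all such
    sets.\<close>
  define d :: real where "d = (LEAST x. False)"
  have bdd: "bdd_above (range (\<lambda>i. X (c i) \<omega>)) \<longleftrightarrow> \<omega> \<in> B" if "\<omega> \<in> space M" for \<omega>
  proof
    assume "bdd_above (range (\<lambda>i. X (c i) \<omega>))"
    then obtain b where "\<And>i. X (c i) \<omega> \<le> b" by (auto simp: bdd_above_def)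
    moreover obtain m :: nat where "b \<le> real m" using real_arch_simple by blast
    ultimately show "\<omega> \<in> B" using that unfolding B_def by (auto intro!: exI[of _ m]) (metis order_trans)
  next
    assume "\<omega> \<in> B"
    then obtain m :: nat where "\<And>i. X (c i) \<omega> \<le> real m" by (auto simp: B_def)
    then show "bdd_above (range (\<lambda>i. X (c i) \<omega>))" by (auto intro!: bdd_aboveI2)
  qed
  have "support_rv X (range c) \<omega> = (SUP i. if \<omega> \<in> B then X (c i) \<omega> else d)" if \<omega>: "\<omega> \<in> space M" for \<omega>
  proof (cases "\<omega> \<in> B")
    case False
    then have "\<nexists>x. \<forall>y\<in>range (\<lambda>i. X (c i) \<omega>). y \<le> x"
      using bdd[OF \<omega>] by (auto simp: bdd_above_def)
    then have "Sup (range (\<lambda>i. X (c i) \<omega>)) = d"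
      unfolding Sup_real_def d_def by (metis (no_types, lifting))
    then show ?thesis using False by (simp add: support_rv_def image_image)
  qed (simp add: support_rv_def image_image)
  moreover have "(\<lambda>\<omega>. SUP i. if \<omega> \<in> B then X (c i) \<omega> else d) \<in> borel_measurable M"
  proof (rule borel_measurable_cSUP)
    show "bdd_above (range (\<lambda>i. if \<omega> \<in> B then X (c i) \<omega> else d))" if "\<omega> \<in> space M" for \<omega>
      using bdd[OF that] by (cases "\<omega> \<in> B") auto
  qed auto
  ultimately show ?thesis by (simp cong: measurable_cong)
qed

text \<open>A layer-cake estimate over the levels \<open>2 ^ k * T\<close>: the square of the level
  grows like \<open>4 ^ k\<close>, the tail decays like \<open>(1 / 8) ^ k\<close>, and the products
  are summable.\<close>

lemma square_integrable_support_rv: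
  fixes c :: "nat \<Rightarrow> 'h"
  assumes bdd: "AE \<omega> in M. bdd_above (range (\<lambda>i. X (c i) \<omega>))"
  shows "square_integrable M (support_rv X (range c))"
proof -
  let ?h = "support_rv X (range c)"
  note [measurable] = measurable_support_rv[of c]
  obtain T where T: "0 < T" and q: "\<And>k. prob (tail c (2 ^ k * T)) \<le> (1 / 8) ^ k"
    by (rule tail_geometric[OF bdd]) blast
  have h_le: "\<bar>?h \<omega>\<bar> \<le> t" if "\<omega> \<notin> tail c t" "\<omega> \<in> space M" for \<omega> t
  proof -
    have le: "\<bar>X (c i) \<omega>\<bar> \<le> t" for i using that by (auto simp: tail_def not_less)
    have "?h \<omega> \<le> t" unfolding support_rv_def image_image
      by (rule cSUP_least) (use le in \<open>auto simp: abs_le_iff\<close>)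
    moreover have "X (c 0) \<omega> \<le> ?h \<omega>" unfolding support_rv_def image_image
      by (rule cSUP_upper) (use le in \<open>auto simp: abs_le_iff intro!: bdd_aboveI2\<close>)
    ultimately show ?thesis using le[of 0] by linarith
  qed
  \<comment> \<open>The square of the level after \<open>2 ^ k * T\<close>: a path whose first level
    not exceeded is number \<open>Suc l\<close> has exceeded number \<open>l\<close>, so its square
    is covered by the summand \<open>l\<close>. Paths that stay below \<open>T\<close> are covered
    by the separate term \<open>T\<^sup>2\<close>.\<close>
  let ?b = "\<lambda>k. (2 ^ Suc k * T)\<^sup>2"
  have "AE \<omega> in M. ennreal ((norm (?h \<omega>))\<^sup>2) \<le> ennreal (T\<^sup>2) + (\<Sum>k. ennreal (?b k) * indicator (tail c (2 ^ k * T)) \<omega>)"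
    using AE_abs_bounded[OF bdd] AE_space
  proof eventually_elim
    case (elim \<omega>)
    then obtain m :: nat where m: "\<omega> \<notin> tail c (real m)" by blast
    obtain k where "real m / T < 2 ^ k" using real_arch_pow[of 2] by auto
    then have "real m \<le> 2 ^ k * T" using T by (simp add: field_simps)
    then have ex: "\<omega> \<notin> tail c (2 ^ k * T)" using m tail_subset by blast
    define n where "n = (LEAST n. \<omega> \<notin> tail c (2 ^ n * T))"
    have n: "\<omega> \<notin> tail c (2 ^ n * T)" unfolding n_def using ex by (rule LeastI)
    have hn: "(norm (?h \<omega>))\<^sup>2 \<le> (2 ^ n * T)\<^sup>2"
      using h_le[OF n] elim by (intro power_mono) auto
    show ?case
    proof (cases n)
      case 0
      then show ?thesis using hn by (intro order_trans[OF _ add_increasing2[OF _ order_refl]]) (auto intro: ennreal_leI)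
    next
      case (Suc l)
      then have "\<omega> \<in> tail c (2 ^ l * T)" using not_less_Least[of l "\<lambda>n. \<omega> \<notin> tail c (2 ^ n * T)"] by (auto simp: n_def)
      then have "ennreal ((norm (?h \<omega>))\<^sup>2) \<le> ennreal (?b l) * indicator (tail c (2 ^ l * T)) \<omega>"
        using hn Suc by (simp add: ennreal_leI)
      also have "\<dots> \<le> (\<Sum>k. ennreal (?b k) * indicator (tail c (2 ^ k * T)) \<omega>)"
      proof -
        define F where "F k = ennreal (?b k) * indicator (tail c (2 ^ k * T)) \<omega>" for k
        have "sum F {l} \<le> suminf F" by (rule sum_le_suminf) auto
        then have "F l \<le> suminf F" by simp
        then show ?thesis unfolding F_def .
      qed
      finally show ?thesis by (rule order_trans) simp
    qed
  qed
  then have "(\<integral>\<^sup>+\<omega>. ennreal ((norm (?h \<omega>))\<^sup>2) \<partial>M) \<le>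
      (\<integral>\<^sup>+\<omega>. ennreal (T\<^sup>2) + (\<Sum>k. ennreal (?b k) * indicator (tail c (2 ^ k * T)) \<omega>) \<partial>M)"
    by (rule nn_integral_mono_AE)
  also have "\<dots> = ennreal (T\<^sup>2) + (\<Sum>k. ennreal (?b k) * emeasure M (tail c (2 ^ k * T)))"
    by (subst nn_integral_add) (auto simp: nn_integral_suminf nn_integral_cmult_indicator emeasure_space_1)
  also have "\<dots> \<le> ennreal (T\<^sup>2) + (\<Sum>k. ennreal (4 * T\<^sup>2 * (1 / 2) ^ k))"
  proof (intro add_left_mono suminf_le summableI)
    fix k
    have "?b k * prob (tail c (2 ^ k * T)) \<le> ?b k * (1 / 8) ^ k" by (intro mult_left_mono q) simp
    also have "\<dots> = 4 * T\<^sup>2 * (1 / 2) ^ k"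
    proof -
      have "(2 ^ k)\<^sup>2 * (1 / 8) ^ k = (1 / 2 :: real) ^ k"
        unfolding power_mult[symmetric] power2_eq_square power_mult_distrib[symmetric] by simp
      then show ?thesis by (simp add: power_mult_distrib algebra_simps)
    qed
    finally show "ennreal (?b k) * emeasure M (tail c (2 ^ k * T)) \<le> ennreal (4 * T\<^sup>2 * (1 / 2) ^ k)"
      by (simp add: emeasure_eq_measure ennreal_mult[symmetric] ennreal_leI)
  qed
  also have "\<dots> < \<infinity>"
  proof -
    have "summable (\<lambda>k. 4 * T\<^sup>2 * (1 / 2 :: real) ^ k)" by (intro summable_mult summable_geometric) simp
    then have "(\<Sum>k. ennreal (4 * T\<^sup>2 * (1 / 2) ^ k)) = ennreal (\<Sum>k. 4 * T\<^sup>2 * (1 / 2) ^ k)"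
      by (intro suminf_ennreal2) auto
    then show ?thesis by simp
  qed
  finally have "integrable M (\<lambda>\<omega>. (norm (?h \<omega>))\<^sup>2)"
    by (intro integrableI_nonneg) auto
  then show ?thesis by (simp add: square_integrable_def)
qed

end

section \<open>Log-sum-exp functions\<close>

definition partition_sum :: "nat \<Rightarrow> real \<Rightarrow> (nat \<Rightarrow> real) \<Rightarrow> real" where
  "partition_sum n \<beta> x = (\<Sum>i<n. exp (\<beta> * x i))"

text \<open>A smooth substitute for the maximum of the first \<open>n\<close> coordinates, above it
  by at most \<open>ln (real n) / \<beta>\<close>; \<open>\<beta>\<close> plays the role of an
  inverse temperature.\<close>

definition log_sum_exp :: "nat \<Rightarrow> real \<Rightarrow> (nat \<Rightarrow> real) \<Rightarrow> real" where
  "log_sum_exp n \<beta> x = ln (partition_sum n \<beta> x) / \<beta>"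

definition softmax :: "nat \<Rightarrow> real \<Rightarrow> nat \<Rightarrow> (nat \<Rightarrow> real) \<Rightarrow> real" where
  "softmax n \<beta> i x = exp (\<beta> * x i) / partition_sum n \<beta> x"

text \<open>An algebra containing the log-sum-exp functions that is closed under partial derivatives.\<close>

inductive lse_algebra :: "nat \<Rightarrow> ((nat \<Rightarrow> real) \<Rightarrow> real) \<Rightarrow> bool" for N where
  const: "lse_algebra N (\<lambda>_. a)"
| log_sum_exp: "0 < n \<Longrightarrow> n \<le> N \<Longrightarrow> 0 < \<beta> \<Longrightarrow> lse_algebra N (log_sum_exp n \<beta>)"
| softmax: "0 < n \<Longrightarrow> n \<le> N \<Longrightarrow> 0 < \<beta> \<Longrightarrow> i < n \<Longrightarrow> lse_algebra N (softmax n \<beta> i)"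
| add: "lse_algebra N f \<Longrightarrow> lse_algebra N g \<Longrightarrow> lse_algebra N (\<lambda>x. f x + g x)"
| mult: "lse_algebra N f \<Longrightarrow> lse_algebra N g \<Longrightarrow> lse_algebra N (\<lambda>x. f x * g x)"

lemma lse_algebra_mono: "lse_algebra N f \<Longrightarrow> N \<le> N' \<Longrightarrow> lse_algebra N' f"
  by (induction rule: lse_algebra.induct) (auto intro: lse_algebra.intros)

lemma partition_sum_pos: "0 < n \<Longrightarrow> 0 < partition_sum n \<beta> x"
  unfolding partition_sum_def by (intro sum_pos) auto

lemma partition_sum_cong: "(\<And>i. i < n \<Longrightarrow> x i = y i) \<Longrightarrow> partition_sum n \<beta> x = partition_sum n \<beta> y"
  by (simp add: partition_sum_def)

lemma lse_algebra_cong: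
  "lse_algebra N f \<Longrightarrow> (\<And>i. i < N \<Longrightarrow> x i = y i) \<Longrightarrow> f x = f y"
proof (induction rule: lse_algebra.induct)
  case (log_sum_exp n \<beta>)
  then show ?case using partition_sum_cong[of n x y \<beta>] by (simp add: log_sum_exp_def)
next
  case (softmax n \<beta> i)
  then show ?case using partition_sum_cong[of n x y \<beta>] by (simp add: softmax_def)
qed auto

lemma continuous_on_partition_sum: "continuous_on UNIV (partition_sum n \<beta>)"
  unfolding partition_sum_def[abs_def]
  by (intro continuous_intros continuous_on_product_coordinates)

lemma continuous_on_lse_algebra: "lse_algebra N f \<Longrightarrow> continuous_on UNIV f"
proof (induction rule: lse_algebra.induct)
  case (log_sum_exp n \<beta>)
  then show ?case
    unfolding log_sum_exp_def[abs_def] using partition_sum_pos[of n \<beta>]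
    by (intro continuous_intros continuous_on_partition_sum) (auto simp: less_imp_neq[symmetric] order_less_imp_not_eq2)
next
  case (softmax n \<beta> i)
  then show ?case
    unfolding softmax_def[abs_def] using partition_sum_pos[of n \<beta>]
    by (intro continuous_intros continuous_on_partition_sum continuous_on_product_coordinates)
       (auto simp: less_imp_neq[symmetric] order_less_imp_not_eq2)
qed (auto intro: continuous_intros)

lemma log_sum_exp_upper:
  assumes "0 < n" "0 < \<beta>" "\<And>i. i < n \<Longrightarrow> x i \<le> b"
  shows "log_sum_exp n \<beta> x \<le> b + ln (real n) / \<beta>"
proof -
  have "partition_sum n \<beta> x \<le> (\<Sum>i<n. exp (\<beta> * b))"
    unfolding partition_sum_def using assms by (intro sum_mono) auto
  then have "ln (partition_sum n \<beta> x) \<le> ln (real n * exp (\<beta> * b))"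
    using partition_sum_pos[OF assms(1)] assms(1) by (subst ln_le_cancel_iff) auto
  also have "\<dots> = ln (real n) + \<beta> * b" using assms(1) by (simp add: ln_mult)
  finally show ?thesis using assms(2) by (simp add: log_sum_exp_def field_simps)
qed

lemma log_sum_exp_lower:
  assumes "0 < \<beta>" "i < n"
  shows "x i \<le> log_sum_exp n \<beta> x"
proof -
  have "exp (\<beta> * x i) \<le> partition_sum n \<beta> x"
    unfolding partition_sum_def using assms(2) by (intro member_le_sum) auto
  then have "\<beta> * x i \<le> ln (partition_sum n \<beta> x)"
    using partition_sum_pos[of n \<beta> x] assms(2) by (subst ln_ge_iff) auto
  then show ?thesis using assms(1) by (simp add: log_sum_exp_def field_simps)
qed

lemma softmax_nonneg: "0 \<le> softmax n \<beta> i x"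
  by (simp add: softmax_def partition_sum_def sum_nonneg)

lemma sum_softmax: "0 < n \<Longrightarrow> (\<Sum>i<n. softmax n \<beta> i x) = 1"
  using partition_sum_pos[of n \<beta> x]
  by (simp add: softmax_def sum_divide_distrib[symmetric]) (simp add: partition_sum_def)

lemma softmax_le_1: "i < n \<Longrightarrow> softmax n \<beta> i x \<le> 1"
  using member_le_sum[of i "{..<n}" "\<lambda>i. softmax n \<beta> i x"] sum_softmax[of n \<beta> x] softmax_nonneg by auto

lemma lse_algebra_poly_growth:
  "lse_algebra N f \<Longrightarrow> \<exists>C k. 0 \<le> C \<and> (\<forall>x. \<bar>f x\<bar> \<le> C * (1 + L2_set x {..<N}) ^ k)"
proof (induction rule: lse_algebra.induct)
  case (const a)
  then show ?case by (intro exI[of _ "\<bar>a\<bar>"] exI[of _ 0]) auto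
next
  case (log_sum_exp n \<beta>)
  let ?C = "1 + ln (real n) / \<beta>"
  have l: "0 \<le> ln (real n) / \<beta>" using log_sum_exp by simp
  have "\<bar>log_sum_exp n \<beta> x\<bar> \<le> ?C * (1 + L2_set x {..<N}) ^ 1" for x
  proof -
    have xi: "\<bar>x i\<bar> \<le> L2_set x {..<N}" if "i < n" for i
      using member_le_L2_set[of "{..<N}" i "\<lambda>i. \<bar>x i\<bar>"] that log_sum_exp by (simp add: L2_set_def)
    have "log_sum_exp n \<beta> x \<le> L2_set x {..<N} + ln (real n) / \<beta>"
      using xi log_sum_exp by (intro log_sum_exp_upper) (auto simp: abs_le_iff)
    moreover have "- L2_set x {..<N} \<le> log_sum_exp n \<beta> x"
      using log_sum_exp_lower[of \<beta> 0 n x] xi[of 0] log_sum_exp by auto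
    moreover have "L2_set x {..<N} + ln (real n) / \<beta> \<le> ?C * (1 + L2_set x {..<N})"
      using l mult_nonneg_nonneg[OF l L2_set_nonneg[of x "{..<N}"]] by (simp only: distrib_left distrib_right; linarith)
    ultimately show ?thesis using l by auto
  qed
  then show ?case using l by (intro exI[of _ ?C] exI[of _ 1]) auto
next
  case (softmax n \<beta> i)
  then show ?case
    using softmax_nonneg softmax_le_1[of i n \<beta>] by (intro exI[of _ 1] exI[of _ 0]) (auto simp: abs_le_iff)
next
  case (add f g)
  then obtain C k D l where f: "0 \<le> C" "\<And>x. \<bar>f x\<bar> \<le> C * (1 + L2_set x {..<N}) ^ k"
    and g: "0 \<le> D" "\<And>x. \<bar>g x\<bar> \<le> D * (1 + L2_set x {..<N}) ^ l" by blast
  have "\<bar>f x + g x\<bar> \<le> (C + D) * (1 + L2_set x {..<N}) ^ (k + l)" for x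
  proof -
    let ?S = "1 + L2_set x {..<N}"
    have "?S ^ k \<le> ?S ^ (k + l)" "?S ^ l \<le> ?S ^ (k + l)" by (intro power_increasing; simp)+
    then have "C * ?S ^ k \<le> C * ?S ^ (k + l)" "D * ?S ^ l \<le> D * ?S ^ (k + l)"
      using f(1) g(1) by (auto intro: mult_left_mono)
    then show ?thesis using f(2)[of x] g(2)[of x] unfolding distrib_right[of C] by linarith
  qed
  then show ?case using f(1) g(1) by (intro exI[of _ "C + D"] exI[of _ "k + l"]) auto
next
  case (mult f g)
  then obtain C k D l where f: "0 \<le> C" "\<And>x. \<bar>f x\<bar> \<le> C * (1 + L2_set x {..<N}) ^ k"
    and g: "0 \<le> D" "\<And>x. \<bar>g x\<bar> \<le> D * (1 + L2_set x {..<N}) ^ l" by blast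
  have "\<bar>f x * g x\<bar> \<le> (C * D) * (1 + L2_set x {..<N}) ^ (k + l)" for x
    using mult_mono[OF f(2)[of x] g(2)[of x]] f(1) by (simp add: abs_mult power_add mult_ac)
  then show ?case using f(1) g(1) by (intro exI[of _ "C * D"] exI[of _ "k + l"]) auto
qed

section \<open>Derivatives of log-sum-exp and softmax\<close>

lemma partition_sum_has_derivative:
  "((\<lambda>t. partition_sum n \<beta> (x(j := t))) has_real_derivative (if j < n then \<beta> * exp (\<beta> * x j) else 0)) (at (x j))"
proof -
  have "((\<lambda>t. exp (\<beta> * (x(j := t)) i)) has_real_derivative (if i = j then \<beta> * exp (\<beta> * x j) else 0)) (at (x j))" for i
    by (cases "i = j") (auto intro!: derivative_eq_intros)
  then have "((\<lambda>t. partition_sum n \<beta> (x(j := t))) has_real_derivative (\<Sum>i<n. if i = j then \<beta> * exp (\<beta> * x j) else 0)) (at (x j))"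
    unfolding partition_sum_def by (intro DERIV_sum)
  then show ?thesis by simp
qed

lemma log_sum_exp_has_derivative:
  assumes "0 < n" "0 < \<beta>"
  shows "((\<lambda>t. log_sum_exp n \<beta> (x(j := t))) has_real_derivative (if j < n then softmax n \<beta> j x else 0)) (at (x j))"
proof -
  have pos: "0 < partition_sum n \<beta> (x(j := x j))" by (rule partition_sum_pos[OF assms(1)])
  show ?thesis
    unfolding log_sum_exp_def
    by (rule derivative_eq_intros partition_sum_has_derivative pos refl)+
       (use assms in \<open>auto simp: softmax_def\<close>)
qed

text \<open>This is the quotient rule, with indicators as scalar factors so that one formula covers
  all \<open>j\<close>, also those beyond \<open>n\<close>, and is visibly a sum of products of
  members of the algebra.\<close>

lemma softmax_has_derivative:
  assumes "0 < n" "i < n"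
  shows "((\<lambda>t. softmax n \<beta> i (x(j := t))) has_real_derivative
    \<beta> * of_bool (i = j) * softmax n \<beta> i x + - (\<beta> * of_bool (j < n)) * (softmax n \<beta> i x * softmax n \<beta> j x)) (at (x j))"
proof -
  have pos: "0 < partition_sum n \<beta> x" by (rule partition_sum_pos[OF assms(1)])
  have e: "((\<lambda>t. exp (\<beta> * (x(j := t)) i)) has_real_derivative (if i = j then \<beta> * exp (\<beta> * x j) else 0)) (at (x j))"
    by (cases "i = j") (auto intro!: derivative_eq_intros)
  have "partition_sum n \<beta> (x(j := x j)) \<noteq> 0" using pos by simp
  from DERIV_divide[OF e partition_sum_has_derivative this] show ?thesis
    unfolding softmax_def
    by (rule DERIV_cong) (use pos assms in \<open>auto simp: field_simps\<close>)
qed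

lemma lse_algebra_has_derivative:
  "lse_algebra N f \<Longrightarrow> \<exists>D. lse_algebra N D \<and>
     (\<forall>x. ((\<lambda>t. f (x(j := t))) has_real_derivative D x) (at (x j)))"
proof (induction rule: lse_algebra.induct)
  case (const a)
  show ?case by (intro exI[of _ "\<lambda>_. 0"]) (auto intro: lse_algebra.const)
next
  case (log_sum_exp n \<beta>)
  then have "lse_algebra N (\<lambda>x. if j < n then softmax n \<beta> j x else 0)"
    by (cases "j < n") (auto intro: lse_algebra.softmax lse_algebra.const)
  then show ?case using log_sum_exp_has_derivative[of n \<beta>] log_sum_exp by blast
next
  case (softmax n \<beta> i)
  have "lse_algebra N (\<lambda>x. \<beta> * of_bool (i = j) * softmax n \<beta> i x + - (\<beta> * of_bool (j < n)) * (softmax n \<beta> i x * softmax n \<beta> j x))"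
  proof (cases "j < n")
    case True
    show ?thesis
      by (intro lse_algebra.add lse_algebra.mult lse_algebra.softmax lse_algebra.const) (use softmax True in auto)
  next
    case False
    have "lse_algebra N (\<lambda>x. \<beta> * of_bool (i = j) * softmax n \<beta> i x)"
      by (intro lse_algebra.mult lse_algebra.softmax lse_algebra.const) (use softmax in auto)
    then show ?thesis using False by simp
  qed
  then show ?case using softmax_has_derivative[of n i \<beta>] softmax by blast
next
  case (add f g)
  then obtain D E where D: "lse_algebra N D" "\<And>x. ((\<lambda>t. f (x(j := t))) has_real_derivative D x) (at (x j))"
    and E: "lse_algebra N E" "\<And>x. ((\<lambda>t. g (x(j := t))) has_real_derivative E x) (at (x j))" by blast
  have "((\<lambda>t. f (x(j := t)) + g (x(j := t))) has_real_derivative (D x + E x)) (at (x j))" for x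
    by (rule DERIV_add[OF D(2)[of x] E(2)[of x]])
  then show ?case
    using lse_algebra.add[OF D(1) E(1)] by (intro exI[of _ "\<lambda>x. D x + E x"]) blast
next
  case (mult f g)
  then obtain D E where D: "lse_algebra N D" "\<And>x. ((\<lambda>t. f (x(j := t))) has_real_derivative D x) (at (x j))"
    and E: "lse_algebra N E" "\<And>x. ((\<lambda>t. g (x(j := t))) has_real_derivative E x) (at (x j))" by blast
  have "((\<lambda>t. f (x(j := t)) * g (x(j := t))) has_real_derivative (D x * g x + E x * f x)) (at (x j))" for x
    using DERIV_mult[OF D(2)[of x] E(2)[of x]] by (simp only: fun_upd_triv)
  moreover have "lse_algebra N (\<lambda>x. D x * g x + E x * f x)"
    using D(1) E(1) mult.hyps by (intro lse_algebra.add lse_algebra.mult)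
  ultimately show ?case by (intro exI[of _ "\<lambda>x. D x * g x + E x * f x"]) blast
qed

lemma lse_algebra_partial_deriv:
  assumes "lse_algebra N f"
  shows "lse_algebra N (partial_deriv j f)"
    and "((\<lambda>t. f (x(j := t))) has_real_derivative partial_deriv j f x) (at (x j))"
proof -
  obtain D where D: "lse_algebra N D" "\<And>x. ((\<lambda>t. f (x(j := t))) has_real_derivative D x) (at (x j))"
    using lse_algebra_has_derivative[OF assms] by blast
  then have "partial_deriv j f = D"
    by (intro ext) (auto simp: partial_deriv_def intro: DERIV_imp_deriv)
  with D show "lse_algebra N (partial_deriv j f)"
    "((\<lambda>t. f (x(j := t))) has_real_derivative partial_deriv j f x) (at (x j))" by auto
qed

lemma lse_algebra_iterated_partial_deriv:
  "lse_algebra N f \<Longrightarrow> lse_algebra N (iterated_partial_deriv js f)"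
  by (induction js) (auto intro: lse_algebra_partial_deriv)

lemma smooth_poly_growth_lse_algebra:
  assumes "lse_algebra N f"
  shows "smooth_poly_growth N f"
  unfolding smooth_poly_growth_def
proof (intro conjI allI impI)
  fix x y :: "nat \<Rightarrow> real" assume "\<forall>i<N. x i = y i"
  then show "f x = f y" using lse_algebra_cong[OF assms] by blast
next
  fix js :: "nat list" and j x
  note it = lse_algebra_iterated_partial_deriv[OF assms, of js]
  show "continuous_on UNIV (iterated_partial_deriv js f)"
    using it by (rule continuous_on_lse_algebra)
  show "(\<lambda>t. iterated_partial_deriv js f (x(j := t))) field_differentiable at (x j)"
    using lse_algebra_partial_deriv(2)[OF it, of x j] field_differentiable_def by blast
  show "\<exists>C k. \<forall>x. \<bar>iterated_partial_deriv js f x\<bar> \<le> C * (1 + L2_set x {..<N}) ^ k"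
    using lse_algebra_poly_growth[OF it] by blast
qed

lemma partial_deriv_add:
  assumes "lse_algebra N f" "lse_algebra N g"
  shows "partial_deriv j (\<lambda>x. a * f x + b * g x) x = a * partial_deriv j f x + b * partial_deriv j g x"
  unfolding partial_deriv_def[of j "\<lambda>x. a * f x + b * g x"]
  by (intro DERIV_imp_deriv DERIV_add DERIV_cmult lse_algebra_partial_deriv(2)[OF assms(1)]
      lse_algebra_partial_deriv(2)[OF assms(2)])

lemma partial_deriv_eq_0:
  assumes "lse_algebra N f" "N \<le> j"
  shows "partial_deriv j f x = 0"
proof -
  have "f (x(j := t)) = f x" for t by (rule lse_algebra_cong[OF assms(1)]) (use assms(2) in auto)
  then show ?thesis by (simp add: partial_deriv_def)
qed

text \<open>At the values of the process this is the vector \<open>\<Phi>\<close> that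
  \<open>smooth_malliavin\<close> assigns to \<open>f\<close>.\<close>

definition gradient :: "nat \<Rightarrow> ((nat \<Rightarrow> real) \<Rightarrow> real) \<Rightarrow> (nat \<Rightarrow> 'h::real_vector) \<Rightarrow> (nat \<Rightarrow> real) \<Rightarrow> 'h" where
  "gradient N f c x = (\<Sum>j<N. partial_deriv j f x *\<^sub>R c j)"

text \<open>Variables that do not occur contribute zero partial derivatives; this allows functions
  of different numbers of variables to be combined.\<close>

lemma gradient_mono:
  assumes "lse_algebra N f" "N \<le> N'"
  shows "gradient N' f c x = gradient N f c x"
  unfolding gradient_def
  by (rule sum.mono_neutral_right) (use assms partial_deriv_eq_0[OF assms(1)] in auto)

lemma gradient_add:
  assumes "lse_algebra N f" "lse_algebra N g"
  shows "gradient N (\<lambda>x. a * f x + b * g x) c x = a *\<^sub>R gradient N f c x + b *\<^sub>R gradient N g c x"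
  unfolding gradient_def partial_deriv_add[OF assms]
  by (simp add: scaleR_left_distrib sum.distrib scaleR_sum_right)

lemma gradient_log_sum_exp:
  assumes "0 < n" "0 < \<beta>"
  shows "gradient n (log_sum_exp n \<beta>) c x = (\<Sum>j<n. softmax n \<beta> j x *\<^sub>R c j)"
proof -
  have "partial_deriv j (log_sum_exp n \<beta>) x = softmax n \<beta> j x" if "j < n" for j
    using log_sum_exp_has_derivative[OF assms, of x j] that
    unfolding partial_deriv_def by (auto intro: DERIV_imp_deriv)
  then show ?thesis by (simp add: gradient_def)
qed

lemma gradient_log_sum_exp_in_convex:
  assumes "0 < n" "0 < \<beta>" "convex K" "\<And>j. c j \<in> K"
  shows "gradient n (log_sum_exp n \<beta>) c x \<in> K"
  unfolding gradient_log_sum_exp[OF assms(1,2)]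
  by (rule convex_sum) (use assms sum_softmax softmax_nonneg in auto)

section \<open>Existence of the Malliavin derivative\<close>

text \<open>
  By the parallelogram identity, elements of almost minimal norm in a decreasing sequence of
  midpoint-convex sets form a Cauchy sequence.
\<close>

lemma min_norm_L2_Cauchy:
  fixes S :: "nat \<Rightarrow> ('a \<Rightarrow> 'h::{real_inner, banach, second_countable_topology}) set"
  assumes ne: "\<And>n. S n \<noteq> {}" and anti: "\<And>m n. m \<le> n \<Longrightarrow> S n \<subseteq> S m"
    and mid: "\<And>n f g. f \<in> S n \<Longrightarrow> g \<in> S n \<Longrightarrow> (\<lambda>\<omega>. (1/2) *\<^sub>R f \<omega> + (1/2) *\<^sub>R g \<omega>) \<in> S n"
    and sq: "\<And>n f. f \<in> S n \<Longrightarrow> square_integrable M f"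
    and bound: "\<And>n f. f \<in> S n \<Longrightarrow> (\<integral>\<omega>. (norm (f \<omega>))\<^sup>2 \<partial>M) \<le> B"
  obtains f where "\<And>n. f n \<in> S n"
    and "\<And>e. 0 < e \<Longrightarrow> \<exists>N. \<forall>m\<ge>N. \<forall>n\<ge>N. (\<integral>\<omega>. (norm (f m \<omega> - f n \<omega>))\<^sup>2 \<partial>M) < e"
proof -
  define E where "E f = (\<integral>\<omega>. (norm (f \<omega>))\<^sup>2 \<partial>M)" for f :: "'a \<Rightarrow> 'h"
  define d where "d n = (INF f\<in>S n. E f)" for n
  have E0: "0 \<le> E f" for f by (simp add: E_def integral_nonneg)
  have bb: "bdd_below (E ` S n)" for n using E0 by (intro bdd_belowI2[of _ 0])
  have d_le: "d n \<le> E f" if "f \<in> S n" for n f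
    unfolding d_def using bb that by (rule cINF_lower)
  have "\<exists>f\<in>S n. E f < d n + 1 / real (Suc n)" for n
  proof -
    have "Inf (E ` S n) < d n + 1 / real (Suc n)" by (simp add: d_def)
    then show ?thesis using cInf_lessD[of "E ` S n"] ne[of n] by (auto simp: bex_imageD)
  qed
  then obtain f where f: "\<And>n. f n \<in> S n" and fE: "\<And>n. E (f n) < d n + 1 / real (Suc n)"
    by metis
  \<comment> \<open>As the sets shrink the infima increase; since they stay below \<open>B\<close>,
    they converge.\<close>
  have incd: "d m \<le> d n" if "m \<le> n" for m n
    unfolding d_def by (rule cINF_superset_mono[OF ne bb anti[OF that]]) simp
  have dB: "d n \<le> B" for n
  proof -
    obtain g where "g \<in> S n" using ne[of n] by blast
    then show ?thesis using d_le bound unfolding E_def by (meson order_trans)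
  qed
  have "incseq d" using incd by (simp add: incseq_def)
  then obtain l where "d \<longlonglongrightarrow> l" by (rule incseq_convergent[of d B]) (use dB in auto)
  then have Cd: "Cauchy d" by (rule LIMSEQ_imp_Cauchy)
  \<comment> \<open>For \<open>n \<le> m\<close> both functions lie in \<open>S n\<close>, so their
    midpoint has squared norm at least \<open>d n\<close>. The parallelogram identity then leaves
    only the gap between the infima and the tolerances \<open>1 / real (Suc m)\<close> and
    \<open>1 / real (Suc n)\<close>.\<close>
  have key: "E (\<lambda>\<omega>. f m \<omega> - f n \<omega>) \<le> 2 * \<bar>d m - d n\<bar> + 4 / real (Suc n)" if "n \<le> m" for m n
  proof -
    have fm: "f m \<in> S n" using f[of m] anti[OF that] by blast
    let ?g = "\<lambda>\<omega>. (1/2) *\<^sub>R f m \<omega> + (1/2) *\<^sub>R f n \<omega>"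
    have g: "?g \<in> S n" using fm f by (rule mid)
    have i: "integrable M (\<lambda>\<omega>. (norm (f k \<omega>))\<^sup>2)" for k
      using sq[OF f[of k]] by (simp add: square_integrable_def)
    have ig: "integrable M (\<lambda>\<omega>. (norm (?g \<omega>))\<^sup>2)"
      using sq[OF g] by (simp add: square_integrable_def)
    have "(norm (f m \<omega> - f n \<omega>))\<^sup>2 = 2 * (norm (f m \<omega>))\<^sup>2 + 2 * (norm (f n \<omega>))\<^sup>2 - 4 * (norm (?g \<omega>))\<^sup>2" for \<omega>
      by (simp add: power2_norm_eq_inner inner_diff_left inner_diff_right inner_add_left inner_add_right inner_commute)
    then have "E (\<lambda>\<omega>. f m \<omega> - f n \<omega>) = 2 * E (f m) + 2 * E (f n) - 4 * E ?g"
      unfolding E_def using i[of m] i[of n] ig by simp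
    also have "\<dots> \<le> 2 * (d m + 1 / real (Suc m)) + 2 * (d n + 1 / real (Suc n)) - 4 * d n"
      using fE[of m, THEN less_imp_le] fE[of n, THEN less_imp_le] d_le[OF g]
      by (intro diff_mono add_mono mult_left_mono) auto
    also have "\<dots> \<le> 2 * \<bar>d m - d n\<bar> + 4 / real (Suc n)"
    proof -
      have "1 / real (Suc m) \<le> 1 / real (Suc n)" using that by (intro divide_left_mono) auto
      then show ?thesis by (simp add: abs_if)
    qed
    finally show ?thesis .
  qed
  show ?thesis
  proof (rule that[OF f])
    fix e :: real assume e: "0 < e"
    then obtain N1 where N1: "\<And>m n. m \<ge> N1 \<Longrightarrow> n \<ge> N1 \<Longrightarrow> \<bar>d m - d n\<bar> < e / 4"
      using CauchyD[OF Cd, of "e / 4"] by auto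
    obtain N2 where N2: "1 / real (Suc N2) < e / 8" using reals_Archimedean[of "e / 8"] e
      by (auto simp: inverse_eq_divide)
    have half: "E (\<lambda>\<omega>. f m \<omega> - f n \<omega>) < e" if "n \<ge> max N1 N2" "n \<le> m" for m n
    proof -
      have "1 / real (Suc n) \<le> 1 / real (Suc N2)" using that by (intro divide_left_mono) auto
      with N2 have "1 / real (Suc n) < e / 8" by linarith
      then show ?thesis using key[OF that(2)] N1[of m n] that by simp
    qed
    have sym: "E (\<lambda>\<omega>. f m \<omega> - f n \<omega>) = E (\<lambda>\<omega>. f n \<omega> - f m \<omega>)" for m n
      by (simp add: E_def norm_minus_commute)
    show "\<exists>N. \<forall>m\<ge>N. \<forall>n\<ge>N. (\<integral>\<omega>. (norm (f m \<omega> - f n \<omega>))\<^sup>2 \<partial>M) < e"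
      unfolding E_def[symmetric] using half sym by (metis nle_le)
  qed
qed

text \<open>As in the Riesz-Fischer theorem, a subsequence with rapidly decreasing increments has
  increments that are almost surely absolutely summable; completeness of the Hilbert space does the
  rest.\<close>

lemma L2_Cauchy_AE_convergent_subseq:
  fixes f :: "nat \<Rightarrow> 'a \<Rightarrow> 'h::{real_inner, banach, second_countable_topology}"
  assumes "prob_space M" and sq: "\<And>n. square_integrable M (f n)"
    and Cauchy: "\<And>e. 0 < e \<Longrightarrow> \<exists>N. \<forall>m\<ge>N. \<forall>n\<ge>N. (\<integral>\<omega>. (norm (f m \<omega> - f n \<omega>))\<^sup>2 \<partial>M) < e"
  obtains r where "strict_mono r" "AE \<omega> in M. convergent (\<lambda>k. f (r k) \<omega>)"
proof -
  interpret prob_space M by fact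
  obtain N where N: "\<And>k m n. m \<ge> N k \<Longrightarrow> n \<ge> N k \<Longrightarrow> (\<integral>\<omega>. (norm (f m \<omega> - f n \<omega>))\<^sup>2 \<partial>M) < (1 / 4) ^ k"
    using Cauchy[of "(1 / 4) ^ k" for k] by (auto, metis)
  \<comment> \<open>The sum dominates \<open>N k\<close>, and adding \<open>k\<close> makes the
    indices strictly increasing.\<close>
  define r where "r k = (\<Sum>i\<le>k. N i) + k" for k
  have r: "strict_mono r" by (intro strict_mono_Suc_iff[THEN iffD2]) (simp add: r_def)
  have rN: "N k \<le> r k" for k unfolding r_def by (intro trans_le_add1 member_le_sum) auto
  define D where "D k \<omega> = f (r (Suc k)) \<omega> - f (r k) \<omega>" for k \<omega>
  have [measurable]: "f n \<in> borel_measurable M" for n using sq[of n] by (simp add: square_integrable_def)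
  have [measurable]: "D k \<in> borel_measurable M" for k unfolding D_def[abs_def] by measurable
  have sqD: "integrable M (\<lambda>\<omega>. (norm (D k \<omega>))\<^sup>2)" for k
    using square_integrable_diff[OF sq sq] by (simp add: D_def square_integrable_def)
  have D_small: "(\<integral>\<omega>. (norm (D k \<omega>))\<^sup>2 \<partial>M) \<le> (1 / 4) ^ k" for k
    unfolding D_def using N[of k "r (Suc k)" "r k"] rN[of k] strict_monoD[OF r, of k "Suc k"] by simp
  \<comment> \<open>Young's inequality with weight \<open>(2/3) ^ k\<close>: after integration the
    first term is at most \<open>(3/8) ^ k\<close>, because \<open>1/4\<close> times
    \<open>3/2\<close> is \<open>3/8\<close>, so both terms are summable.\<close>
  have pt: "norm (D k \<omega>) \<le> (norm (D k \<omega>))\<^sup>2 * (3/2) ^ k + (2/3) ^ k" for k \<omega>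
    using mult_le_square_add_square[of "(2/3)^k" "norm (D k \<omega>)" 1] by (simp add: power_divide)
  have "(\<integral>\<^sup>+\<omega>. ennreal (norm (D k \<omega>)) \<partial>M) \<le> ennreal (2 * (2/3) ^ k)" for k
  proof -
    have "(\<integral>\<^sup>+\<omega>. ennreal (norm (D k \<omega>)) \<partial>M) \<le> (\<integral>\<^sup>+\<omega>. ennreal ((norm (D k \<omega>))\<^sup>2 * (3/2) ^ k + (2/3) ^ k) \<partial>M)"
      by (intro nn_integral_mono ennreal_leI pt)
    also have "\<dots> = ennreal (\<integral>\<omega>. (norm (D k \<omega>))\<^sup>2 * (3/2) ^ k + (2/3) ^ k \<partial>M)"
      by (intro nn_integral_eq_integral Bochner_Integration.integrable_add integrable_mult_left sqD) auto
    also have "(\<integral>\<omega>. (norm (D k \<omega>))\<^sup>2 * (3/2) ^ k + (2/3) ^ k \<partial>M) = (\<integral>\<omega>. (norm (D k \<omega>))\<^sup>2 \<partial>M) * (3/2) ^ k + (2/3) ^ k"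
      using sqD[of k] by (simp add: prob_space)
    also have "\<dots> \<le> (1 / 4) ^ k * (3/2) ^ k + (2/3) ^ k"
      using D_small[of k] by (intro add_right_mono mult_right_mono) auto
    also have "\<dots> \<le> 2 * (2/3) ^ k"
    proof -
      have "(1 / 4) ^ k * (3/2) ^ k = (3 / 8 :: real) ^ k" by (simp add: power_mult_distrib[symmetric])
      also have "\<dots> \<le> (2/3) ^ k" by (intro power_mono) auto
      finally show ?thesis by simp
    qed
    finally show ?thesis by (simp add: ennreal_leI)
  qed
  then have "(\<integral>\<^sup>+\<omega>. (\<Sum>k. ennreal (norm (D k \<omega>))) \<partial>M) \<le> (\<Sum>k. ennreal (2 * (2/3) ^ k))"
    by (subst nn_integral_suminf) (auto intro!: suminf_le summableI)
  also have "\<dots> = ennreal (\<Sum>k. 2 * (2/3) ^ k)"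
    by (intro suminf_ennreal2 summable_mult summable_geometric) auto
  also have "\<dots> < \<infinity>" by simp
  finally have fin: "(\<integral>\<^sup>+\<omega>. (\<Sum>k. ennreal (norm (D k \<omega>))) \<partial>M) \<noteq> \<infinity>" by simp
  have "AE \<omega> in M. (\<Sum>k. ennreal (norm (D k \<omega>))) \<noteq> \<infinity>"
    by (rule nn_integral_PInf_AE[OF _ fin]) measurable
  then have "AE \<omega> in M. convergent (\<lambda>k. f (r k) \<omega>)"
  proof eventually_elim
    case (elim \<omega>)
    then have "summable (\<lambda>k. norm (D k \<omega>))" by (intro summable_suminf_not_top) auto
    then have "summable (\<lambda>k. D k \<omega>)" by (rule summable_norm_cancel)
    then have "convergent (\<lambda>n. \<Sum>k<n. D k \<omega>)" by (simp add: summable_iff_convergent)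
    then have "convergent (\<lambda>n. (\<Sum>k<n. D k \<omega>) + f (r 0) \<omega>)" by (intro convergent_add convergent_const)
    then show ?case
      unfolding D_def sum_lessThan_telescope[of "\<lambda>k. f (r k) \<omega>"] by simp
  qed
  with r show ?thesis by (rule that)
qed

lemma (in prob_space) square_integrable_bounded:
  fixes f :: "'a \<Rightarrow> 'b::{banach, second_countable_topology}"
  assumes "f \<in> borel_measurable M" "\<And>\<omega>. norm (f \<omega>) \<le> B"
  shows "square_integrable M f"
proof -
  have "(norm (f \<omega>))\<^sup>2 \<le> B\<^sup>2" for \<omega> using assms(2) by (intro power_mono) auto
  then show ?thesis
    unfolding square_integrable_def using assms(1)
    by (auto intro!: integrable_const_bound[where B="B\<^sup>2"])
qed

context isonormal_gaussian_process
begin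

text \<open>The approximating functions are selected through their gradients: any choice from the
  admissible sets converges to the support function, and almost minimal norm makes the gradients
  converge too. Convexity keeps averaged gradients in \<open>K\<close>, closedness keeps the limit
  there.\<close>

lemma malliavin_derivative_exists:
  fixes c :: "nat \<Rightarrow> 'h"
  assumes K: "convex_body K" and c: "\<And>i. c i \<in> K"
    and bdd: "AE \<omega> in M. bdd_above (range (\<lambda>i. X (c i) \<omega>))"
  obtains G where "has_malliavin_derivative M X (support_rv X (range c)) G" "\<And>\<omega>. G \<omega> \<in> K"
proof -
  define h where "h = support_rv X (range c)"
  have h: "square_integrable M h" unfolding h_def by (rule square_integrable_support_rv[OF bdd])
  then have [measurable]: "h \<in> borel_measurable M" by (simp add: square_integrable_def)
  have convex: "convex K" and compact: "compact K" using K by (auto simp: convex_body_def)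
  obtain R where R: "\<And>x. x \<in> K \<Longrightarrow> norm x \<le> R"
    using compact_imp_bounded[OF compact] by (auto simp: bounded_iff)
  define mx where "mx n \<omega> = Max ((\<lambda>i. X (c i) \<omega>) ` {..n})" for n \<omega>
  have mx_ge: "X (c i) \<omega> \<le> mx n \<omega>" if "i \<le> n" for i n \<omega>
    unfolding mx_def using that by (intro Max_ge) auto
  \<comment> \<open>The tolerance is itself random. It decreases in \<open>n\<close>, tends to
    \<open>0\<close> on bounded paths and is dominated by the square-integrable
    \<open>\<epsilon> 0\<close>, so dominated convergence applies to every choice of functions
    within it.\<close>
  define \<epsilon> where "\<epsilon> n \<omega> = h \<omega> - mx n \<omega> + 1 / real (Suc n)" for n \<omega>
  have \<epsilon>_mono: "\<epsilon> n \<omega> \<le> \<epsilon> m \<omega>" if "m \<le> n" for m n \<omega>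
  proof -
    have "mx m \<omega> \<le> mx n \<omega>" unfolding mx_def using that by (intro Max_mono) auto
    moreover have "1 / real (Suc n) \<le> 1 / real (Suc m)" using that by (intro divide_left_mono) auto
    ultimately show ?thesis by (simp add: \<epsilon>_def)
  qed
  have h_ge: "X (c i) \<omega> \<le> h \<omega>" if "bdd_above (range (\<lambda>i. X (c i) \<omega>))" for i \<omega>
    unfolding h_def support_rv_def image_image using that by (intro cSUP_upper) auto
  have mx_le: "mx n \<omega> \<le> h \<omega>" if "bdd_above (range (\<lambda>i. X (c i) \<omega>))" for n \<omega>
    unfolding mx_def using h_ge[OF that] by (intro Max.boundedI) auto
  have \<epsilon>_lim: "(\<lambda>n. \<epsilon> n \<omega>) \<longlonglongrightarrow> 0" if b: "bdd_above (range (\<lambda>i. X (c i) \<omega>))" for \<omega>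
  proof -
    have "(\<lambda>n. h \<omega> - mx n \<omega>) \<longlonglongrightarrow> 0"
    proof (rule LIMSEQ_I)
      fix e :: real assume "0 < e"
      then have "h \<omega> - e < (SUP i. X (c i) \<omega>)" by (simp add: h_def support_rv_def image_image)
      then obtain i where "h \<omega> - e < X (c i) \<omega>" using less_cSUP_iff[OF _ b] by auto
      then have "\<bar>h \<omega> - mx n \<omega>\<bar> < e" if "i \<le> n" for n
        using mx_ge[OF that, of \<omega>] mx_le[OF b, of n] by linarith
      then show "\<exists>i. \<forall>n\<ge>i. norm (h \<omega> - mx n \<omega> - 0) < e" by auto
    qed
    from tendsto_add[OF this LIMSEQ_Suc[OF lim_1_over_n]] show ?thesis by (simp add: \<epsilon>_def[abs_def])
  qed
  let ?F = "\<lambda>f \<omega>. f (\<lambda>i. X (c i) \<omega>) :: real"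
  let ?G = "\<lambda>N f \<omega>. gradient N f c (\<lambda>i. X (c i) \<omega>)"
  \<comment> \<open>Functions are recorded along with gradients: only the gradients enter the
    minimisation, but the functions must still converge to \<open>h\<close>. All conditions are
    preserved by midpoints, and the sets decrease in \<open>n\<close>.\<close>
  define T where "T n = {(N, f). lse_algebra N f \<and> (\<forall>\<omega>. ?G N f \<omega> \<in> K) \<and>
    (AE \<omega> in M. \<bar>?F f \<omega> - h \<omega>\<bar> \<le> \<epsilon> n \<omega>)}" for n
  define S where "S n = (\<lambda>(N, f). ?G N f) ` T n" for n
  have smooth: "smooth_malliavin X (?F f) (?G N f)" if "lse_algebra N f" for N f
    unfolding smooth_malliavin_def gradient_def
    using smooth_poly_growth_lse_algebra[OF that] by blast
  have S_sq: "square_integrable M g" and S_K: "\<And>\<omega>. g \<omega> \<in> K" if "g \<in> S n" for g n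
    using that smooth_malliavin_square_integrable(2)[OF smooth] by (auto simp: S_def T_def)
  have "T n \<noteq> {}" for n
  proof -
    \<comment> \<open>Chosen so that \<open>ln (real (Suc n)) / \<beta>\<close>, the excess over the
      maximum, fits into the summand \<open>1 / real (Suc n)\<close> of the tolerance. The
      \<open>1 +\<close> keeps \<open>\<beta>\<close> positive at \<open>n = 0\<close>.\<close>
    define \<beta> where "\<beta> = real (Suc n) * (1 + ln (real (Suc n)))"
    have \<beta>: "0 < \<beta>" unfolding \<beta>_def by (intro mult_pos_pos add_pos_nonneg) auto
    have "ln (real (Suc n)) / \<beta> \<le> 1 / real (Suc n)"
      using \<beta> by (simp add: field_simps \<beta>_def) 
    then have *: "AE \<omega> in M. \<bar>?F (log_sum_exp (Suc n) \<beta>) \<omega> - h \<omega>\<bar> \<le> \<epsilon> n \<omega>"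
      using bdd
    proof (elim eventually_mono)
      fix \<omega> assume le: "ln (real (Suc n)) / \<beta> \<le> 1 / real (Suc n)" and b: "bdd_above (range (\<lambda>i. X (c i) \<omega>))"
      let ?l = "?F (log_sum_exp (Suc n) \<beta>) \<omega>"
      have "?l \<le> mx n \<omega> + ln (real (Suc n)) / \<beta>"
        using mx_ge[of _ n \<omega>] \<beta> by (intro log_sum_exp_upper) auto
      moreover have "mx n \<omega> \<le> ?l"
        unfolding mx_def using log_sum_exp_lower[of \<beta> _ "Suc n" "\<lambda>i. X (c i) \<omega>"] \<beta>
        by (intro Max.boundedI) auto
      ultimately show "\<bar>?l - h \<omega>\<bar> \<le> \<epsilon> n \<omega>" using le mx_le[OF b, of n] by (simp add: \<epsilon>_def)
    qed
    have "(Suc n, log_sum_exp (Suc n) \<beta>) \<in> T n"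
      unfolding T_def using * \<beta> gradient_log_sum_exp_in_convex[OF _ \<beta> convex c, of "Suc n"]
      by (auto intro: lse_algebra.log_sum_exp)
    then show ?thesis by blast
  qed
  then have ne: "S n \<noteq> {}" for n by (simp add: S_def)
  have "T n \<subseteq> T m" if "m \<le> n" for m n
    unfolding T_def using \<epsilon>_mono[OF that] by (auto elim!: eventually_mono intro: order_trans)
  then have anti: "S n \<subseteq> S m" if "m \<le> n" for m n
    using that unfolding S_def by (intro image_mono) auto
  have mid: "(\<lambda>\<omega>. (1/2) *\<^sub>R g1 \<omega> + (1/2) *\<^sub>R g2 \<omega>) \<in> S n" if g: "g1 \<in> S n" "g2 \<in> S n" for n g1 g2
  proof -
    obtain N1 f1 N2 f2 where 1: "(N1, f1) \<in> T n" "g1 = ?G N1 f1" and 2: "(N2, f2) \<in> T n" "g2 = ?G N2 f2"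
      using g by (auto simp: S_def)
    \<comment> \<open>The two functions may depend on different numbers of variables; enlarging both
      to \<open>N\<close> changes neither gradient.\<close>
    define N where "N = max N1 N2"
    define f where "f x = (1/2) * f1 x + (1/2) * f2 x" for x
    have A1: "lse_algebra N1 f1" "lse_algebra N f1" and A2: "lse_algebra N2 f2" "lse_algebra N f2"
      using 1 2 lse_algebra_mono[of N1 f1 N] lse_algebra_mono[of N2 f2 N] by (auto simp: T_def N_def)
    have alg: "lse_algebra N f"
      unfolding f_def[abs_def] by (intro lse_algebra.add lse_algebra.mult lse_algebra.const A1 A2)
    have grad: "?G N f \<omega> = (1/2) *\<^sub>R g1 \<omega> + (1/2) *\<^sub>R g2 \<omega>" for \<omega>
      unfolding f_def[abs_def] gradient_add[OF A1(2) A2(2)] 1 2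
      using gradient_mono[OF A1(1), of N c] gradient_mono[OF A2(1), of N c] by (simp add: N_def)
    have "?G N f \<omega> \<in> K" for \<omega>
      unfolding grad using S_K[OF g(1)] S_K[OF g(2)] by (intro convexD[OF convex]) auto
    moreover have "AE \<omega> in M. \<bar>?F f \<omega> - h \<omega>\<bar> \<le> \<epsilon> n \<omega>"
    proof -
      have "AE \<omega> in M. \<bar>?F f1 \<omega> - h \<omega>\<bar> \<le> \<epsilon> n \<omega>" "AE \<omega> in M. \<bar>?F f2 \<omega> - h \<omega>\<bar> \<le> \<epsilon> n \<omega>"
        using 1 2 by (auto simp: T_def)
      then show ?thesis by eventually_elim (auto simp: f_def abs_le_iff)
    qed
    ultimately have "(N, f) \<in> T n" using alg by (simp add: T_def)
    then show ?thesis unfolding S_def using grad by (intro image_eqI[of _ _ "(N, f)"]) auto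
  qed
  have bound: "(\<integral>\<omega>. (norm (g \<omega>))\<^sup>2 \<partial>M) \<le> R\<^sup>2" if "g \<in> S n" for g n
  proof -
    have "(\<integral>\<omega>. (norm (g \<omega>))\<^sup>2 \<partial>M) \<le> (\<integral>\<omega>. R\<^sup>2 \<partial>M)"
    proof (rule integral_mono)
      show "(norm (g \<omega>))\<^sup>2 \<le> R\<^sup>2" for \<omega> using R[OF S_K[OF that]] by (intro power_mono) auto
    qed (use S_sq[OF that] in \<open>auto simp: square_integrable_def\<close>)
    then show ?thesis by (simp add: prob_space)
  qed
  obtain g where g: "\<And>n. g n \<in> S n"
    and Cauchy: "\<And>e. 0 < e \<Longrightarrow> \<exists>N. \<forall>m\<ge>N. \<forall>n\<ge>N. (\<integral>\<omega>. (norm (g m \<omega> - g n \<omega>))\<^sup>2 \<partial>M) < e"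
  proof (rule min_norm_L2_Cauchy[of S M "R\<^sup>2", OF ne anti mid S_sq bound])
    fix g assume "\<And>n. g n \<in> S n"
      "\<And>e. 0 < e \<Longrightarrow> \<exists>N. \<forall>m\<ge>N. \<forall>n\<ge>N. (\<integral>\<omega>. (norm (g m \<omega> - g n \<omega>))\<^sup>2 \<partial>M) < e"
    then show thesis by (rule that)
  qed
  obtain r where r: "strict_mono r" and conv: "AE \<omega> in M. convergent (\<lambda>k. g (r k) \<omega>)"
    by (rule L2_Cauchy_AE_convergent_subseq[OF prob_space_axioms S_sq[OF g] Cauchy]) blast
  obtain N f where f: "\<And>k. (N k, f k) \<in> T k" and gf: "\<And>k. g k = ?G (N k) (f k)"
  proof -
    have "\<exists>p. p \<in> T k \<and> g k = ?G (fst p) (snd p)" for k using g[of k] by (auto simp: S_def)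
    then obtain p where "\<And>k. p k \<in> T k \<and> g k = ?G (fst (p k)) (snd (p k))" by metis
    then show ?thesis by (intro that[of "fst \<circ> p" "snd \<circ> p"]) auto
  qed
  have [measurable]: "g k \<in> borel_measurable M" for k
    using S_sq[OF g[of k]] by (simp add: square_integrable_def)
  \<comment> \<open>The default \<open>c 0\<close> places \<open>G\<close> in \<open>K\<close> at
    every point, also where the subsequence diverges.\<close>
  define G where "G \<omega> = (if convergent (\<lambda>k. g (r k) \<omega>) then lim (\<lambda>k. g (r k) \<omega>) else c 0)" for \<omega>
  have GK: "G \<omega> \<in> K" for \<omega>
  proof (cases "convergent (\<lambda>k. g (r k) \<omega>)")
    case True
    then have "(\<lambda>k. g (r k) \<omega>) \<longlonglongrightarrow> G \<omega>" by (simp add: G_def convergent_LIMSEQ_iff)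
    then show ?thesis
      by (rule closed_sequentially[OF compact_imp_closed[OF compact] S_K[OF g]])
  qed (simp add: G_def c)
  have Gm [measurable]: "G \<in> borel_measurable M"
    unfolding G_def[abs_def] Cauchy_convergent_iff[symmetric]
    by (intro measurable_If borel_measurable_lim_metric sets_Collect_Cauchy) auto
  have Glim: "AE \<omega> in M. (\<lambda>k. g (r k) \<omega>) \<longlonglongrightarrow> G \<omega>"
    using conv by eventually_elim (simp add: G_def convergent_LIMSEQ_iff)
  have Gsq: "square_integrable M G" by (rule square_integrable_bounded[OF Gm R[OF GK]])
  have limG: "tendsto_L2 M (\<lambda>k. g (r k)) G"
    unfolding tendsto_L2_iff[OF S_sq[OF g] Gsq]
  proof -
    have "(\<lambda>k. \<integral>\<omega>. (norm (g (r k) \<omega> - G \<omega>))\<^sup>2 \<partial>M) \<longlonglongrightarrow> (\<integral>\<omega>. 0 \<partial>M)"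
    proof (rule integral_dominated_convergence[where w="\<lambda>_. (2 * R)\<^sup>2"])
      show "AE \<omega> in M. (\<lambda>k. (norm (g (r k) \<omega> - G \<omega>))\<^sup>2) \<longlonglongrightarrow> 0"
        using Glim
      proof eventually_elim
        case (elim \<omega>)
        then have "(\<lambda>k. (norm (g (r k) \<omega> - G \<omega>))\<^sup>2) \<longlonglongrightarrow> (norm (G \<omega> - G \<omega>))\<^sup>2" by (intro tendsto_intros)
        then show ?case by simp
      qed
      show "AE \<omega> in M. norm ((norm (g (r k) \<omega> - G \<omega>))\<^sup>2) \<le> (2 * R)\<^sup>2" for k
      proof (intro AE_I2)
        fix \<omega>
        have "norm (g (r k) \<omega> - G \<omega>) \<le> 2 * R"
          using norm_triangle_ineq4[of "g (r k) \<omega>" "G \<omega>"] R[OF GK[of \<omega>]] R[OF S_K[OF g], of "r k" \<omega>] by linarith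
        then have "(norm (g (r k) \<omega> - G \<omega>))\<^sup>2 \<le> (2 * R)\<^sup>2" by (intro power_mono) auto
        then show "norm ((norm (g (r k) \<omega> - G \<omega>))\<^sup>2) \<le> (2 * R)\<^sup>2" by simp
      qed
    qed auto
    then show "(\<lambda>k. \<integral>\<omega>. (norm (g (r k) \<omega> - G \<omega>))\<^sup>2 \<partial>M) \<longlonglongrightarrow> 0" by simp
  qed
  have alg: "lse_algebra (N k) (f k)" and close: "AE \<omega> in M. \<bar>?F (f k) \<omega> - h \<omega>\<bar> \<le> \<epsilon> k \<omega>" for k
    using f[of k] by (auto simp: T_def)
  then have close_all: "AE \<omega> in M. \<forall>k. \<bar>?F (f k) \<omega> - h \<omega>\<bar> \<le> \<epsilon> k \<omega>"
    by (simp add: AE_all_countable)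
  have fsq: "square_integrable M (?F (f k))" for k
    by (rule smooth_malliavin_square_integrable(1)[OF smooth[OF alg]])
  have limF: "tendsto_L2 M (\<lambda>k. ?F (f (r k))) h"
    unfolding tendsto_L2_iff[OF fsq h]
  proof -
    have [measurable]: "?F (f k) \<in> borel_measurable M" for k using fsq[of k] by (simp add: square_integrable_def)
    \<comment> \<open>This function is \<open>\<epsilon> 0\<close>, for \<open>mx 0\<close> is
      \<open>X (c 0)\<close>.\<close>
    have dom: "square_integrable M (\<lambda>\<omega>. h \<omega> - (X (c 0) \<omega> - 1))"
      by (intro square_integrable_diff h exp_growth_square_integrable exp_growth_diff exp_growth_X exp_growth_const)
    have "(\<lambda>k. \<integral>\<omega>. (norm (?F (f (r k)) \<omega> - h \<omega>))\<^sup>2 \<partial>M) \<longlonglongrightarrow> (\<integral>\<omega>. 0 \<partial>M)"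
    proof (rule integral_dominated_convergence[where w="\<lambda>\<omega>. (norm (h \<omega> - (X (c 0) \<omega> - 1)))\<^sup>2"])
      show "AE \<omega> in M. (\<lambda>k. (norm (?F (f (r k)) \<omega> - h \<omega>))\<^sup>2) \<longlonglongrightarrow> 0"
        using bdd close_all
      proof eventually_elim
        case (elim \<omega>)
        have "(\<lambda>k. ?F (f (r k)) \<omega> - h \<omega>) \<longlonglongrightarrow> 0"
          by (rule Lim_null_comparison[OF _ LIMSEQ_subseq_LIMSEQ[OF \<epsilon>_lim[OF elim(1)] r]]) (use elim(2) in auto)
        then have "(\<lambda>k. (norm (?F (f (r k)) \<omega> - h \<omega>))\<^sup>2) \<longlonglongrightarrow> (norm (0 :: real))\<^sup>2" by (intro tendsto_intros)
        then show ?case by simp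
      qed
      show "AE \<omega> in M. norm ((norm (?F (f (r k)) \<omega> - h \<omega>))\<^sup>2) \<le> (norm (h \<omega> - (X (c 0) \<omega> - 1)))\<^sup>2" for k
        using close[of "r k"]
      proof eventually_elim
        case (elim \<omega>)
        have "\<epsilon> (r k) \<omega> \<le> \<epsilon> 0 \<omega>" by (rule \<epsilon>_mono) simp
        also have "\<epsilon> 0 \<omega> = h \<omega> - (X (c 0) \<omega> - 1)" by (simp add: \<epsilon>_def mx_def)
        finally have "norm (?F (f (r k)) \<omega> - h \<omega>) \<le> norm (h \<omega> - (X (c 0) \<omega> - 1))" using elim by simp
        from power_mono[OF this, of 2] show ?case by simp
      qed
    qed (use dom in \<open>auto simp: square_integrable_def\<close>)
    then show "(\<lambda>k. \<integral>\<omega>. (norm (?F (f (r k)) \<omega> - h \<omega>))\<^sup>2 \<partial>M) \<longlonglongrightarrow> 0" by simp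
  qed
  have "has_malliavin_derivative M X h G"
    unfolding has_malliavin_derivative_def
    using h Gsq limF limG smooth[OF alg] gf by (intro conjI exI[of _ "\<lambda>k. ?F (f (r k))"] exI[of _ "\<lambda>k. g (r k)"]) auto
  then show ?thesis using GK unfolding h_def by (rule that)
qed

end

section \<open>Averages over Cameron-Martin shifts\<close>

lemma exp_bounded_shift_density:
  assumes "0 < s"
  shows "exp_bounded (\<lambda>x. exp (s * x - s\<^sup>2 / 2))"
proof (rule exp_boundedI)
  fix x :: real
  have "s * x \<le> s * \<bar>x\<bar>" using assms by (intro mult_left_mono) auto
  then have "s * x - s\<^sup>2 / 2 \<le> s * \<bar>x\<bar>" using zero_le_power2[of s] by linarith
  then show "\<bar>exp (s * x - s\<^sup>2 / 2)\<bar> \<le> 1 * exp (s * \<bar>x\<bar>)" by simp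
qed

text \<open>
  The weight is \<open>\<Psi> x = exp (x\<^sup>2 / 2) * (\<integral>y=x-s..x. exp (- y\<^sup>2 / 2))\<close>, which equals
  \<open>\<integral>r=0..s. exp (r * x - r\<^sup>2 / 2)\<close>: integrating against \<open>\<Psi> (X u)\<close> averages over the
  Cameron-Martin shifts by \<open>r u\<close>, \<open>0 \<le> r \<le> s\<close>.
\<close>

lemma shift_average_weight:
  assumes s: "0 < s"
  obtains \<Psi> where "\<forall>x. (\<Psi> has_real_derivative (x * \<Psi> x + 1 - exp (s * x - s\<^sup>2 / 2))) (at x)"
    "\<forall>x. 0 \<le> \<Psi> x" "exp_bounded \<Psi>"
    "continuous_on UNIV (\<lambda>x. x * \<Psi> x + 1 - exp (s * x - s\<^sup>2 / 2))"
    "exp_bounded (\<lambda>x. x * \<Psi> x + 1 - exp (s * x - s\<^sup>2 / 2))"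
proof -
  let ?e = "\<lambda>x::real. exp (- x\<^sup>2 / 2)"
  have "\<exists>F. \<forall>x::real. -\<infinity> < ereal x \<longrightarrow> ereal x < \<infinity> \<longrightarrow> (F has_vector_derivative ?e x) (at x)"
    by (rule einterval_antiderivative) (auto intro!: continuous_intros)
  then obtain Q where Q: "\<And>x. (Q has_real_derivative ?e x) (at x)"
    by (auto simp: has_real_derivative_iff_has_vector_derivative)
  define \<Psi> where "\<Psi> x = exp (x\<^sup>2 / 2) * (Q x - Q (x - s))" for x
  have deriv: "(\<Psi> has_real_derivative (x * \<Psi> x + 1 - exp (s * x - s\<^sup>2 / 2))) (at x)" for x
  proof -
    have "((\<lambda>x. Q (x - s)) has_real_derivative ?e (x - s) * 1) (at x)"
      by (rule DERIV_chain2[OF Q]) (auto intro!: derivative_eq_intros)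
    then have Qs: "((\<lambda>x. Q (x - s)) has_real_derivative ?e (x - s)) (at x)" by simp
    have e: "((\<lambda>x. exp (x\<^sup>2 / 2)) has_real_derivative x * exp (x\<^sup>2 / 2)) (at x)"
      by (rule derivative_eq_intros refl | simp)+
    have "exp (x\<^sup>2 / 2) * ?e x = 1" by (simp flip: exp_add)
    moreover have "exp (x\<^sup>2 / 2) * ?e (x - s) = exp (s * x - s\<^sup>2 / 2)"
      unfolding exp_add[symmetric] by (simp add: field_simps power2_eq_square)
    ultimately have "exp (x\<^sup>2 / 2) * (?e x - ?e (x - s)) = 1 - exp (s * x - s\<^sup>2 / 2)"
      by (simp only: right_diff_distrib)
    then show ?thesis
      unfolding \<Psi>_def by (intro DERIV_cong[OF DERIV_mult[OF e DERIV_diff[OF Q[of x] Qs]]]) (simp add: algebra_simps)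
  qed
  \<comment> \<open>By the mean value theorem with \<open>r = x - z\<close>, the average over shifts
    equals \<open>s\<close> times the density of a single shift; positivity and the exponential
    bound both follow.\<close>
  have val: "\<exists>r. 0 < r \<and> r < s \<and> \<Psi> x = s * exp (r * x - r\<^sup>2 / 2)" for x
  proof -
    obtain z where z: "x - s < z" "z < x" "Q x - Q (x - s) = (x - (x - s)) * ?e z"
      using MVT2[of "x - s" x Q ?e] Q s by auto
    have "exp (x\<^sup>2 / 2) * ?e z = exp ((x - z) * x - (x - z)\<^sup>2 / 2)"
      unfolding exp_add[symmetric] by (simp add: field_simps power2_eq_square)
    then have "\<Psi> x = s * exp ((x - z) * x - (x - z)\<^sup>2 / 2)"
      unfolding \<Psi>_def z(3) by (simp add: mult_ac)
    with z show ?thesis by (intro exI[of _ "x - z"]) auto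
  qed
  have le: "\<bar>\<Psi> x\<bar> \<le> s * exp (s * \<bar>x\<bar>)" and pos: "0 \<le> \<Psi> x" for x
  proof -
    obtain r where r: "0 < r" "r < s" "\<Psi> x = s * exp (r * x - r\<^sup>2 / 2)" using val by blast
    have "r * x \<le> r * \<bar>x\<bar>" using r by (intro mult_left_mono) auto
    also have "\<dots> \<le> s * \<bar>x\<bar>" using r by (intro mult_right_mono) auto
    finally have "r * x - r\<^sup>2 / 2 \<le> s * \<bar>x\<bar>" using zero_le_power2[of r] by linarith
    then show "\<bar>\<Psi> x\<bar> \<le> s * exp (s * \<bar>x\<bar>)" "0 \<le> \<Psi> x" using r s by (simp_all add: abs_mult)
  qed
  have bd: "exp_bounded \<Psi>" using le by (rule exp_boundedI)
  let ?\<phi> = "\<lambda>x. exp (s * x - s\<^sup>2 / 2)"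
  have c\<Psi>: "continuous_on UNIV \<Psi>" by (meson DERIV_isCont continuous_at_imp_continuous_on deriv)
  have c': "continuous_on UNIV (\<lambda>x. x * \<Psi> x + 1 - ?\<phi> x)" by (intro continuous_intros c\<Psi>) auto
  have bd': "exp_bounded (\<lambda>x. x * \<Psi> x + 1 - ?\<phi> x)"
    using exp_bounded_add[OF exp_bounded_add[OF exp_bounded_mult[OF exp_bounded_id bd] exp_bounded_const[of 1]]
        exp_bounded_mult[OF exp_bounded_const[of "-1"] exp_bounded_shift_density[OF s]]] by simp
  show ?thesis using deriv pos bd c' bd' by (intro that[of \<Psi>]) blast+
qed

context isonormal_gaussian_process
begin

text \<open>The exponential is the density of the shift by \<open>s\<close> along \<open>u\<close>,
  under which \<open>X u\<close> becomes normal with mean \<open>s\<close> and variance one.\<close>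

lemma expectation_shift:
  assumes u: "norm u = 1"
  shows "expectation (\<lambda>\<omega>. X u \<omega> * exp (s * X u \<omega> - s\<^sup>2 / 2)) = s"
proof -
  have "u \<noteq> 0" using u by auto
  from distributed_X[OF this] have d: "distributed M lborel (X u) std_normal_density" by (simp add: u)
  have "expectation (\<lambda>\<omega>. X u \<omega> * exp (s * X u \<omega> - s\<^sup>2 / 2)) =
      (\<integral>x. std_normal_density x * (x * exp (s * x - s\<^sup>2 / 2)) \<partial>lborel)"
    using distributed_integral[OF d, of "\<lambda>x. x * exp (s * x - s\<^sup>2 / 2)"] by simp
  also have "\<dots> = (\<integral>x. normal_density s 1 x * x \<partial>lborel)"
  proof (rule Bochner_Integration.integral_cong[OF refl])
    fix x
    have "std_normal_density x * exp (s * x) = exp (s\<^sup>2 / 2) * normal_density s 1 x"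
      using normal_density_times_exp[of 1 x s] by simp
    then have "x * (std_normal_density x * exp (s * x)) / exp (s\<^sup>2 / 2) = normal_density s 1 x * x"
      by simp
    then show "std_normal_density x * (x * exp (s * x - s\<^sup>2 / 2)) = normal_density s 1 x * x"
      by (simp add: exp_diff mult_ac)
  qed
  also have "\<dots> = s" by (rule integral_normal_moment_nz_1) simp
  finally show ?thesis .
qed

text \<open>Integration by parts with test function \<open>\<Psi> (X u)\<close>: the differential
  equation of \<open>\<Psi>\<close> collapses \<open>x * \<Psi> x\<close> minus its derivative to
  the shift density minus one. The variable \<open>X p\<close> has the constant derivative
  \<open>p\<close>.\<close>

lemma shift_average_linear:
  assumes u: "norm u = 1"
    and \<Psi>: "\<And>x. (\<Psi> has_real_derivative (x * \<Psi> x + 1 - exp (s * x - s\<^sup>2 / 2))) (at x)"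
      "continuous_on UNIV (\<lambda>x. x * \<Psi> x + 1 - exp (s * x - s\<^sup>2 / 2))"
      "exp_bounded \<Psi>" "exp_bounded (\<lambda>x. x * \<Psi> x + 1 - exp (s * x - s\<^sup>2 / 2))"
  shows "expectation (\<lambda>\<omega>. (p \<bullet> u) * \<Psi> (X u \<omega>)) = expectation (\<lambda>\<omega>. X p \<omega> * (exp (s * X u \<omega> - s\<^sup>2 / 2) - 1))"
proof -
  \<comment> \<open>With one variable and \<open>\<beta> = 1\<close> this is just the first
    coordinate, whose smoothness is already available.\<close>
  define f where "f = log_sum_exp 1 1"
  have f: "smooth_poly_growth 1 f"
    unfolding f_def by (rule smooth_poly_growth_lse_algebra[OF lse_algebra.log_sum_exp]) auto
  have fx: "f x = x 0" for x by (simp add: f_def log_sum_exp_def partition_sum_def)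
  have df: "partial_deriv 0 f x = 1" for x
    by (simp add: partial_deriv_def fx)
  have "u \<bullet> u = 1" using u by (simp add: norm_eq_1)
  then show ?thesis
    using integration_by_parts_smooth[OF f u \<Psi>, of "\<lambda>_. p" u] by (simp add: df fx)
qed

text \<open>The nonnegative variable \<open>h - X p\<close> keeps a nonnegative mean under the shift
  by \<open>s\<close> along \<open>u\<close>, while integration by parts shows that the shift
  changes this mean by at most \<open>(b - p \<bullet> u) * s\<close>. If
  \<open>b < p \<bullet> u\<close>, a large \<open>s\<close> makes this impossible.\<close>

lemma inner_le_malliavin_derivative_bound:
  assumes hG: "has_malliavin_derivative M X h G" and u: "norm u = 1"
    and ge: "AE \<omega> in M. X p \<omega> \<le> h \<omega>" and le: "AE \<omega> in M. G \<omega> \<bullet> u \<le> b"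
  shows "p \<bullet> u \<le> b"
proof (rule ccontr)
  assume "\<not> p \<bullet> u \<le> b"
  then have d: "0 < p \<bullet> u - b" by simp
  have h: "square_integrable M h" and G: "square_integrable M G"
    using hG by (auto simp: has_malliavin_derivative_def)
  have Xp: "square_integrable M (X p)" by (intro exp_growth_square_integrable exp_growth_X)
  have one: "square_integrable M (\<lambda>_. 1 :: real)" by (intro exp_growth_square_integrable exp_growth_const)
  have hX: "square_integrable M (\<lambda>\<omega>. h \<omega> - X p \<omega>)" by (intro square_integrable_diff h Xp)
  have ihX: "integrable M (\<lambda>\<omega>. h \<omega> - X p \<omega>)" using integrable_mult_L2[OF hX one] by simp
  define E where "E = expectation (\<lambda>\<omega>. h \<omega> - X p \<omega>)"
  have main: "(p \<bullet> u - b) * s \<le> E" if s: "0 < s" for s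
  proof -
    let ?\<phi> = "\<lambda>x. exp (s * x - s\<^sup>2 / 2)"
    obtain \<Psi> where \<Psi>1: "\<forall>x. (\<Psi> has_real_derivative (x * \<Psi> x + 1 - ?\<phi> x)) (at x)"
      and pos: "\<forall>x. 0 \<le> \<Psi> x" and \<Psi>3: "exp_bounded \<Psi>"
      and \<Psi>2: "continuous_on UNIV (\<lambda>x. x * \<Psi> x + 1 - ?\<phi> x)"
      and \<Psi>4: "exp_bounded (\<lambda>x. x * \<Psi> x + 1 - ?\<phi> x)"
      by (rule shift_average_weight[OF s])
    note \<Psi> = \<Psi>1[rule_format] \<Psi>2 \<Psi>3 \<Psi>4
    have "continuous_on UNIV \<Psi>" by (meson DERIV_isCont continuous_at_imp_continuous_on \<Psi>1[rule_format])
    then have [measurable]: "\<Psi> \<in> borel_measurable borel" by (rule borel_measurable_continuous_onI)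
    note bd\<phi> = exp_bounded_shift_density[OF s]
    have T: "square_integrable M (\<lambda>\<omega>. \<Psi> (X u \<omega>))"
      by (intro exp_growth_square_integrable exp_growth_comp_X \<Psi>3) measurable
    have T': "square_integrable M (\<lambda>\<omega>. ?\<phi> (X u \<omega>) - 1)"
      by (intro square_integrable_diff one exp_growth_square_integrable exp_growth_comp_X[OF bd\<phi>]) measurable
    have "u \<bullet> u = 1" using u by (simp add: norm_eq_1)
    then have lhs: "expectation (\<lambda>\<omega>. (G \<omega> \<bullet> u) * \<Psi> (X u \<omega>)) = expectation (\<lambda>\<omega>. h \<omega> * (?\<phi> (X u \<omega>) - 1))"
      using integration_by_parts[OF hG u \<Psi>, of u] by simp
    have i\<Psi>: "integrable M (\<lambda>\<omega>. \<Psi> (X u \<omega>))" using integrable_mult_L2[OF T one] by simp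
    \<comment> \<open>Each shift density has mean one, so their integral over
      \<open>0 \<le> r \<le> s\<close> has mean \<open>s\<close>; the linear case with
      \<open>p = u\<close> yields this value.\<close>
    have E\<Psi>: "expectation (\<lambda>\<omega>. \<Psi> (X u \<omega>)) = s"
    proof -
      have "square_integrable M (\<lambda>\<omega>. ?\<phi> (X u \<omega>))"
        by (intro exp_growth_square_integrable exp_growth_comp_X[OF bd\<phi>]) measurable
      moreover have "square_integrable M (X u)" by (intro exp_growth_square_integrable exp_growth_X)
      ultimately have "integrable M (\<lambda>\<omega>. X u \<omega> * ?\<phi> (X u \<omega>))" "integrable M (X u)"
        using integrable_mult_L2[of M "X u" "\<lambda>_. 1"] one by (auto intro: integrable_mult_L2)
      then have "expectation (\<lambda>\<omega>. X u \<omega> * (?\<phi> (X u \<omega>) - 1)) = s"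
        using expectation_shift[OF u, of s] centred[of u] by (simp add: right_diff_distrib)
      then show ?thesis
        using shift_average_linear[OF u \<Psi>, of u] \<open>u \<bullet> u = 1\<close> by simp
    qed
    have "- E = expectation (\<lambda>\<omega>. - (h \<omega> - X p \<omega>))"
      unfolding E_def by (rule Bochner_Integration.integral_minus[symmetric])
    also have "\<dots> \<le> expectation (\<lambda>\<omega>. (h \<omega> - X p \<omega>) * (?\<phi> (X u \<omega>) - 1))"
    proof (rule integral_mono_AE)
      show "AE \<omega> in M. - (h \<omega> - X p \<omega>) \<le> (h \<omega> - X p \<omega>) * (?\<phi> (X u \<omega>) - 1)"
        using ge
      proof eventually_elim
        case (elim \<omega>)
        then have "0 \<le> (h \<omega> - X p \<omega>) * ?\<phi> (X u \<omega>)" by simp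
        then show ?case by (simp add: right_diff_distrib)
      qed
      show "integrable M (\<lambda>\<omega>. - (h \<omega> - X p \<omega>))" using ihX by (rule Bochner_Integration.integrable_minus)
      show "integrable M (\<lambda>\<omega>. (h \<omega> - X p \<omega>) * (?\<phi> (X u \<omega>) - 1))" by (rule integrable_mult_L2[OF hX T'])
    qed
    also have "\<dots> = expectation (\<lambda>\<omega>. h \<omega> * (?\<phi> (X u \<omega>) - 1)) - expectation (\<lambda>\<omega>. X p \<omega> * (?\<phi> (X u \<omega>) - 1))"
      using integrable_mult_L2[OF h T'] integrable_mult_L2[OF Xp T']
      by (simp only: left_diff_distrib Bochner_Integration.integral_diff)
    also have "\<dots> = expectation (\<lambda>\<omega>. (G \<omega> \<bullet> u) * \<Psi> (X u \<omega>)) - expectation (\<lambda>\<omega>. (p \<bullet> u) * \<Psi> (X u \<omega>))"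
      by (simp only: lhs shift_average_linear[OF u \<Psi>])
    also have "expectation (\<lambda>\<omega>. (G \<omega> \<bullet> u) * \<Psi> (X u \<omega>)) \<le> expectation (\<lambda>\<omega>. b * \<Psi> (X u \<omega>))"
    proof (rule integral_mono_AE)
      show "AE \<omega> in M. (G \<omega> \<bullet> u) * \<Psi> (X u \<omega>) \<le> b * \<Psi> (X u \<omega>)"
        using le by eventually_elim (intro mult_right_mono pos[rule_format])
    qed (use i\<Psi> integrable_mult_L2[OF square_integrable_inner_right[OF G] T] in auto)
    finally show ?thesis using E\<Psi> by (simp add: algebra_simps)
  qed
  \<comment> \<open>This shift length makes the left-hand side equal to
    \<open>\<bar>E\<bar> + 1\<close>.\<close>
  have "(p \<bullet> u - b) * ((\<bar>E\<bar> + 1) / (p \<bullet> u - b)) \<le> E"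
    using d by (intro main divide_pos_pos) auto
  then show False using d by (simp split: abs_split)
qed

end

section \<open>The essential range\<close>

text \<open>A value outside the essential range has a basic open neighbourhood that misses the
  closed range of some version, hence is almost surely avoided by \<open>f\<close>. A countable
  basis has only countably many such sets, so one null set covers all of them.\<close>

lemma (in prob_space) AE_in_essential_range:
  fixes f :: "'a \<Rightarrow> 'b::second_countable_topology"
  shows "AE \<omega> in M. f \<omega> \<in> essential_range M f"
proof -
  obtain B :: "'b set set" where B: "countable B" "topological_basis B"
    using ex_countable_basis by blast
  define B0 where "B0 = {b \<in> B. AE \<omega> in M. f \<omega> \<notin> b}"
  have "AE \<omega> in M. \<forall>b\<in>B0. f \<omega> \<notin> b"
    by (subst AE_ball_countable) (use B(1) in \<open>auto simp: B0_def\<close>)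
  then show ?thesis
  proof eventually_elim
    case (elim \<omega>)
    show ?case
    proof (rule ccontr)
      assume "f \<omega> \<notin> essential_range M f"
      then obtain u where u: "AE \<omega> in M. u \<omega> = f \<omega>" and nin: "f \<omega> \<in> - closure (u ` space M)"
        by (auto simp: essential_range_def)
      obtain b where b: "b \<in> B" "f \<omega> \<in> b" "b \<subseteq> - closure (u ` space M)"
        using topological_basisE[OF B(2) _ nin] by auto
      have "AE \<omega> in M. f \<omega> \<notin> b"
        using u AE_space
      proof eventually_elim
        case (elim \<omega>)
        then have "f \<omega> \<in> closure (u ` space M)" by (metis closure_subset imageI subsetD)
        then show ?case using b(3) by blast
      qed
      then have "b \<in> B0" using b(1) by (simp add: B0_def)
      then show False using elim b(2) by blast
    qed
  qed
qed

text \<open>Redirecting the exceptional values to one point of \<open>K\<close> gives a version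
  whose closed range lies in \<open>K\<close>, and this version takes part in the
  intersection.\<close>

lemma essential_range_subset_closed:
  fixes f :: "'a \<Rightarrow> 'b::topological_space"
  assumes f [measurable]: "f \<in> borel_measurable M" and K: "closed K" "K \<noteq> {}"
    and AE: "AE \<omega> in M. f \<omega> \<in> K"
  shows "essential_range M f \<subseteq> K"
proof -
  obtain k where k: "k \<in> K" using K(2) by blast
  define u where "u \<omega> = (if f \<omega> \<in> K then f \<omega> else k)" for \<omega>
  have [measurable]: "K \<in> sets borel" using K(1) by simp
  have "u \<in> borel_measurable M" unfolding u_def[abs_def] by measurable
  moreover have "AE \<omega> in M. u \<omega> = f \<omega>" using AE by eventually_elim (simp add: u_def)
  ultimately have "essential_range M f \<subseteq> closure (u ` space M)"
    unfolding essential_range_def by blast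
  also have "\<dots> \<subseteq> K" using k by (intro closure_minimal K(1)) (auto simp: u_def)
  finally show ?thesis .
qed

theorem corollary4p13:
  fixes M :: "'a measure"
    and X :: "'h::{real_inner, banach, second_countable_topology} \<Rightarrow> 'a \<Rightarrow> real"
    and K C :: "'h set"
  assumes infinite_dimensional: "\<not> (\<exists>B :: 'h set. finite B \<and> span B = UNIV)"
    and isonormal: "isonormal_gaussian_process M X"
    and body: "convex_body K"
    and GB: "gaussian_bounded M X K"
    and dense: "countable C" "C \<subseteq> K" "K \<subseteq> closure C"
  shows "closure (convex hull (essential_range M (malliavin_deriv M X (support_rv X C)))) = K"
proof -
  interpret isonormal_gaussian_process M X by (rule isonormal)
  have K: "K \<noteq> {}" "compact K" "convex K" using body by (auto simp: convex_body_def)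
  then have "C \<noteq> {}" using dense(3) by auto
  define c where "c = from_nat_into C"
  have range_c: "range c = C"
    unfolding c_def using \<open>C \<noteq> {}\<close> dense(1) by (rule range_from_nat_into)
  have bdd: "AE \<omega> in M. bdd_above ((\<lambda>v. X v \<omega>) ` C)"
    using GB dense unfolding gaussian_bounded_def by blast
  have cK: "c i \<in> K" for i using range_c dense(2) by blast
  have bdd': "AE \<omega> in M. bdd_above (range (\<lambda>i. X (c i) \<omega>))"
    using bdd unfolding range_c[symmetric] image_image .
  define h where "h = support_rv X C"
  define G where "G = malliavin_deriv M X h"
  obtain G0 where G0: "has_malliavin_derivative M X h G0" and G0K: "\<And>\<omega>. G0 \<omega> \<in> K"
    using malliavin_derivative_exists[OF body cK bdd'] unfolding range_c h_def by blast
  \<comment> \<open>\<open>G\<close> is an unspecified choice among all derivatives; its values are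
    located in \<open>K\<close> only through almost sure equality with \<open>G0\<close>.\<close>
  have G: "has_malliavin_derivative M X h G"
    unfolding G_def malliavin_deriv_def by (rule someI[of "has_malliavin_derivative M X h", OF G0])
  have GK: "AE \<omega> in M. G \<omega> \<in> K"
    using malliavin_derivative_unique[OF G G0] by eventually_elim (simp add: G0K)
  have Gm: "G \<in> borel_measurable M"
    using G by (simp add: has_malliavin_derivative_def square_integrable_def)
  define L where "L = closure (convex hull (essential_range M G))"
  have Gess: "AE \<omega> in M. G \<omega> \<in> L"
    using AE_in_essential_range[of G]
  proof eventually_elim
    case (elim \<omega>)
    then show ?case unfolding L_def by (intro closure_subset[THEN subsetD] hull_inc)
  qed
  have "essential_range M G \<subseteq> K"
    by (rule essential_range_subset_closed[OF Gm compact_imp_closed[OF K(2)] K(1) GK])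
  then have LK: "L \<subseteq> K"
    unfolding L_def by (intro closure_minimal hull_minimal K(3) compact_imp_closed[OF K(2)])
  have L: "convex L" "closed L" by (auto simp: L_def convex_closure)
  moreover have "K \<subseteq> L"
  proof (rule ccontr)
    assume "\<not> K \<subseteq> L"
    then obtain x where x: "x \<in> K" "x \<notin> L" by blast
    have "L \<noteq> {}" using Gess by auto
    \<comment> \<open>\<open>L\<close> is compact as a closed subset of \<open>K\<close>, so a
      nearest point to \<open>x\<close> exists; the direction from it to \<open>x\<close> is the
      normal of a separating hyperplane.\<close>
    have "continuous_on L (dist x)" by (intro continuous_intros)
    moreover have "compact L" using compact_Int_closed[OF K(2) L(2)] LK by (simp add: Int_absorb1)
    ultimately obtain q where q: "q \<in> L" "\<forall>z\<in>L. dist x q \<le> dist x z"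
      using continuous_attains_inf[of L "dist x"] \<open>L \<noteq> {}\<close> by blast
    define w where "w = x - q"
    have "w \<noteq> 0" using x q by (auto simp: w_def)
    define u where "u = w /\<^sub>R norm w"
    have u: "norm u = 1" using \<open>w \<noteq> 0\<close> by (simp add: u_def)
    have Lu: "z \<bullet> u \<le> q \<bullet> u" if "z \<in> L" for z
    proof -
      have "w \<bullet> (z - q) \<le> 0"
        unfolding w_def by (rule any_closest_point_dot[OF L q(1) that q(2)])
      then have "(z - q) \<bullet> u \<le> 0"
        by (simp add: u_def inner_commute mult_nonneg_nonpos)
      then show ?thesis by (simp add: inner_diff_left)
    qed
    have "0 < w \<bullet> u" using \<open>w \<noteq> 0\<close> by (simp add: u_def dot_square_norm power2_eq_square)
    then have "x \<in> {y. q \<bullet> u < y \<bullet> u}" by (simp add: w_def inner_diff_left)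
    moreover have "open {y. q \<bullet> u < y \<bullet> u}" by (intro open_Collect_less continuous_intros)
    moreover have "x \<in> closure C" using x dense(3) by blast
    \<comment> \<open>The strict inequality is an open condition, so it passes from \<open>x\<close>
      to a point of the dense set \<open>C\<close>. This matters because \<open>X p\<close> is known
      to lie below the support function only for \<open>p\<close> in \<open>C\<close>.\<close>
    ultimately obtain p where p: "p \<in> C" "q \<bullet> u < p \<bullet> u"
      using open_Int_closure_eq_empty[of "{y. q \<bullet> u < y \<bullet> u}" C] by blast
    have "p \<bullet> u \<le> q \<bullet> u"
    proof (rule inner_le_malliavin_derivative_bound[OF G u])
      show "AE \<omega> in M. X p \<omega> \<le> h \<omega>"
        using bdd unfolding h_def support_rv_def by eventually_elim (rule cSUP_upper[OF p(1)])
      show "AE \<omega> in M. G \<omega> \<bullet> u \<le> q \<bullet> u"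
        using Gess by eventually_elim (rule Lu)
    qed
    with p(2) show False by simp
  qed
  ultimately have "L = K" using LK by blast
  then show ?thesis by (simp add: L_def G_def h_def)
qed

end
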